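(* Let $\mathbb F$ be a field of characteristic zero, $0\ne\gamma\in\mathbb F$, and let $\theta_{1,\gamma}\in\mathrm{Aut}_{\mathbb F\text{-alg}}\mathbb F[h]$ send $h$ to $h+\gamma$. Fix $f\in\mathbb F[h]$ and $s\in\mathbb F^\times$ not a root of unity, and integers $l,m,n$ with $l\ne0$. Let $q$ be an indeterminate and let $$\mathcal W_q(l,m,n):=\mathcal W\Big(\mathbb F(q)[K^{\pm1}],\ \theta:K\mapsto q^{-l}K,\ z_0=s^{-1}q^mK^nf\Big(\tfrac{-\gamma}{l}\cdot\tfrac{K-1}{q-1}\Big),\ z_1=s^{-1}\Big)$$ be the triangular generalized Weyl algebra over $\mathbb F(q)$. Let $R\subset\mathbb F(q)$ be the local subring of rational functions regular at $q=1$, and let $\mathcal W_q^R(l,m,n)$ be the unital $R$-subalgebra of $\mathcal W_q(l,m,n)$ generated by $U,D,K^{\pm1}$ and $(K-1)/(q-1)$, where $U,D$ denote the generators $u,d$ of $\mathcal W_q(l,m,n)$. Then $$\mathcal W_1:=\mathcal W_q^R(l,m,n)/(q-1)\mathcal W_q^R(l,m,n)\ \cong\ \mathcal W(\mathbb F[h],\theta_{1,\gamma},s^{-1}f(h),s^{-1}).$$ Now fix a scalar $\lambda\in\mathbb F(q)^\times$ such that $\frac{\lambda-1}{q-1}\in R$, and a highest weight module $M_q(\lambda)\twoheadrightarrow\mathbb V^\lambda_q$ over $\mathcal W_q(l,m,n)$, where $\lambda$ is identified with the $\mathbb F(q)$-weight of $\mathbb F(q)[K^{\pm1}]$ sending $K$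 to $\lambda$. If $v_\lambda\in(\mathbb V_q^\lambda)_\lambda$ generates $\mathbb V_q^\lambda$, then $$\mathbb V_1^\lambda:=\mathcal W_q^R(l,m,n)v_\lambda/(q-1)\mathcal W_q^R(l,m,n)v_\lambda$$ is a highest weight module over $\mathcal W_1\cong\mathcal W(\mathbb F[h],\theta_{1,\gamma},s^{-1}f(h),s^{-1})$ with highest $\mathbb F[h]$-weight given by $h\mapsto\frac{-\gamma}{l}\cdot\frac{\lambda-1}{q-1}\Big|_{q\to1}$, and with the same graded character as $\mathbb V_q^\lambda$ (up to modification of the highest weight).
   Context: For a field $k$, a $k$-algebra $H$, a $k$-algebra map $\theta:H\to H$ and $z_0,z_1\in H$, the *triangular generalized Weyl algebra* is $$\mathcal W(H,\theta,z_0,z_1):=H\langle d,u\rangle/(uh=\theta(h)u,\ hd=d\theta(h),\ ud=z_0+dz_1u\ \ \forall h\in H).$$ For a weight $\lambda$ (a $k$-algebra map $H\to k$), the Verma module is $M(\lambda)=\mathcal W/(\mathcal W u+\mathcal W\ker\lambda)$ (written $M_q(\lambda)$ over $\mathcal W_q(l,m,n)$), and a highest weight module of highest weight $\lambda$ is a nonzero quotient of $M(\lambda)$. The weight space of weight $\mu$ is the set of vectors on which $H$ acts via $\mu$. "Same graded character up to modification of the highest weight" means: for each $i\ge0$, the dimension over $\mathbb F(q)$ of the weight space of $\mathbb V_q^\lambda$ of weight $\lambda\circ\theta^i$ (spanned by $D^iv_\lambda$) equals the dimension over $\mathbb F$ of the weight space of $\mathbb V_1^\lambda$ of weight $\lambda_1\circ\theta_{1,\gamma}^i$,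 where $\lambda_1$ is the highest weight of $\mathbb V_1^\lambda$. *)

theory Defs
  imports
    "HOL-Algebra.QuotRing"
    "HOL-Algebra.Generated_Rings"
    "HOL-Library.Poly_Mapping"
    "HOL-Computational_Algebra.Polynomial_Factorial"
    "Jordan_Normal_Form.VS_Connect"
begin

section \<open>Free associative algebras\<close>

text \<open>Words form the free monoid, written additively because the convolution product on
  \<^type>\<open>poly_mapping\<close> is indexed by additive monoids.  Hence the type
  \<open>'x word_monoid \<Rightarrow>\<^sub>0 'k\<close> is the free associative unital \<open>'k\<close>-algebra on the alphabet \<open>'x\<close>.\<close>

datatype 'x word_monoid = Word (letters: "'x list")

instantiation word_monoid :: (type) monoid_add
begin

definition zero_word_monoid :: "'x word_monoid" where
  "zero_word_monoid = Word []"

definition plus_word_monoid :: "'x word_monoid \<Rightarrow> 'x word_monoid \<Rightarrow> 'x word_monoid" where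
  "plus_word_monoid v w = Word (letters v @ letters w)"

instance
  by standard (simp_all add: zero_word_monoid_def plus_word_monoid_def)

end

type_synonym ('k, 'x) free_alg = "'x word_monoid \<Rightarrow>\<^sub>0 'k"

definition free_gen :: "'x \<Rightarrow> ('k::field, 'x) free_alg" where
  "free_gen x = Poly_Mapping.single (Word [x]) 1"

definition free_scalar :: "'k::field \<Rightarrow> ('k, 'x) free_alg" where
  "free_scalar c = Poly_Mapping.single 0 c"


section \<open>Triangular generalized Weyl algebras\<close>

text \<open>The data \<open>(H, \<theta>, z\<^sub>0, z\<^sub>1)\<close>; the \<open>'k\<close>-algebra structure of \<open>'h\<close> is given by its structure
  map \<open>c \<mapsto> c \<cdot> 1\<close>.\<close>

record ('k, 'h) tgwa_data =
  scalar_map :: "'k \<Rightarrow> 'h"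
  endo :: "'h \<Rightarrow> 'h"
  z_zero :: 'h
  z_one :: 'h

datatype 'h tgwa_letter = Base 'h | Down | Up

text \<open>The first three families of relations turn the letters \<open>Base h\<close> into a copy of the algebra
  \<open>H\<close>, so that they alone present \<open>H\<langle>d,u\<rangle>\<close>.\<close>

definition tgwa_relations ::
    "('k::field, 'h::ring_1) tgwa_data \<Rightarrow> ('k, 'h tgwa_letter) free_alg set" where
  "tgwa_relations A =
     {free_gen (Base (h + h')) - (free_gen (Base h) + free_gen (Base h')) | h h'. True}
   \<union> {free_gen (Base (h * h')) - free_gen (Base h) * free_gen (Base h') | h h'. True}
   \<union> {free_gen (Base (scalar_map A c)) - free_scalar c | c. True}
   \<union> {free_gen Up * free_gen (Base h) - free_gen (Base (endo A h)) * free_gen Up | h. True}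
   \<union> {free_gen (Base h) * free_gen Down - free_gen Down * free_gen (Base (endo A h)) | h. True}
   \<union> {free_gen Up * free_gen Down
        - (free_gen (Base (z_zero A)) + free_gen Down * free_gen (Base (z_one A)) * free_gen Up)}"

definition tgwa_ideal ::
    "('k::field, 'h::ring_1) tgwa_data \<Rightarrow> ('k, 'h tgwa_letter) free_alg set" where
  "tgwa_ideal A = Idl\<^bsub>class_ring\<^esub> (tgwa_relations A)"

type_synonym ('k, 'h) tgwa_elem = "('k, 'h tgwa_letter) free_alg set"

definition tgwa :: "('k::field, 'h::ring_1) tgwa_data \<Rightarrow> ('k, 'h) tgwa_elem ring" where
  "tgwa A = class_ring Quot (tgwa_ideal A)"

definition tgwa_class ::
    "('k::field, 'h::ring_1) tgwa_data \<Rightarrow> ('k, 'h tgwa_letter) free_alg \<Rightarrow> ('k, 'h) tgwa_elem" where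
  "tgwa_class A x = tgwa_ideal A +>\<^bsub>class_ring\<^esub> x"

definition tgwa_base :: "('k::field, 'h::ring_1) tgwa_data \<Rightarrow> 'h \<Rightarrow> ('k, 'h) tgwa_elem" where
  "tgwa_base A h = tgwa_class A (free_gen (Base h))"

definition tgwa_scalar :: "('k::field, 'h::ring_1) tgwa_data \<Rightarrow> 'k \<Rightarrow> ('k, 'h) tgwa_elem" where
  "tgwa_scalar A c = tgwa_class A (free_scalar c)"

definition tgwa_d :: "('k::field, 'h::ring_1) tgwa_data \<Rightarrow> ('k, 'h) tgwa_elem" where
  "tgwa_d A = tgwa_class A (free_gen Down)"

definition tgwa_u :: "('k::field, 'h::ring_1) tgwa_data \<Rightarrow> ('k, 'h) tgwa_elem" where
  "tgwa_u A = tgwa_class A (free_gen Up)"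


section \<open>Left modules over noncommutative rings\<close>

text \<open>The locale \<open>module\<close> of \<open>HOL-Algebra\<close> requires a commutative ring.  We reuse its record type
  and axioms; as there, the fields \<open>mult\<close> and \<open>one\<close> of the record are irrelevant.\<close>

locale left_module = R?: ring R + M?: abelian_group M
  for R :: "('a, 'm) ring_scheme" (structure) and M :: "('a, 'b) module" (structure) +
  assumes smult_closed:
      "\<lbrakk>a \<in> carrier R; x \<in> carrier M\<rbrakk> \<Longrightarrow> a \<odot>\<^bsub>M\<^esub> x \<in> carrier M"
    and smult_l_distr:
      "\<lbrakk>a \<in> carrier R; b \<in> carrier R; x \<in> carrier M\<rbrakk> \<Longrightarrow>
        (a \<oplus>\<^bsub>R\<^esub> b) \<odot>\<^bsub>M\<^esub> x = a \<odot>\<^bsub>M\<^esub> x \<oplus>\<^bsub>M\<^esub> b \<odot>\<^bsub>M\<^esub> x"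
    and smult_r_distr:
      "\<lbrakk>a \<in> carrier R; x \<in> carrier M; y \<in> carrier M\<rbrakk> \<Longrightarrow>
        a \<odot>\<^bsub>M\<^esub> (x \<oplus>\<^bsub>M\<^esub> y) = a \<odot>\<^bsub>M\<^esub> x \<oplus>\<^bsub>M\<^esub> a \<odot>\<^bsub>M\<^esub> y"
    and smult_assoc:
      "\<lbrakk>a \<in> carrier R; b \<in> carrier R; x \<in> carrier M\<rbrakk> \<Longrightarrow>
        (a \<otimes>\<^bsub>R\<^esub> b) \<odot>\<^bsub>M\<^esub> x = a \<odot>\<^bsub>M\<^esub> (b \<odot>\<^bsub>M\<^esub> x)"
    and smult_one:
      "x \<in> carrier M \<Longrightarrow> \<one>\<^bsub>R\<^esub> \<odot>\<^bsub>M\<^esub> x = x"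

definition left_module_hom ::
    "('a, 'm) ring_scheme \<Rightarrow> ('a, 'b) module \<Rightarrow> ('a, 'c) module \<Rightarrow> ('b \<Rightarrow> 'c) set" where
  "left_module_hom R M N =
    {g. g \<in> carrier M \<rightarrow> carrier N
      \<and> (\<forall>x \<in> carrier M. \<forall>y \<in> carrier M. g (x \<oplus>\<^bsub>M\<^esub> y) = g x \<oplus>\<^bsub>N\<^esub> g y)
      \<and> (\<forall>a \<in> carrier R. \<forall>x \<in> carrier M. g (a \<odot>\<^bsub>M\<^esub> x) = a \<odot>\<^bsub>N\<^esub> g x)}"

definition regular_module :: "'a ring \<Rightarrow> ('a, 'a) module" where
  "regular_module R =
    \<lparr>carrier = carrier R, mult = mult R, one = one R, zero = zero R, add = add R, smult = mult R\<rparr>"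

definition submodule_on :: "('a, 'b) module \<Rightarrow> 'b set \<Rightarrow> ('a, 'b) module" where
  "submodule_on M X = M\<lparr>carrier := X\<rparr>"

text \<open>As for \<^const>\<open>FactRing\<close>, the elements are the cosets \<open>N + x\<close>, and \<open>a (N + x) = N + a x\<close>.\<close>

definition quot_module :: "('a, 'b) module \<Rightarrow> 'b set \<Rightarrow> ('a, 'b set) module" where
  "quot_module M N =
    \<lparr>carrier = a_rcosets\<^bsub>M\<^esub> N, mult = (\<lambda>_ _. N), one = N, zero = N, add = set_add M,
      smult = (\<lambda>a X. \<Union>x\<in>X. N +>\<^bsub>M\<^esub> (a \<odot>\<^bsub>M\<^esub> x))\<rparr>"

text \<open>An \<open>R\<close>-module annihilated by an ideal \<open>I\<close>, regarded as a module over \<open>R Quot I\<close>.  It is applied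
  to modules such as \<^const>\<open>quot_module\<close>, whose elements are themselves sets: for a coset \<open>X\<close> of \<open>I\<close>
  all the sets in the union are equal, their common value being the action of \<open>X\<close>.\<close>

definition descend_module :: "('a, 'b set) module \<Rightarrow> ('a set, 'b set) module" where
  "descend_module M =
    \<lparr>carrier = carrier M, mult = mult M, one = one M, zero = zero M, add = add M,
      smult = (\<lambda>X m. \<Union>a\<in>X. a \<odot>\<^bsub>M\<^esub> m)\<rparr>"

definition pullback_module :: "('c \<Rightarrow> 'a) \<Rightarrow> ('a, 'b) module \<Rightarrow> ('c, 'b) module" where
  "pullback_module \<psi> M =
    \<lparr>carrier = carrier M, mult = mult M, one = one M, zero = zero M, add = add M,
      smult = (\<lambda>a m. \<psi> a \<odot>\<^bsub>M\<^esub> m)\<rparr>"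


section \<open>Weights, Verma modules and highest weight modules\<close>

definition weight :: "('k::field, 'h::ring_1) tgwa_data \<Rightarrow> ('h \<Rightarrow> 'k) \<Rightarrow> bool" where
  "weight A \<mu> \<longleftrightarrow>
     (\<forall>x y. \<mu> (x + y) = \<mu> x + \<mu> y) \<and> (\<forall>x y. \<mu> (x * y) = \<mu> x * \<mu> y)
   \<and> (\<forall>c. \<mu> (scalar_map A c) = c)"

definition left_multiples :: "'a ring \<Rightarrow> 'a set \<Rightarrow> 'a set" where
  "left_multiples R S = generate (add_monoid R) {r \<otimes>\<^bsub>R\<^esub> s | r s. r \<in> carrier R \<and> s \<in> S}"

definition verma_ideal ::
    "('k::field, 'h::ring_1) tgwa_data \<Rightarrow> ('h \<Rightarrow> 'k) \<Rightarrow> ('k, 'h) tgwa_elem set" where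
  "verma_ideal A \<mu> =
     left_multiples (tgwa A) {tgwa_u A}
       <+>\<^bsub>tgwa A\<^esub> left_multiples (tgwa A) (tgwa_base A ` {h. \<mu> h = 0})"

definition verma ::
    "('k::field, 'h::ring_1) tgwa_data \<Rightarrow> ('h \<Rightarrow> 'k)
      \<Rightarrow> (('k, 'h) tgwa_elem, ('k, 'h) tgwa_elem set) module" where
  "verma A \<mu> = quot_module (regular_module (tgwa A)) (verma_ideal A \<mu>)"

definition highest_weight_module ::
    "('k::field, 'h::ring_1) tgwa_data \<Rightarrow> ('h \<Rightarrow> 'k) \<Rightarrow> (('k, 'h) tgwa_elem, 'v) module \<Rightarrow> bool" where
  "highest_weight_module A \<mu> V \<longleftrightarrow>
     weight A \<mu> \<and> left_module (tgwa A) V \<and> carrier V \<noteq> {\<zero>\<^bsub>V\<^esub>}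
   \<and> (\<exists>\<pi> \<in> left_module_hom (tgwa A) (verma A \<mu>) V. \<pi> ` carrier (verma A \<mu>) = carrier V)"

definition weight_space ::
    "('k::field, 'h::ring_1) tgwa_data \<Rightarrow> (('k, 'h) tgwa_elem, 'v) module \<Rightarrow> ('h \<Rightarrow> 'k) \<Rightarrow> 'v set" where
  "weight_space A V \<mu> =
    {v \<in> carrier V. \<forall>h. tgwa_base A h \<odot>\<^bsub>V\<^esub> v = tgwa_scalar A (\<mu> h) \<odot>\<^bsub>V\<^esub> v}"

definition weight_vectorspace ::
    "('k::field, 'h::ring_1) tgwa_data \<Rightarrow> (('k, 'h) tgwa_elem, 'v) module \<Rightarrow> ('h \<Rightarrow> 'k)
      \<Rightarrow> ('k, 'v) module" where
  "weight_vectorspace A V \<mu> =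
     submodule_on (pullback_module (tgwa_scalar A) V) (weight_space A V \<mu>)"

text \<open>Since \<open>vectorspace.dim\<close> is meaningless on infinite-dimensional spaces, finite-dimensionality
  is part of the definition.\<close>

definition same_graded_character ::
    "('k::field, 'h::ring_1) tgwa_data \<Rightarrow> ('h \<Rightarrow> 'k) \<Rightarrow> (('k, 'h) tgwa_elem, 'v) module
      \<Rightarrow> ('k'::field, 'h'::ring_1) tgwa_data \<Rightarrow> ('h' \<Rightarrow> 'k') \<Rightarrow> (('k', 'h') tgwa_elem, 'w) module
      \<Rightarrow> bool" where
  "same_graded_character A \<mu> V A' \<mu>' V' \<longleftrightarrow>
    (\<forall>i::nat.
      let X = weight_vectorspace A V (\<mu> \<circ> (endo A ^^ i));
          X' = weight_vectorspace A' V' (\<mu>' \<circ> (endo A' ^^ i))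
      in vectorspace.fin_dim class_ring X \<and> vectorspace.fin_dim class_ring X'
         \<and> vectorspace.dim class_ring X = vectorspace.dim class_ring X')"


section \<open>Rational functions regular at \<open>q = 1\<close>\<close>

type_synonym 'a ratfun = "'a poly fract"

definition ratfun_const :: "'a::field \<Rightarrow> 'a ratfun" where
  "ratfun_const c = to_fract [:c:]"

definition qvar :: "'a::field ratfun" where
  "qvar = to_fract [:0, 1:]"

definition regular_at_one :: "'a::field ratfun set" where
  "regular_at_one = {Fraction_Field.Fract a b | a b. poly b 1 \<noteq> 0}"

definition value_at_one :: "'a::field ratfun \<Rightarrow> 'a" where
  "value_at_one x =
    (THE c. \<exists>a b. poly b 1 \<noteq> 0 \<and> x = Fraction_Field.Fract a b \<and> c = poly a 1 / poly b 1)"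


section \<open>Laurent polynomials in \<open>K\<close>\<close>

type_synonym 'k laurent = "int \<Rightarrow>\<^sub>0 'k"

definition laurent_const :: "'k::field \<Rightarrow> 'k laurent" where
  "laurent_const c = Poly_Mapping.single 0 c"

definition Kpow :: "int \<Rightarrow> 'k::field laurent" where
  "Kpow n = Poly_Mapping.single n 1"

text \<open>The algebra endomorphism \<open>K \<mapsto> c K\<close> (for \<open>c \<noteq> 0\<close>).\<close>

definition laurent_rescale :: "'k::field \<Rightarrow> 'k laurent \<Rightarrow> 'k laurent" where
  "laurent_rescale c p = Poly_Mapping.mapp (\<lambda>n a. c powi n * a) p"

text \<open>The algebra map sending \<open>K\<close> to \<open>x\<close> (for \<open>x \<noteq> 0\<close>).\<close>

definition laurent_eval :: "'k::field \<Rightarrow> 'k laurent \<Rightarrow> 'k" where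
  "laurent_eval x p = (\<Sum>n\<in>Poly_Mapping.keys p. Poly_Mapping.lookup p n * x powi n)"


section \<open>The algebra over \<open>F(q)\<close>, its \<open>R\<close>-form and its classical limit\<close>

definition K_quotient :: "'a::field ratfun laurent" where
  "K_quotient = laurent_const (inverse (qvar - 1)) * (Kpow 1 - 1)"

definition h_lift :: "'a::field \<Rightarrow> int \<Rightarrow> 'a ratfun laurent" where
  "h_lift \<gamma> l = laurent_const (ratfun_const (- \<gamma> / of_int l)) * K_quotient"

definition Wq_data ::
    "'a::field \<Rightarrow> 'a \<Rightarrow> 'a poly \<Rightarrow> int \<Rightarrow> int \<Rightarrow> int \<Rightarrow> ('a ratfun, 'a ratfun laurent) tgwa_data" where
  "Wq_data \<gamma> s f l m n =
    \<lparr>scalar_map = laurent_const,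
     endo = laurent_rescale (qvar powi (- l)),
     z_zero = laurent_const (ratfun_const (inverse s)) * laurent_const (qvar powi m) * Kpow n
                * poly (map_poly (\<lambda>c. laurent_const (ratfun_const c)) f) (h_lift \<gamma> l),
     z_one = laurent_const (ratfun_const (inverse s))\<rparr>"

definition Wclassical_data :: "'a::field \<Rightarrow> 'a \<Rightarrow> 'a poly \<Rightarrow> ('a, 'a poly) tgwa_data" where
  "Wclassical_data \<gamma> s f =
    \<lparr>scalar_map = (\<lambda>c. [:c:]),
     endo = (\<lambda>p. pcompose p [:\<gamma>, 1:]),
     z_zero = Polynomial.smult (inverse s) f,
     z_one = [:inverse s:]\<rparr>"

text \<open>The unital \<open>R\<close>-subalgebra generated by a set \<open>S\<close> is the
  subring generated by \<open>S\<close> and the image of \<open>R\<close>.\<close>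

definition R_form ::
    "('a::field ratfun, 'a ratfun laurent) tgwa_data
      \<Rightarrow> ('a ratfun, 'a ratfun laurent) tgwa_elem ring" where
  "R_form A =
    (tgwa A)\<lparr>carrier := generate_ring (tgwa A)
      (tgwa_scalar A ` regular_at_one
        \<union> {tgwa_u A, tgwa_d A, tgwa_base A (Kpow 1), tgwa_base A (Kpow (- 1)),
           tgwa_base A K_quotient})\<rparr>"

definition q_minus_one_ideal ::
    "('a::field ratfun, 'a ratfun laurent) tgwa_data
      \<Rightarrow> ('a ratfun, 'a ratfun laurent) tgwa_elem set" where
  "q_minus_one_ideal A =
    {tgwa_scalar A (qvar - 1) \<otimes>\<^bsub>tgwa A\<^esub> x | x. x \<in> carrier (R_form A)}"

definition W_one ::
    "('a::field ratfun, 'a ratfun laurent) tgwa_data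
      \<Rightarrow> ('a ratfun, 'a ratfun laurent) tgwa_elem set ring" where
  "W_one A = R_form A Quot q_minus_one_ideal A"

definition W_one_class ::
    "('a::field ratfun, 'a ratfun laurent) tgwa_data
      \<Rightarrow> ('a ratfun, 'a ratfun laurent) tgwa_elem
      \<Rightarrow> ('a ratfun, 'a ratfun laurent) tgwa_elem set" where
  "W_one_class A x = q_minus_one_ideal A +>\<^bsub>R_form A\<^esub> x"

text \<open>The \<open>F\<close>-algebra isomorphism is the one determined by \<open>U \<mapsto> u\<close>, \<open>D \<mapsto> d\<close> and
  \<open>(- \<gamma> / l) (K - 1) / (q - 1) \<mapsto> h\<close>; the \<open>F\<close>-algebra structure of \<open>W_one\<close> comes from \<open>F \<subseteq> R\<close>.\<close>

definition classical_limit_iso ::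
    "'a::field \<Rightarrow> 'a \<Rightarrow> 'a poly \<Rightarrow> int \<Rightarrow> int \<Rightarrow> int
      \<Rightarrow> (('a ratfun, 'a ratfun laurent) tgwa_elem set \<Rightarrow> ('a, 'a poly) tgwa_elem) \<Rightarrow> bool" where
  "classical_limit_iso \<gamma> s f l m n \<phi> \<longleftrightarrow>
    (let A = Wq_data \<gamma> s f l m n; B = Wclassical_data \<gamma> s f in
       \<phi> \<in> ring_iso (W_one A) (tgwa B)
     \<and> (\<forall>c. \<phi> (W_one_class A (tgwa_scalar A (ratfun_const c))) = tgwa_scalar B c)
     \<and> \<phi> (W_one_class A (tgwa_u A)) = tgwa_u B
     \<and> \<phi> (W_one_class A (tgwa_d A)) = tgwa_d B
     \<and> \<phi> (W_one_class A (tgwa_base A (h_lift \<gamma> l))) = tgwa_base B [:0, 1:])"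

definition R_lattice ::
    "('a::field ratfun, 'a ratfun laurent) tgwa_data
      \<Rightarrow> (('a ratfun, 'a ratfun laurent) tgwa_elem, 'v) module \<Rightarrow> 'v \<Rightarrow> 'v set" where
  "R_lattice A V v = {x \<odot>\<^bsub>V\<^esub> v | x. x \<in> carrier (R_form A)}"

definition V_one ::
    "('a::field ratfun, 'a ratfun laurent) tgwa_data
      \<Rightarrow> (('a ratfun, 'a ratfun laurent) tgwa_elem, 'v) module \<Rightarrow> 'v
      \<Rightarrow> (('a ratfun, 'a ratfun laurent) tgwa_elem set, 'v set) module" where
  "V_one A V v =
     descend_module
       (quot_module (submodule_on V (R_lattice A V v))
         {tgwa_scalar A (qvar - 1) \<odot>\<^bsub>V\<^esub> x | x. x \<in> R_lattice A V v})"

end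

theory Submission
  imports Defs "HOL-Library.Function_Algebras"
begin

text \<open>The argument rests on a basis theorem.  Over a commutative base \<open>H\<close>, a triangular
  generalized Weyl algebra has unique normal forms \<open>\<Sum> d^i h\<^sub>i\<^sub>j u^j\<close>.  They exist because the
  relations move every \<open>d\<close> to the left and every \<open>u\<close> to the right.  They are unique because the
  algebra acts on the families \<open>(h\<^sub>i\<^sub>j)\<close> by explicit operators (\<open>letter_act\<close>), and applying an element
  to the family of \<open>1\<close> returns its coefficients (\<open>pbw_coeffs_expansion\<close>, \<open>pbw_coeffs_eq_zero\<close>).

  In the base \<open>F(q)[K, K^-1]\<close>, the subring generated by \<open>R\<close>, \<open>K\<close>, \<open>K^-1\<close> and \<open>(K - 1)/(q - 1)\<close> maps onto
  \<open>F[h]\<close> with kernel generated by \<open>q - 1\<close>: modulo \<open>q - 1\<close> one has \<open>K = 1\<close>, so polynomials in the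
  lift of \<open>h\<close> suffice, and a polynomial is determined by the values at \<open>q = 1\<close> of evaluations of
  \<open>K\<close> (\<open>reduces_decompose\<close>, \<open>reduces_unique\<close>).  This map carries \<open>K \<mapsto> q^-l K\<close> to \<open>h \<mapsto> h + \<gamma>\<close>,
  and the data \<open>z\<^sub>0, z\<^sub>1\<close> of the one algebra to those of the other.  Hence elements of the \<open>R\<close>-form act
  on families with coefficients in this subring, and the action reduces to that of the classical
  algebra.  The basis theorem on both sides shows that this reduction is a well-defined surjection
  from the \<open>R\<close>-form whose kernel is generated by \<open>q - 1\<close> (\<open>limit_rel_functional\<close>,
  \<open>limit_rel_kernel\<close>, \<open>limit_rel_surjective\<close>); the induced isomorphism is \<open>limit_iso\<close>.

  For modules, let \<open>v\<close> be a vector of the highest weight that generates a highest weight module.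
  The vectors \<open>d^i v\<close> span it, and their weights are pairwise distinct, over \<open>F(q)\<close> because \<open>q\<close> is
  not a root of unity and \<open>l\<close> is nonzero, and over \<open>F\<close> because the characteristic is zero and \<open>\<gamma>\<close>
  is nonzero.  Interpolation in the base then shows that the \<open>i\<close>-th
  weight space is the line spanned by \<open>d^i v\<close>, or zero if \<open>d^i v = 0\<close> (\<open>weight_space_dim\<close>).  The
  reduction of the lattice is again generated by a highest weight vector, so that only the
  equivalence of \<open>D^i v = 0\<close> with the vanishing of its image is left (\<open>down_zero_iff\<close>): if \<open>D^i v\<close>
  lies in \<open>(q - 1)\<close> times the lattice, then \<open>D^i v = (q - 1) r D^i v\<close> with \<open>r \<in> R\<close>, and
  \<open>1 - (q - 1) r\<close> is nonzero.\<close>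


section \<open>Free algebras and congruences\<close>

lemma poly_mapping_single_add_induct [case_names single add]:
  fixes x :: "'a \<Rightarrow>\<^sub>0 'b::comm_monoid_add"
  assumes single: "\<And>k c. P (Poly_Mapping.single k c)"
    and add: "\<And>x y. P x \<Longrightarrow> P y \<Longrightarrow> P (x + y)"
  shows "P x"
proof -
  have *: "P (\<Sum>k\<in>S. Poly_Mapping.single k (Poly_Mapping.lookup x k))" if "finite S" for S
    using that
  proof (induction S)
    case empty
    have "P (Poly_Mapping.single undefined 0)" by (rule single)
    then show ?case by simp
  next
    case (insert k S)
    then show ?case by (simp add: single add)
  qed
  have "x = (\<Sum>k\<in>Poly_Mapping.keys x. Poly_Mapping.single k (Poly_Mapping.lookup x k))"
    by (rule poly_mapping_eqI)
      (simp add: lookup_sum lookup_single when_def sum.delta in_keys_iff)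
  then show ?thesis using *[of "Poly_Mapping.keys x"] by simp
qed

lemma free_scalar_one: "free_scalar 1 = 1"
  by (simp add: free_scalar_def)

lemma free_scalar_zero: "free_scalar 0 = 0"
  by (simp add: free_scalar_def)

lemma free_scalar_add: "free_scalar (a + b) = free_scalar a + free_scalar b"
  by (simp add: free_scalar_def single_add)

lemma free_scalar_diff: "free_scalar (a - b) = free_scalar a - free_scalar b"
  by (simp add: free_scalar_def single_diff)

lemma free_scalar_uminus: "free_scalar (- a) = - free_scalar a"
  by (simp add: free_scalar_def single_uminus)

lemma free_scalar_mult: "free_scalar (a * b) = free_scalar a * free_scalar b"
  by (simp add: free_scalar_def mult_single)

lemma free_scalar_commute: "free_scalar c * x = x * free_scalar c"
proof (induction x rule: poly_mapping_single_add_induct)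
  case (single k d)
  then show ?case by (simp add: free_scalar_def mult_single mult.commute)
next
  case (add x y)
  then show ?case by (simp add: distrib_left distrib_right)
qed

lemma free_alg_induct [case_names scalar gen add mult]:
  fixes x :: "('k::field, 'x) free_alg"
  assumes scalar: "\<And>c. P (free_scalar c)" and gen: "\<And>a. P (free_gen a)"
    and add: "\<And>x y. P x \<Longrightarrow> P y \<Longrightarrow> P (x + y)"
    and mult: "\<And>x y. P x \<Longrightarrow> P y \<Longrightarrow> P (x * y)"
  shows "P x"
proof (induction x rule: poly_mapping_single_add_induct)
  case (single k c)
  have word: "P (Poly_Mapping.single (Word ws) 1)" for ws
  proof (induction ws)
    case Nil
    have "Word [] = (0 :: 'x word_monoid)" by (simp add: zero_word_monoid_def)
    then show ?case using scalar[of 1] by (simp add: free_scalar_def)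
  next
    case (Cons a ws)
    have "Poly_Mapping.single (Word (a # ws)) (1::'k) = free_gen a * Poly_Mapping.single (Word ws) 1"
      by (simp add: free_gen_def mult_single plus_word_monoid_def)
    then show ?case using mult[OF gen Cons] by simp
  qed
  obtain ws where k: "k = Word ws" by (cases k)
  have "Poly_Mapping.single k c = free_scalar c * Poly_Mapping.single (Word ws) 1"
    by (simp add: free_scalar_def mult_single k)
  then show ?case using mult[OF scalar word] by simp
qed (rule add)

lemma tgwa_ideal_ideal: "ideal (tgwa_ideal A) class_ring"
  unfolding tgwa_ideal_def by (rule ring.genideal_ideal[OF class_ring.ring_axioms]) simp

lemma tgwa_relations_in_ideal: "r \<in> tgwa_relations A \<Longrightarrow> r \<in> tgwa_ideal A"
  unfolding tgwa_ideal_def using ring.genideal_self[OF class_ring.ring_axioms, of "tgwa_relations A"] by auto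

lemma tgwa_ideal_minimal:
  assumes "ideal I class_ring" and "tgwa_relations A \<subseteq> I"
  shows "tgwa_ideal A \<subseteq> I"
  unfolding tgwa_ideal_def by (rule ring.genideal_minimal[OF class_ring.ring_axioms assms])

lemma tgwa_ideal_zero: "0 \<in> tgwa_ideal A"
  using additive_subgroup.zero_closed[OF ideal.axioms(1)[OF tgwa_ideal_ideal]] by auto

lemma tgwa_ideal_add: "x \<in> tgwa_ideal A \<Longrightarrow> y \<in> tgwa_ideal A \<Longrightarrow> x + y \<in> tgwa_ideal A"
  using additive_subgroup.a_closed[OF ideal.axioms(1)[OF tgwa_ideal_ideal]] by auto

lemma tgwa_ideal_mult_left: "x \<in> tgwa_ideal A \<Longrightarrow> y * x \<in> tgwa_ideal A"
  using ideal.I_l_closed[OF tgwa_ideal_ideal, of x A y] by auto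

lemma tgwa_ideal_mult_right: "x \<in> tgwa_ideal A \<Longrightarrow> x * y \<in> tgwa_ideal A"
  using ideal.I_r_closed[OF tgwa_ideal_ideal, of x A y] by auto

lemma tgwa_ideal_uminus: "x \<in> tgwa_ideal A \<Longrightarrow> - x \<in> tgwa_ideal A"
  using tgwa_ideal_mult_left[of x A "- 1"] by simp

text \<open>Equality in \<^const>\<open>tgwa\<close>, expressed by representatives in the free algebra, where the
  calculations can use the type class of rings.\<close>

definition tgwa_eq :: "('k::field, 'h::ring_1) tgwa_data
    \<Rightarrow> ('k, 'h tgwa_letter) free_alg \<Rightarrow> ('k, 'h tgwa_letter) free_alg \<Rightarrow> bool" where
  "tgwa_eq A x y \<longleftrightarrow> x - y \<in> tgwa_ideal A"

lemma tgwa_eq_refl [simp]: "tgwa_eq A x x"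
  by (simp add: tgwa_eq_def tgwa_ideal_zero)

lemma tgwa_eq_sym: "tgwa_eq A x y \<Longrightarrow> tgwa_eq A y x"
  unfolding tgwa_eq_def by (drule tgwa_ideal_uminus) simp

lemma tgwa_eq_trans [trans]: "tgwa_eq A x y \<Longrightarrow> tgwa_eq A y z \<Longrightarrow> tgwa_eq A x z"
  unfolding tgwa_eq_def by (drule (1) tgwa_ideal_add) simp

lemma tgwa_eq_add: "tgwa_eq A x x' \<Longrightarrow> tgwa_eq A y y' \<Longrightarrow> tgwa_eq A (x + y) (x' + y')"
  unfolding tgwa_eq_def by (drule (1) tgwa_ideal_add) (simp add: algebra_simps)

lemma tgwa_eq_mult:
  assumes "tgwa_eq A x x'" and "tgwa_eq A y y'"
  shows "tgwa_eq A (x * y) (x' * y')"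
proof -
  have "(x - x') * y + x' * (y - y') \<in> tgwa_ideal A"
    using assms unfolding tgwa_eq_def
    by (intro tgwa_ideal_add tgwa_ideal_mult_left tgwa_ideal_mult_right)
  then show ?thesis by (simp add: tgwa_eq_def algebra_simps)
qed

lemma tgwa_eq_sum:
  "(\<And>k. k \<in> S \<Longrightarrow> tgwa_eq A (f k) (g k)) \<Longrightarrow> tgwa_eq A (sum f S) (sum g S)"
  by (induction S rule: infinite_finite_induct) (auto intro: tgwa_eq_add)

lemma tgwa_eq_zero_iff: "tgwa_eq A x 0 \<longleftrightarrow> x \<in> tgwa_ideal A"
  by (simp add: tgwa_eq_def)

lemma tgwa_eq_base_add:
  "tgwa_eq A (free_gen (Base (h + h'))) (free_gen (Base h) + free_gen (Base h'))"
  unfolding tgwa_eq_def by (rule tgwa_relations_in_ideal) (auto simp: tgwa_relations_def)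

lemma tgwa_eq_base_mult:
  "tgwa_eq A (free_gen (Base (h * h'))) (free_gen (Base h) * free_gen (Base h'))"
  unfolding tgwa_eq_def by (rule tgwa_relations_in_ideal) (auto simp: tgwa_relations_def)

lemma tgwa_eq_base_scalar: "tgwa_eq A (free_gen (Base (scalar_map A c))) (free_scalar c)"
  unfolding tgwa_eq_def by (rule tgwa_relations_in_ideal) (auto simp: tgwa_relations_def)

lemma tgwa_eq_up_base:
  "tgwa_eq A (free_gen Up * free_gen (Base h)) (free_gen (Base (endo A h)) * free_gen Up)"
  unfolding tgwa_eq_def by (rule tgwa_relations_in_ideal) (auto simp: tgwa_relations_def)

lemma tgwa_eq_base_down:
  "tgwa_eq A (free_gen (Base h) * free_gen Down) (free_gen Down * free_gen (Base (endo A h)))"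
  unfolding tgwa_eq_def by (rule tgwa_relations_in_ideal) (auto simp: tgwa_relations_def)

lemma tgwa_eq_up_down:
  "tgwa_eq A (free_gen Up * free_gen Down)
    (free_gen (Base (z_zero A)) + free_gen Down * free_gen (Base (z_one A)) * free_gen Up)"
  unfolding tgwa_eq_def by (rule tgwa_relations_in_ideal) (auto simp: tgwa_relations_def)

lemma tgwa_eq_base_zero: "tgwa_eq A (free_gen (Base 0)) 0"
proof -
  have "tgwa_eq A (free_gen (Base 0) + - free_gen (Base 0))
      ((free_gen (Base 0) + free_gen (Base 0)) + - free_gen (Base 0))"
    using tgwa_eq_add[OF tgwa_eq_base_add[of A 0 0] tgwa_eq_refl[of A "- free_gen (Base 0)"]]
    by simp
  then have "tgwa_eq A 0 (free_gen (Base 0))" by simp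
  then show ?thesis by (rule tgwa_eq_sym)
qed

lemma tgwa_ring: "ring (tgwa A)"
  unfolding tgwa_def by (rule ideal.quotient_is_ring[OF tgwa_ideal_ideal])

lemma tgwa_class_hom: "tgwa_class A \<in> Ring.ring_hom class_ring (tgwa A)"
  using ideal.rcos_ring_hom[OF tgwa_ideal_ideal[of A]]
  by (simp add: tgwa_def tgwa_class_def[abs_def])

lemma tgwa_class_closed [simp]: "tgwa_class A x \<in> carrier (tgwa A)"
  using ring_hom_closed[OF tgwa_class_hom, of x] by simp

lemma tgwa_carrier: "carrier (tgwa A) = range (tgwa_class A)"
  by (auto simp: tgwa_def FactRing_def A_RCOSETS_def' tgwa_class_def)

lemma tgwa_class_add: "tgwa_class A x \<oplus>\<^bsub>tgwa A\<^esub> tgwa_class A y = tgwa_class A (x + y)"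
  using ring_hom_add[OF tgwa_class_hom, of x y A] by simp

lemma tgwa_class_mult: "tgwa_class A x \<otimes>\<^bsub>tgwa A\<^esub> tgwa_class A y = tgwa_class A (x * y)"
  using ring_hom_mult[OF tgwa_class_hom, of x y A] by simp

lemma tgwa_class_one: "\<one>\<^bsub>tgwa A\<^esub> = tgwa_class A 1"
  using ring_hom_one[OF tgwa_class_hom, of A] by simp

lemma tgwa_class_zero: "\<zero>\<^bsub>tgwa A\<^esub> = tgwa_class A 0"
proof -
  interpret ring "tgwa A" by (rule tgwa_ring)
  have "tgwa_class A 0 \<oplus>\<^bsub>tgwa A\<^esub> tgwa_class A 0 = tgwa_class A 0"
    by (simp add: tgwa_class_add)
  then show ?thesis by (metis add.l_cancel_one tgwa_class_closed)
qed

lemma tgwa_class_uminus: "\<ominus>\<^bsub>tgwa A\<^esub> tgwa_class A x = tgwa_class A (- x)"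
proof -
  interpret ring "tgwa A" by (rule tgwa_ring)
  have "tgwa_class A (- x) \<oplus>\<^bsub>tgwa A\<^esub> tgwa_class A x = \<zero>\<^bsub>tgwa A\<^esub>"
    by (simp add: tgwa_class_add tgwa_class_zero)
  then show ?thesis by (simp add: minus_equality)
qed

lemma tgwa_class_eq_iff: "tgwa_class A x = tgwa_class A y \<longleftrightarrow> tgwa_eq A x y"
  using ring.quotient_eq_iff_same_a_r_cos[OF class_ring.ring_axioms tgwa_ideal_ideal, of x y A]
  by (simp add: tgwa_class_def tgwa_eq_def class_ring_simps)


section \<open>A basis of a triangular generalized Weyl algebra\<close>

text \<open>Data for which the endomorphism and the structure map are ring homomorphisms of
  \<open>'k\<close>-algebras, over a commutative base.\<close>

locale tgwa_basis =
  fixes A :: "('k::field, 'h::comm_ring_1) tgwa_data"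
  assumes endo_add: "endo A (g + h) = endo A g + endo A h"
    and endo_mult: "endo A (g * h) = endo A g * endo A h"
    and endo_one: "endo A 1 = 1"
    and endo_scalar: "endo A (scalar_map A c) = scalar_map A c"
    and scalar_map_add: "scalar_map A (a + b) = scalar_map A a + scalar_map A b"
    and scalar_map_mult: "scalar_map A (a * b) = scalar_map A a * scalar_map A b"
    and scalar_map_one: "scalar_map A 1 = 1"
begin

lemma endo_zero: "endo A 0 = 0"
  using endo_add[of 0 0] by simp

lemma scalar_map_zero: "scalar_map A 0 = 0"
  using scalar_map_add[of 0 0] by simp

lemma endo_pow_add: "(endo A ^^ i) (g + h) = (endo A ^^ i) g + (endo A ^^ i) h"
  by (induction i) (simp_all add: endo_add)

lemma endo_pow_mult: "(endo A ^^ i) (g * h) = (endo A ^^ i) g * (endo A ^^ i) h"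
  by (induction i) (simp_all add: endo_mult)

lemma endo_pow_scalar: "(endo A ^^ i) (scalar_map A c) = scalar_map A c"
  by (induction i) (simp_all add: endo_scalar)

text \<open>The coefficients in \<open>u d^i = d^(i-1) Z\<^sub>i + d^i Y\<^sub>i u\<close>.\<close>

fun lower_coeff :: "nat \<Rightarrow> 'h" where
  "lower_coeff 0 = 0"
| "lower_coeff (Suc i) = (endo A ^^ i) (z_zero A) + (endo A ^^ (i - 1)) (z_one A) * lower_coeff i"

fun raise_coeff :: "nat \<Rightarrow> 'h" where
  "raise_coeff 0 = 1"
| "raise_coeff (Suc i) = (endo A ^^ i) (z_one A) * raise_coeff i"

text \<open>The left regular representation in the prospective basis: \<open>p i j\<close> is the coefficient of
  \<open>d^i h u^j\<close>.  Every row of the operators is finite, so they act on all families, not only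
  on the finitely supported ones.\<close>

fun letter_act :: "'h tgwa_letter \<Rightarrow> (nat \<Rightarrow> nat \<Rightarrow> 'h) \<Rightarrow> nat \<Rightarrow> nat \<Rightarrow> 'h" where
  "letter_act (Base h) p = (\<lambda>i j. (endo A ^^ i) h * p i j)"
| "letter_act Down p = (\<lambda>i j. case i of 0 \<Rightarrow> 0 | Suc k \<Rightarrow> p k j)"
| "letter_act Up p = (\<lambda>i j. lower_coeff (Suc i) * p (Suc i) j
      + (case j of 0 \<Rightarrow> 0 | Suc k \<Rightarrow> raise_coeff i * endo A (p i k)))"

text \<open>The action of the scalars through the structure map.\<close>

definition scale :: "'k \<Rightarrow> (nat \<Rightarrow> nat \<Rightarrow> 'h) \<Rightarrow> nat \<Rightarrow> nat \<Rightarrow> 'h" where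
  "scale c p = (\<lambda>i j. scalar_map A c * p i j)"

text \<open>The action of the free algebra: words act by composing the operators of their letters, so
  the last letter acts first.\<close>

definition free_act :: "('k, 'h tgwa_letter) free_alg \<Rightarrow> (nat \<Rightarrow> nat \<Rightarrow> 'h) \<Rightarrow> nat \<Rightarrow> nat \<Rightarrow> 'h" where
  "free_act x p = (\<Sum>w\<in>Poly_Mapping.keys x.
     scale (Poly_Mapping.lookup x w) (foldr letter_act (letters w) p))"

lemma scale_zero [simp]: "scale 0 p = 0"
  by (auto simp: scale_def scalar_map_zero fun_eq_iff)

lemma scale_add_left: "scale (a + b) p = scale a p + scale b p"
  by (auto simp: scale_def scalar_map_add fun_eq_iff algebra_simps)

lemma scale_add_right: "scale c (p + q) = scale c p + scale c q"
  by (auto simp: scale_def fun_eq_iff algebra_simps)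

lemma scale_mult: "scale (a * b) p = scale a (scale b p)"
  by (auto simp: scale_def scalar_map_mult fun_eq_iff algebra_simps)

lemma scale_one [simp]: "scale 1 p = p"
  by (auto simp: scale_def scalar_map_one fun_eq_iff)

lemma letter_act_add: "letter_act a (p + q) = letter_act a p + letter_act a q"
  by (cases a) (auto simp: fun_eq_iff algebra_simps endo_add split: nat.splits)

lemma letter_act_scale: "letter_act a (scale c p) = scale c (letter_act a p)"
  by (cases a)
    (auto simp: fun_eq_iff algebra_simps scale_def endo_mult endo_scalar split: nat.splits)

lemma free_act_superset:
  assumes "finite S" "Poly_Mapping.keys x \<subseteq> S"
  shows "free_act x p = (\<Sum>w\<in>S. scale (Poly_Mapping.lookup x w) (foldr letter_act (letters w) p))"
  unfolding free_act_def
  by (rule sum.mono_neutral_left[OF assms]) (auto simp: in_keys_iff)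

lemma free_act_add_left: "free_act (x + y) p = free_act x p + free_act y p"
proof -
  let ?S = "Poly_Mapping.keys x \<union> Poly_Mapping.keys y"
  have "Poly_Mapping.keys (x + y) \<subseteq> ?S" by (rule Poly_Mapping.keys_add)
  then show ?thesis
    by (simp add: free_act_superset[of ?S] lookup_add scale_add_left sum.distrib)
qed

lemma free_act_single:
  "free_act (Poly_Mapping.single w c) p = scale c (foldr letter_act (letters w) p)"
  by (simp add: free_act_superset[of "{w}"])

lemma free_act_zero: "free_act 0 p = 0"
  by (simp add: free_act_def)

lemma free_act_uminus: "free_act (- x) p = - free_act x p"
  using free_act_add_left[of x "- x" p] by (simp add: free_act_zero add_eq_0_iff)

lemma free_act_add_right: "free_act x (p + q) = free_act x p + free_act x q"
proof (induction x rule: poly_mapping_single_add_induct)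
  case (single w c)
  have "foldr letter_act ws (p + q) = foldr letter_act ws p + foldr letter_act ws q" for ws
    by (induction ws) (simp_all only: foldr.simps o_apply id_apply letter_act_add)
  then show ?case by (simp only: free_act_single scale_add_right)
qed (simp only: free_act_add_left add_ac)

lemma free_act_zero_right: "free_act x 0 = 0"
  using free_act_add_right[of x 0 0] by simp

lemma free_act_mult: "free_act (x * y) p = free_act x (free_act y p)"
proof (induction x rule: poly_mapping_single_add_induct)
  case (single w c)
  show ?case
  proof (induction y rule: poly_mapping_single_add_induct)
    case (single w' c')
    have "foldr letter_act ws (scale c' p') = scale c' (foldr letter_act ws p')" for ws p'
      by (induction ws) (simp_all add: letter_act_scale)
    then show ?case
      by (simp add: mult_single free_act_single plus_word_monoid_def scale_mult)
  qed (simp only: free_act_add_left free_act_add_right distrib_left)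
qed (simp only: free_act_add_left distrib_right)

lemma free_act_gen: "free_act (free_gen a) p = letter_act a p"
  by (simp add: free_gen_def free_act_single)

lemma free_act_scalar: "free_act (free_scalar c) p = scale c p"
  by (simp add: free_scalar_def free_act_single zero_word_monoid_def)

lemma free_act_diff: "free_act (x - y) p = free_act x p - free_act y p"
  using free_act_add_left[of x "- y" p] by (simp add: free_act_uminus)

lemma letter_act_up_down:
  "letter_act Up (letter_act Down p)
    = letter_act (Base (z_zero A)) p + letter_act Down (letter_act (Base (z_one A)) (letter_act Up p))"
proof (intro ext)
  fix i j
  show "letter_act Up (letter_act Down p) i j = (letter_act (Base (z_zero A)) p
      + letter_act Down (letter_act (Base (z_one A)) (letter_act Up p))) i j"
    by (cases i; cases j) (auto simp: algebra_simps endo_zero)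
qed

lemma letter_act_up_base:
  "letter_act Up (letter_act (Base h) p) = letter_act (Base (endo A h)) (letter_act Up p)"
  by (auto simp: fun_eq_iff algebra_simps endo_mult funpow_swap1 split: nat.splits)

lemma letter_act_base_down:
  "letter_act (Base h) (letter_act Down p) = letter_act Down (letter_act (Base (endo A h)) p)"
  by (auto simp: fun_eq_iff algebra_simps funpow_swap1 split: nat.splits)

text \<open>The elements acting by zero form a two-sided ideal containing the defining relations, so the
  action descends to the algebra.\<close>

lemma free_act_ideal:
  assumes "x \<in> tgwa_ideal A"
  shows "free_act x p = 0"
proof -
  let ?I = "{x. \<forall>p. free_act x p = 0}"
  have "ideal ?I class_ring"
  proof (rule idealI)
    show "subgroup ?I (add_monoid class_ring)"
    proof
      show "inv\<^bsub>add_monoid class_ring\<^esub> x \<in> ?I" if "x \<in> ?I" for x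
      proof -
        have "\<ominus>\<^bsub>class_ring\<^esub> x = - x" by (simp only: class_ring_simps)
        then have "inv\<^bsub>add_monoid class_ring\<^esub> x = - x" by (simp add: a_inv_def)
        then show ?thesis using that by (simp add: free_act_uminus)
      qed
    qed (auto simp: free_act_add_left free_act_zero)
  qed (auto simp: free_act_mult free_act_zero_right class_ring.ring_axioms)
  moreover have "tgwa_relations A \<subseteq> ?I"
    by (auto simp: tgwa_relations_def free_act_diff free_act_add_left free_act_mult free_act_gen
        free_act_scalar letter_act_up_down letter_act_up_base letter_act_base_down
        simp del: letter_act.simps)
      (auto simp: fun_eq_iff scale_def endo_pow_add endo_pow_mult endo_pow_scalar algebra_simps)
  ultimately show ?thesis using tgwa_ideal_minimal assms by blast
qed

lemma free_act_cong: "tgwa_eq A x y \<Longrightarrow> free_act x p = free_act y p"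
  using free_act_ideal[of "x - y" p] by (simp add: tgwa_eq_def free_act_diff)

text \<open>The family of coefficients of the unit element.\<close>

definition vacuum :: "nat \<Rightarrow> nat \<Rightarrow> 'h" where
  "vacuum = (\<lambda>i j. if i = 0 \<and> j = 0 then 1 else 0)"

text \<open>The coefficients of an element with respect to the monomials \<open>d^i h u^j\<close>.\<close>

definition pbw_coeffs :: "('k, 'h tgwa_letter) free_alg \<Rightarrow> nat \<Rightarrow> nat \<Rightarrow> 'h" where
  "pbw_coeffs x = free_act x vacuum"

text \<open>The normal form monomial \<open>d^i h u^j\<close>; it is additive in \<open>h\<close> only modulo the relations.\<close>

definition pbw_monomial :: "nat \<Rightarrow> nat \<Rightarrow> 'h \<Rightarrow> ('k, 'h tgwa_letter) free_alg" where
  "pbw_monomial i j h = free_gen Down ^ i * free_gen (Base h) * free_gen Up ^ j"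

lemma pbw_coeffs_add: "pbw_coeffs (x + y) = pbw_coeffs x + pbw_coeffs y"
  by (simp add: pbw_coeffs_def free_act_add_left)

lemma pbw_coeffs_cong: "tgwa_eq A x y \<Longrightarrow> pbw_coeffs x = pbw_coeffs y"
  by (simp add: pbw_coeffs_def free_act_cong)

lemma pbw_coeffs_pbw_monomial: "pbw_coeffs (pbw_monomial i j h) = (\<lambda>a b. if a = i \<and> b = j then h else 0)"
proof -
  have up: "free_act (free_gen Up ^ j) vacuum = (\<lambda>a b. if a = 0 \<and> b = j then 1 else 0)"
  proof (induction j)
    case 0
    have "free_act 1 vacuum = vacuum"
      by (metis free_scalar_one free_act_scalar scale_one)
    then show ?case by (simp add: vacuum_def)
  next
    case (Suc j)
    then show ?case
      by (auto simp: free_act_mult free_act_gen fun_eq_iff endo_zero endo_one split: nat.splits)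
  qed
  have down: "free_act (free_gen Down ^ i) (\<lambda>a b. if a = 0 \<and> b = j then h else 0)
      = (\<lambda>a b. if a = i \<and> b = j then h else 0)"
  proof (induction i)
    case 0
    show ?case by (metis (no_types, lifting) free_scalar_one free_act_scalar scale_one power_0)
  next
    case (Suc i)
    then show ?case
      by (auto simp: free_act_mult free_act_gen fun_eq_iff split: nat.splits)
  qed
  have "letter_act (Base h) (\<lambda>a b. if a = 0 \<and> b = j then 1 else 0)
      = (\<lambda>a b. if a = 0 \<and> b = j then h else 0)"
    by (auto simp: fun_eq_iff)
  then show ?thesis
    by (simp only: pbw_coeffs_def pbw_monomial_def free_act_mult up free_act_gen down)
qed

lemma pbw_monomial_zero: "tgwa_eq A (pbw_monomial i j 0) 0"
proof -
  have "tgwa_eq A (pbw_monomial i j 0) (free_gen Down ^ i * 0 * free_gen Up ^ j)"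
    unfolding pbw_monomial_def by (intro tgwa_eq_mult tgwa_eq_base_zero) simp_all
  then show ?thesis by simp
qed

lemma pbw_monomial_add: "tgwa_eq A (pbw_monomial i j (g + h)) (pbw_monomial i j g + pbw_monomial i j h)"
proof -
  have "tgwa_eq A (pbw_monomial i j (g + h))
      (free_gen Down ^ i * (free_gen (Base g) + free_gen (Base h)) * free_gen Up ^ j)"
    unfolding pbw_monomial_def by (intro tgwa_eq_mult tgwa_eq_base_add) simp_all
  then show ?thesis by (simp add: pbw_monomial_def algebra_simps)
qed

lemma base_down_power:
  "tgwa_eq A (free_gen (Base g) * free_gen Down ^ i)
    (free_gen Down ^ i * free_gen (Base ((endo A ^^ i) g)))"
proof (induction i arbitrary: g)
  case (Suc i)
  have "free_gen (Base g) * free_gen Down ^ Suc i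
      = (free_gen (Base g) * free_gen Down) * (free_gen Down ^ i :: ('k, 'h tgwa_letter) free_alg)"
    by (simp add: mult.assoc)
  also have "tgwa_eq A \<dots> (free_gen Down * free_gen (Base (endo A g)) * free_gen Down ^ i)"
    by (rule tgwa_eq_mult[OF tgwa_eq_base_down tgwa_eq_refl])
  also have "\<dots> = free_gen Down * (free_gen (Base (endo A g)) * free_gen Down ^ i)"
    by (simp add: mult.assoc)
  also have "tgwa_eq A \<dots> (free_gen Down * (free_gen Down ^ i * free_gen (Base ((endo A ^^ i) (endo A g)))))"
    by (rule tgwa_eq_mult[OF tgwa_eq_refl Suc])
  also have "\<dots> = free_gen Down ^ Suc i * free_gen (Base ((endo A ^^ Suc i) g))"
    by (simp add: mult.assoc funpow_swap1)
  finally show ?case .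
qed simp

lemma base_pbw_monomial:
  "tgwa_eq A (free_gen (Base g) * pbw_monomial i j h) (pbw_monomial i j ((endo A ^^ i) g * h))"
proof -
  have "tgwa_eq A (free_gen (Base g) * pbw_monomial i j h)
      (free_gen Down ^ i * free_gen (Base ((endo A ^^ i) g)) * (free_gen (Base h) * free_gen Up ^ j))"
    unfolding pbw_monomial_def mult.assoc
    unfolding mult.assoc[symmetric, of "free_gen (Base g)"]
      mult.assoc[symmetric, of "free_gen Down ^ i" "free_gen (Base ((endo A ^^ i) g))"]
    by (intro tgwa_eq_mult base_down_power) simp_all
  also have "tgwa_eq A \<dots> (pbw_monomial i j ((endo A ^^ i) g * h))"
    unfolding pbw_monomial_def mult.assoc
    unfolding mult.assoc[symmetric, of "free_gen (Base ((endo A ^^ i) g))"]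
    by (intro tgwa_eq_mult tgwa_eq_sym[OF tgwa_eq_base_mult]) simp_all
  finally show ?thesis .
qed

lemma base_one: "tgwa_eq A (free_gen (Base 1)) 1"
  using tgwa_eq_base_scalar[of A 1] by (simp add: scalar_map_one free_scalar_one)

lemma up_down_power:
  "tgwa_eq A (free_gen Up * free_gen Down ^ i)
    (free_gen Down ^ (i - 1) * free_gen (Base (lower_coeff i))
      + free_gen Down ^ i * free_gen (Base (raise_coeff i)) * free_gen Up)"
proof (induction i)
  case 0
  have "tgwa_eq A (free_gen (Base 0) + free_gen (Base 1) * free_gen Up) (0 + 1 * free_gen Up)"
    by (intro tgwa_eq_add tgwa_eq_mult tgwa_eq_base_zero base_one) simp_all
  then show ?case by (simp add: tgwa_eq_sym)
next
  case (Suc i)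
  let ?d = "free_gen Down :: ('k, 'h tgwa_letter) free_alg"
  let ?u = "free_gen Up :: ('k, 'h tgwa_letter) free_alg"
  let ?b = "\<lambda>h. free_gen (Base h) :: ('k, 'h tgwa_letter) free_alg"
  let ?e = "\<lambda>i h. (endo A ^^ i) h"
  have "tgwa_eq A (?u * ?d ^ Suc i) ((?b (z_zero A) + ?d * ?b (z_one A) * ?u) * ?d ^ i)"
    unfolding power_Suc mult.assoc[symmetric] by (intro tgwa_eq_mult tgwa_eq_up_down) simp_all
  also have "\<dots> = ?b (z_zero A) * ?d ^ i + ?d * ?b (z_one A) * (?u * ?d ^ i)"
    by (simp add: algebra_simps)
  also have "tgwa_eq A \<dots> (?d ^ i * ?b (?e i (z_zero A)) + ?d * ?b (z_one A)
      * (?d ^ (i - 1) * ?b (lower_coeff i) + ?d ^ i * ?b (raise_coeff i) * ?u))"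
    by (intro tgwa_eq_add tgwa_eq_mult base_down_power Suc) simp_all
  also have "\<dots> = ?d ^ i * ?b (?e i (z_zero A)) + (?d * (?b (z_one A) * ?d ^ (i - 1)) * ?b (lower_coeff i)
      + ?d * (?b (z_one A) * ?d ^ i) * ?b (raise_coeff i) * ?u)"
    by (simp add: algebra_simps)
  also have "tgwa_eq A \<dots> (?d ^ i * ?b (?e i (z_zero A))
      + (?d * (?d ^ (i - 1) * ?b (?e (i - 1) (z_one A))) * ?b (lower_coeff i)
      + ?d * (?d ^ i * ?b (?e i (z_one A))) * ?b (raise_coeff i) * ?u))"
    by (intro tgwa_eq_add tgwa_eq_mult base_down_power) simp_all
  also have "\<dots> = ?d ^ i * ?b (?e i (z_zero A))
      + (?d * ?d ^ (i - 1) * (?b (?e (i - 1) (z_one A)) * ?b (lower_coeff i))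
      + ?d ^ Suc i * (?b (?e i (z_one A)) * ?b (raise_coeff i)) * ?u)"
    by (simp add: algebra_simps)
  also have "tgwa_eq A \<dots> (?d ^ i * ?b (?e i (z_zero A))
      + (?d * ?d ^ (i - 1) * ?b (?e (i - 1) (z_one A) * lower_coeff i)
      + ?d ^ Suc i * ?b (raise_coeff (Suc i)) * ?u))"
    by (intro tgwa_eq_add tgwa_eq_mult)
      (simp_all add: tgwa_eq_sym[OF tgwa_eq_base_mult])
  also have "tgwa_eq A \<dots> (?d ^ i * ?b (?e i (z_zero A))
      + (?d ^ i * ?b (?e (i - 1) (z_one A) * lower_coeff i)
      + ?d ^ Suc i * ?b (raise_coeff (Suc i)) * ?u))"
  proof (cases i)
    case 0
    \<comment> \<open>Here the exponent \<open>i - 1\<close> is truncated, but the coefficient vanishes.\<close>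
    have *: "tgwa_eq A (x * ?b 0) 0" for x
      using tgwa_eq_mult[OF tgwa_eq_refl tgwa_eq_base_zero, of A x] by simp
    have "tgwa_eq A (?d * ?b 0) (?b 0)"
      by (rule tgwa_eq_trans[OF * tgwa_eq_sym[OF tgwa_eq_base_zero]])
    then show ?thesis
      unfolding 0 by (intro tgwa_eq_add) simp_all
  qed simp
  also have "\<dots> = ?d ^ i * (?b (?e i (z_zero A)) + ?b (?e (i - 1) (z_one A) * lower_coeff i))
      + ?d ^ Suc i * ?b (raise_coeff (Suc i)) * ?u"
    by (simp add: algebra_simps)
  also have "tgwa_eq A \<dots> (?d ^ i * ?b (lower_coeff (Suc i))
      + ?d ^ Suc i * ?b (raise_coeff (Suc i)) * ?u)"
    by (intro tgwa_eq_add tgwa_eq_mult) (simp_all add: tgwa_eq_sym[OF tgwa_eq_base_add])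
  finally show ?case by simp
qed

lemma up_pbw_monomial:
  "tgwa_eq A (free_gen Up * pbw_monomial i j h)
    (pbw_monomial (i - 1) j (lower_coeff i * h) + pbw_monomial i (Suc j) (raise_coeff i * endo A h))"
proof -
  let ?d = "free_gen Down :: ('k, 'h tgwa_letter) free_alg"
  let ?u = "free_gen Up :: ('k, 'h tgwa_letter) free_alg"
  let ?b = "\<lambda>h. free_gen (Base h) :: ('k, 'h tgwa_letter) free_alg"
  have "free_gen Up * pbw_monomial i j h = (?u * ?d ^ i) * (?b h * ?u ^ j)"
    by (simp add: pbw_monomial_def mult.assoc)
  also have "tgwa_eq A \<dots> ((?d ^ (i - 1) * ?b (lower_coeff i) + ?d ^ i * ?b (raise_coeff i) * ?u)
      * (?b h * ?u ^ j))"
    by (intro tgwa_eq_mult up_down_power) simp_all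
  also have "\<dots> = ?d ^ (i - 1) * (?b (lower_coeff i) * ?b h) * ?u ^ j
      + ?d ^ i * ?b (raise_coeff i) * (?u * ?b h) * ?u ^ j"
    by (simp add: algebra_simps)
  also have "tgwa_eq A \<dots> (?d ^ (i - 1) * ?b (lower_coeff i * h) * ?u ^ j
      + ?d ^ i * ?b (raise_coeff i) * (?b (endo A h) * ?u) * ?u ^ j)"
    by (intro tgwa_eq_add tgwa_eq_mult tgwa_eq_up_base)
      (simp_all add: tgwa_eq_sym[OF tgwa_eq_base_mult])
  also have "\<dots> = pbw_monomial (i - 1) j (lower_coeff i * h)
      + ?d ^ i * (?b (raise_coeff i) * ?b (endo A h)) * ?u ^ Suc j"
    by (simp add: pbw_monomial_def algebra_simps)
  also have "tgwa_eq A \<dots> (pbw_monomial (i - 1) j (lower_coeff i * h) + pbw_monomial i (Suc j) (raise_coeff i * endo A h))"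
    unfolding pbw_monomial_def by (intro tgwa_eq_add tgwa_eq_mult)
      (simp_all add: tgwa_eq_sym[OF tgwa_eq_base_mult])
  finally show ?thesis .
qed

text \<open>An element expands if it is congruent to the combination of monomials that its coefficients
  prescribe.  Congruence to some combination of monomials would follow from the relations alone;
  naming the coefficients builds in their uniqueness.\<close>

definition expands :: "('k, 'h tgwa_letter) free_alg \<Rightarrow> bool" where
  "expands x \<longleftrightarrow> (\<exists>S. finite S \<and> (\<forall>i j. (i, j) \<notin> S \<longrightarrow> pbw_coeffs x i j = 0)
     \<and> tgwa_eq A x (\<Sum>(i, j)\<in>S. pbw_monomial i j (pbw_coeffs x i j)))"

lemma expands_cong: "tgwa_eq A x y \<Longrightarrow> expands y \<Longrightarrow> expands x"
  using pbw_coeffs_cong[of x y] tgwa_eq_trans[of A x y] unfolding expands_def by auto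

lemma sum_pbw_superset:
  assumes "finite S" "T \<subseteq> S" "\<And>i j. (i, j) \<notin> T \<Longrightarrow> p i j = 0"
  shows "tgwa_eq A (\<Sum>(i, j)\<in>S. pbw_monomial i j (p i j)) (\<Sum>(i, j)\<in>T. pbw_monomial i j (p i j))"
proof -
  have "(\<Sum>(i, j)\<in>T. pbw_monomial i j (p i j)) = (\<Sum>(i, j)\<in>S. if (i, j) \<in> T then pbw_monomial i j (p i j) else 0)"
    by (rule sum.mono_neutral_cong_left[OF assms(1,2)]) auto
  also have "tgwa_eq A \<dots> (\<Sum>(i, j)\<in>S. pbw_monomial i j (p i j))"
    by (rule tgwa_eq_sum) (auto simp: assms(3) tgwa_eq_sym[OF pbw_monomial_zero])
  finally show ?thesis by (rule tgwa_eq_sym)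
qed

lemma expands_add:
  assumes "expands x" "expands y"
  shows "expands (x + y)"
proof -
  obtain S where S: "finite S" "\<And>i j. (i, j) \<notin> S \<Longrightarrow> pbw_coeffs x i j = 0"
      "tgwa_eq A x (\<Sum>(i, j)\<in>S. pbw_monomial i j (pbw_coeffs x i j))"
    using assms(1) unfolding expands_def by blast
  obtain T where T: "finite T" "\<And>i j. (i, j) \<notin> T \<Longrightarrow> pbw_coeffs y i j = 0"
      "tgwa_eq A y (\<Sum>(i, j)\<in>T. pbw_monomial i j (pbw_coeffs y i j))"
    using assms(2) unfolding expands_def by blast
  have x: "tgwa_eq A x (\<Sum>(i, j)\<in>S \<union> T. pbw_monomial i j (pbw_coeffs x i j))"
    by (rule tgwa_eq_trans[OF S(3)], rule tgwa_eq_sym, rule sum_pbw_superset)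
      (use S T in auto)
  have y: "tgwa_eq A y (\<Sum>(i, j)\<in>S \<union> T. pbw_monomial i j (pbw_coeffs y i j))"
    by (rule tgwa_eq_trans[OF T(3)], rule tgwa_eq_sym, rule sum_pbw_superset)
      (use S T in auto)
  let ?p = "pbw_coeffs x" and ?q = "pbw_coeffs y"
  have "tgwa_eq A (x + y) ((\<Sum>(i, j)\<in>S \<union> T. pbw_monomial i j (?p i j))
      + (\<Sum>(i, j)\<in>S \<union> T. pbw_monomial i j (?q i j)))"
    by (rule tgwa_eq_add[OF x y])
  also have "\<dots> = (\<Sum>(i, j)\<in>S \<union> T. pbw_monomial i j (?p i j) + pbw_monomial i j (?q i j))"
    by (simp add: sum.distrib split_def)
  also have "tgwa_eq A \<dots> (\<Sum>(i, j)\<in>S \<union> T. pbw_monomial i j (pbw_coeffs (x + y) i j))"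
    by (rule tgwa_eq_sum) (auto simp: pbw_coeffs_add tgwa_eq_sym[OF pbw_monomial_add])
  finally show ?thesis
    unfolding expands_def using S T by (intro exI[of _ "S \<union> T"]) (auto simp: pbw_coeffs_add)
qed

lemma expands_pbw_monomial: "expands (pbw_monomial i j h)"
  unfolding expands_def pbw_coeffs_pbw_monomial by (intro exI[of _ "{(i, j)}"]) auto

lemma expands_zero: "expands 0"
  by (rule expands_cong[OF tgwa_eq_sym[OF pbw_monomial_zero] expands_pbw_monomial])

lemma expands_sum: "(\<And>k. k \<in> S \<Longrightarrow> expands (f k)) \<Longrightarrow> expands (sum f S)"
  by (induction S rule: infinite_finite_induct) (auto simp: expands_zero expands_add)

lemma expands_gen_mult:
  assumes "expands x"
  shows "expands (free_gen a * x)"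
proof -
  obtain S where S: "tgwa_eq A x (\<Sum>(i, j)\<in>S. pbw_monomial i j (pbw_coeffs x i j))"
    using assms unfolding expands_def by blast
  have "expands (free_gen a * pbw_monomial i j h)" for i j h
  proof (cases a)
    case (Base g)
    then show ?thesis using expands_cong[OF base_pbw_monomial expands_pbw_monomial] by simp
  next
    case Down
    have "free_gen Down * pbw_monomial i j h = pbw_monomial (Suc i) j h"
      by (simp add: pbw_monomial_def mult.assoc)
    then show ?thesis using Down expands_pbw_monomial by simp
  next
    case Up
    then show ?thesis using expands_cong[OF up_pbw_monomial expands_add[OF expands_pbw_monomial expands_pbw_monomial]] by simp
  qed
  then have "expands (\<Sum>(i, j)\<in>S. free_gen a * pbw_monomial i j (pbw_coeffs x i j))"
    by (intro expands_sum) auto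
  moreover have "tgwa_eq A (free_gen a * x) (\<Sum>(i, j)\<in>S. free_gen a * pbw_monomial i j (pbw_coeffs x i j))"
    using tgwa_eq_mult[OF tgwa_eq_refl S, of "free_gen a"]
    by (simp add: sum_distrib_left split_def)
  ultimately show ?thesis using expands_cong by blast
qed

text \<open>The basis theorem: the elements that expand are stable under left multiplication by letters and
  contain \<open>1\<close>, so every element does.\<close>

theorem pbw_coeffs_expansion:
  obtains S where "finite S" "\<And>i j. (i, j) \<notin> S \<Longrightarrow> pbw_coeffs x i j = 0"
    "tgwa_eq A x (\<Sum>(i, j)\<in>S. pbw_monomial i j (pbw_coeffs x i j))"
proof -
  have "expands (x * y)" if "expands y" for y
    using that
  proof (induction x arbitrary: y rule: free_alg_induct)
    case (scalar c)
    have "tgwa_eq A (free_scalar c * y) (free_gen (Base (scalar_map A c)) * y)"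
      by (intro tgwa_eq_mult tgwa_eq_sym[OF tgwa_eq_base_scalar]) simp_all
    then show ?case using expands_cong expands_gen_mult[OF scalar] by blast
  qed (simp_all add: expands_gen_mult expands_add distrib_right mult.assoc)
  moreover have "expands 1"
    using expands_cong[OF tgwa_eq_sym[OF base_one]] expands_pbw_monomial[of 0 0 1]
    by (simp add: pbw_monomial_def)
  ultimately have "expands (x * 1)" by blast
  then show ?thesis using that unfolding expands_def by auto
qed

lemma pbw_coeffs_eq_zero:
  assumes "pbw_coeffs x = 0"
  shows "x \<in> tgwa_ideal A"
proof -
  obtain S where S: "finite S" "tgwa_eq A x (\<Sum>(i, j)\<in>S. pbw_monomial i j (pbw_coeffs x i j))"
    by (rule pbw_coeffs_expansion)
  note S(2)
  also have "tgwa_eq A (\<Sum>(i, j)\<in>S. pbw_monomial i j (pbw_coeffs x i j)) (\<Sum>(i, j)\<in>S. 0)"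
    by (rule tgwa_eq_sum) (auto simp: assms pbw_monomial_zero)
  finally show ?thesis by (simp add: tgwa_eq_zero_iff)
qed

end


section \<open>Values of rational functions at \<open>q = 1\<close>\<close>

text \<open>The relational form of \<^const>\<open>value_at_one\<close>: the function is regular at \<open>1\<close>, with value \<open>c\<close>.\<close>

definition has_value :: "'a::field ratfun \<Rightarrow> 'a \<Rightarrow> bool" where
  "has_value x c \<longleftrightarrow>
    (\<exists>a b. poly b 1 \<noteq> 0 \<and> x = Fraction_Field.Fract a b \<and> c = poly a 1 / poly b 1)"

lemma poly_one_nonzero: "poly b 1 \<noteq> 0 \<Longrightarrow> b \<noteq> 0"
  by auto

lemma has_value_unique:
  assumes "has_value x c" "has_value x d"
  shows "c = d"
proof -
  obtain a b a' b' where *: "poly b 1 \<noteq> 0" "x = Fraction_Field.Fract a b" "c = poly a 1 / poly b 1"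
    "poly b' 1 \<noteq> 0" "x = Fraction_Field.Fract a' b'" "d = poly a' 1 / poly b' 1"
    using assms unfolding has_value_def by blast
  then have "a * b' = a' * b"
    by (metis eq_fract(1) poly_one_nonzero)
  then have "poly a 1 * poly b' 1 = poly a' 1 * poly b 1"
    by (metis poly_mult)
  then show ?thesis unfolding *(3,6) using *(1,4) by (simp add: frac_eq_eq)
qed

lemma value_at_one_eqI: "has_value x c \<Longrightarrow> value_at_one x = c"
  unfolding value_at_one_def
  by (rule the_equality) (use has_value_unique has_value_def in blast)+

lemma regular_at_one_iff: "x \<in> regular_at_one \<longleftrightarrow> (\<exists>c. has_value x c)"
  by (auto simp: regular_at_one_def has_value_def)

lemma has_value_value_at_one: "x \<in> regular_at_one \<Longrightarrow> has_value x (value_at_one x)"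
  using value_at_one_eqI regular_at_one_iff by blast

lemma has_value_add:
  assumes "has_value x c" "has_value y d"
  shows "has_value (x + y) (c + d)"
proof -
  obtain a b a' b' where *: "poly b 1 \<noteq> 0" "x = Fraction_Field.Fract a b" "c = poly a 1 / poly b 1"
    "poly b' 1 \<noteq> 0" "y = Fraction_Field.Fract a' b'" "d = poly a' 1 / poly b' 1"
    using assms unfolding has_value_def by blast
  then have "x + y = Fraction_Field.Fract (a * b' + a' * b) (b * b')"
    by (simp add: poly_one_nonzero)
  moreover have "c + d = poly (a * b' + a' * b) 1 / poly (b * b') 1" "poly (b * b') 1 \<noteq> 0"
    unfolding *(3,6) using *(1,4) by (simp_all add: field_simps)
  ultimately show ?thesis unfolding has_value_def by blast
qed

lemma has_value_mult:
  assumes "has_value x c" "has_value y d"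
  shows "has_value (x * y) (c * d)"
proof -
  obtain a b a' b' where *: "poly b 1 \<noteq> 0" "x = Fraction_Field.Fract a b" "c = poly a 1 / poly b 1"
    "poly b' 1 \<noteq> 0" "y = Fraction_Field.Fract a' b'" "d = poly a' 1 / poly b' 1"
    using assms unfolding has_value_def by blast
  then have "x * y = Fraction_Field.Fract (a * a') (b * b')"
    by simp
  moreover have "c * d = poly (a * a') 1 / poly (b * b') 1" "poly (b * b') 1 \<noteq> 0"
    unfolding *(3,6) using *(1,4) by (simp_all add: field_simps)
  ultimately show ?thesis unfolding has_value_def by blast
qed

lemma has_value_inverse:
  assumes "has_value x c" "c \<noteq> 0"
  shows "has_value (inverse x) (inverse c)"
proof -
  obtain a b where *: "poly b 1 \<noteq> 0" "x = Fraction_Field.Fract a b" "c = poly a 1 / poly b 1"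
    using assms unfolding has_value_def by blast
  then have "inverse x = Fraction_Field.Fract b a" "poly a 1 \<noteq> 0" "inverse c = poly b 1 / poly a 1"
    using assms by auto
  then show ?thesis unfolding has_value_def by blast
qed

lemma has_value_to_fract: "has_value (to_fract a) (poly a 1)"
  unfolding has_value_def to_fract_def by (intro exI[of _ a] exI[of _ 1]) simp

lemma has_value_const: "has_value (ratfun_const c) c"
  using has_value_to_fract[of "[:c:]"] by (simp add: ratfun_const_def)

lemma has_value_qvar: "has_value qvar 1"
  using has_value_to_fract[of "[:0, 1:]"] by (simp add: qvar_def)

lemma ratfun_const_add: "ratfun_const (a + b) = ratfun_const a + ratfun_const b"
  by (simp add: ratfun_const_def to_fract_def)

lemma ratfun_const_mult: "ratfun_const (a * b) = ratfun_const a * ratfun_const b"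
  by (simp add: ratfun_const_def to_fract_def mult.commute)

lemma ratfun_const_zero: "ratfun_const 0 = 0"
  by (simp add: ratfun_const_def to_fract_def Zero_fract_def)

lemma ratfun_const_one: "ratfun_const 1 = 1"
  by (simp add: ratfun_const_def to_fract_def One_fract_def one_pCons)

lemma has_value_zero: "has_value 0 0"
  using has_value_const[of 0] by (simp add: ratfun_const_zero)

lemma has_value_one: "has_value 1 1"
  using has_value_const[of 1] by (simp add: ratfun_const_one)

lemma has_value_uminus:
  fixes c :: "'a::field"
  assumes "has_value x c"
  shows "has_value (- x) (- c)"
proof -
  have "ratfun_const (- 1 :: 'a) = - 1"
    using ratfun_const_add[of "1 :: 'a" "- 1"] by (simp add: ratfun_const_one ratfun_const_zero add_eq_0_iff)
  then show ?thesis using has_value_mult[OF has_value_const[of "- 1"] assms] by simp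
qed

lemma has_value_diff: "has_value x c \<Longrightarrow> has_value y d \<Longrightarrow> has_value (x - y) (c - d)"
  using has_value_add[of x c "- y" "- d"] has_value_uminus by fastforce

lemma has_value_power: "has_value x c \<Longrightarrow> has_value (x ^ n) (c ^ n)"
  by (induction n) (auto intro: has_value_mult has_value_one)

lemma has_value_power_int: "has_value x 1 \<Longrightarrow> has_value (x powi n) 1"
  using has_value_power[of x 1] has_value_inverse[of x 1]
    has_value_power[of "inverse x" 1]
  by (auto simp: power_int_def)

lemma has_value_nonzero: "has_value x c \<Longrightarrow> c \<noteq> 0 \<Longrightarrow> x \<noteq> 0"
  using has_value_unique has_value_zero by blast

lemma qvar_neq_one [simp]: "qvar \<noteq> (1 :: 'a::field ratfun)"
proof
  assume "qvar = (1 :: 'a ratfun)"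
  then have "Fraction_Field.Fract [:0, 1:] 1 = (Fraction_Field.Fract 1 1 :: 'a ratfun)"
    by (simp only: qvar_def to_fract_def One_fract_def)
  then show False by (simp add: eq_fract one_pCons)
qed

lemma has_value_zeroE:
  assumes "has_value x 0"
  obtains y c where "has_value y c" "x = (qvar - 1) * y"
proof -
  obtain a b where *: "poly b 1 \<noteq> 0" "x = Fraction_Field.Fract a b" "0 = poly a 1 / poly b 1"
    using assms unfolding has_value_def by blast
  then have "poly a 1 = 0" by simp
  then obtain a' where a': "a = [:- 1, 1:] * a'"
    by (auto simp: poly_eq_0_iff_dvd elim: dvdE)
  have "qvar - 1 = (Fraction_Field.Fract [:- 1, 1:] 1 :: 'a ratfun)"
    by (simp add: qvar_def to_fract_def One_fract_def one_pCons)
  then have "x = (qvar - 1) * Fraction_Field.Fract a' b"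
    by (simp only: *(2) a' mult_fract mult_1)
  moreover have "has_value (Fraction_Field.Fract a' b) (poly a' 1 / poly b 1)"
    using * unfolding has_value_def by blast
  ultimately show ?thesis using that by blast
qed

text \<open>The value at \<open>q = 1\<close> of a quantum integer.\<close>

lemma has_value_q_number:
  "has_value ((qvar powi k - 1) / (qvar - 1)) (of_int k :: 'a::field)"
proof -
  have nat: "has_value ((qvar ^ n - 1) / (qvar - 1)) (of_nat n :: 'a)" for n
  proof (induction n)
    case 0
    show ?case by (simp add: has_value_zero)
  next
    case (Suc n)
    have "((qvar :: 'a ratfun) ^ Suc n - 1) / (qvar - 1) = (qvar ^ n - 1) / (qvar - 1) * qvar + 1"
    proof -
      have "(qvar :: 'a ratfun) ^ Suc n - 1 = (qvar ^ n - 1) * qvar + (qvar - 1)"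
        by (simp add: algebra_simps)
      then show ?thesis by (simp only: add_divide_distrib) simp
    qed
    then show ?case
      using has_value_add[OF has_value_mult[OF Suc has_value_qvar] has_value_one]
      by (simp add: add.commute)
  qed
  show ?thesis
  proof (cases "k \<ge> 0")
    case True
    then show ?thesis using nat[of "nat k"] by (simp add: power_int_def)
  next
    case False
    let ?n = "nat (- k)"
    have q0: "(qvar :: 'a ratfun) \<noteq> 0" using has_value_nonzero[OF has_value_qvar] by simp
    have "(qvar :: 'a ratfun) powi k = inverse (qvar ^ ?n)"
      using False by (simp add: power_int_def power_inverse)
    then have "((qvar :: 'a ratfun) powi k - 1) / (qvar - 1)
        = - (inverse (qvar ^ ?n) * ((qvar ^ ?n - 1) / (qvar - 1)))"
      using q0 by (simp add: field_simps)
    moreover have "has_value (- (inverse (qvar ^ ?n) * ((qvar ^ ?n - 1) / (qvar - 1))))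
        (- (inverse (1 ^ ?n) * of_nat ?n) :: 'a)"
      by (intro has_value_uminus has_value_mult has_value_inverse has_value_power has_value_qvar nat)
        simp
    ultimately show ?thesis using False by simp
  qed
qed

lemma qvar_power_int_eq_one_iff: "qvar powi k = (1 :: 'a::field_char_0 ratfun) \<longleftrightarrow> k = 0"
proof
  assume "qvar powi k = (1 :: 'a ratfun)"
  then have "has_value (0 :: 'a ratfun) (of_int k)" using has_value_q_number[of k, where ?'a = 'a] by simp
  then show "k = 0" using has_value_unique has_value_zero by force
qed simp


section \<open>Laurent polynomials\<close>

lemma laurent_const_add: "laurent_const (a + b) = laurent_const a + laurent_const b"
  by (simp add: laurent_const_def single_add)

lemma laurent_const_mult: "laurent_const (a * b) = laurent_const a * laurent_const b"
  by (simp add: laurent_const_def mult_single)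

lemma laurent_const_one: "laurent_const 1 = 1"
  by (simp add: laurent_const_def)

lemma laurent_const_zero: "laurent_const 0 = 0"
  by (simp add: laurent_const_def)

lemma laurent_const_uminus: "laurent_const (- a) = - laurent_const a"
  by (simp add: laurent_const_def single_uminus)

lemma laurent_const_diff: "laurent_const (a - b) = laurent_const a - laurent_const b"
  by (simp add: laurent_const_def single_diff)

lemma Kpow_add: "Kpow (m + n) = Kpow m * Kpow n"
  by (simp add: Kpow_def mult_single)

lemma Kpow_zero: "Kpow 0 = 1"
  by (simp add: Kpow_def)

lemma laurent_eval_single: "laurent_eval x (Poly_Mapping.single n c) = c * x powi n"
  by (simp add: laurent_eval_def)

lemma laurent_eval_superset:
  assumes "finite S" "Poly_Mapping.keys p \<subseteq> S"
  shows "laurent_eval x p = (\<Sum>n\<in>S. Poly_Mapping.lookup p n * x powi n)"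
  unfolding laurent_eval_def
  by (rule sum.mono_neutral_left[OF assms]) (auto simp: in_keys_iff)

lemma laurent_eval_add: "laurent_eval x (p + r) = laurent_eval x p + laurent_eval x r"
proof -
  let ?S = "Poly_Mapping.keys p \<union> Poly_Mapping.keys r"
  have "Poly_Mapping.keys (p + r) \<subseteq> ?S" by (rule Poly_Mapping.keys_add)
  then show ?thesis
    by (simp add: laurent_eval_superset[of ?S] lookup_add distrib_right sum.distrib)
qed

lemma laurent_eval_mult:
  assumes "x \<noteq> 0"
  shows "laurent_eval x (p * r) = laurent_eval x p * laurent_eval x r"
proof (induction p rule: poly_mapping_single_add_induct)
  case (single n c)
  show ?case
  proof (induction r rule: poly_mapping_single_add_induct)
    case (single k d)
    then show ?case using assms by (simp add: mult_single laurent_eval_single power_int_add)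
  qed (simp add: laurent_eval_add distrib_left)
qed (simp add: laurent_eval_add distrib_right)

lemma laurent_eval_const: "laurent_eval x (laurent_const c) = c"
  by (simp add: laurent_const_def laurent_eval_single)

lemma laurent_eval_Kpow: "laurent_eval x (Kpow n) = x powi n"
  by (simp add: Kpow_def laurent_eval_single)

lemma laurent_eval_K_quotient:
  assumes "x \<noteq> 0"
  shows "laurent_eval x K_quotient = (x - 1) / (qvar - 1)"
proof -
  have "laurent_eval x (Kpow 1 + - 1) = x + - 1"
    using laurent_eval_const[of x "- 1"]
    by (simp only: laurent_eval_add laurent_eval_Kpow laurent_const_uminus laurent_const_one
        power_int_1_right)
  then have "laurent_eval x (Kpow 1 - 1) = x - 1" by simp
  then show ?thesis
    by (simp add: K_quotient_def laurent_eval_mult[OF assms] laurent_eval_const divide_inverse)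
qed

lemma laurent_rescale_single:
  "laurent_rescale c (Poly_Mapping.single n a) = Poly_Mapping.single n (c powi n * a)"
  by (rule poly_mapping_eqI)
    (auto simp: laurent_rescale_def lookup_mapp lookup_single when_def in_keys_iff)

lemma laurent_rescale_add:
  "laurent_rescale c (p + r) = laurent_rescale c p + laurent_rescale c r"
  by (rule poly_mapping_eqI)
    (auto simp: laurent_rescale_def lookup_mapp lookup_add when_def in_keys_iff algebra_simps
      simp flip: distrib_left)

lemma laurent_rescale_mult:
  assumes "c \<noteq> 0"
  shows "laurent_rescale c (p * r) = laurent_rescale c p * laurent_rescale c r"
proof (induction p rule: poly_mapping_single_add_induct)
  case (single n a)
  show ?case
  proof (induction r rule: poly_mapping_single_add_induct)
    case (single k b)
    then show ?case
      using assms by (simp add: mult_single laurent_rescale_single power_int_add mult_ac)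
  qed (simp add: laurent_rescale_add distrib_left)
qed (simp add: laurent_rescale_add distrib_right)

lemma laurent_rescale_const: "laurent_rescale c (laurent_const a) = laurent_const a"
  by (simp add: laurent_const_def laurent_rescale_single)

lemma laurent_rescale_Kpow: "laurent_rescale c (Kpow n) = laurent_const (c powi n) * Kpow n"
  by (simp add: Kpow_def laurent_const_def laurent_rescale_single mult_single)

lemma Kpow_one_eq: "Kpow 1 = (1 :: 'a::field ratfun laurent) + laurent_const (qvar - 1) * K_quotient"
proof -
  have "laurent_const (qvar - 1) * laurent_const (inverse (qvar - 1)) = (1 :: 'a ratfun laurent)"
    unfolding laurent_const_mult[symmetric] by (simp add: laurent_const_one)
  then have "laurent_const (qvar - 1) * K_quotient = Kpow 1 - (1 :: 'a ratfun laurent)"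
    by (simp only: K_quotient_def mult.assoc[symmetric] mult_1)
  then show ?thesis by simp
qed


section \<open>The classical limit of the base algebra\<close>

text \<open>\<open>reduces \<gamma> l h g\<close> says that \<open>h\<close> lies in the \<open>R\<close>-form \<open>R[K, K^-1, (K - 1)/(q - 1)]\<close> and that
  its class modulo \<open>q - 1\<close> corresponds to the polynomial \<open>g\<close> in the variable
  \<open>(- \<gamma> / l) (K - 1)/(q - 1)\<close>.  It is the graph of the specialisation map; functionality is
  not part of the definition and holds by \<open>reduces_unique\<close> below.\<close>

inductive reduces :: "'a::field \<Rightarrow> int \<Rightarrow> 'a ratfun laurent \<Rightarrow> 'a poly \<Rightarrow> bool" for \<gamma> l where
  const: "has_value r c \<Longrightarrow> reduces \<gamma> l (laurent_const r) [:c:]"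
| K: "reduces \<gamma> l (Kpow 1) 1"
| K_inverse: "reduces \<gamma> l (Kpow (- 1)) 1"
| K_quotient: "reduces \<gamma> l K_quotient [:0, - of_int l / \<gamma>:]"
| add: "reduces \<gamma> l h g \<Longrightarrow> reduces \<gamma> l h' g' \<Longrightarrow> reduces \<gamma> l (h + h') (g + g')"
| mult: "reduces \<gamma> l h g \<Longrightarrow> reduces \<gamma> l h' g' \<Longrightarrow> reduces \<gamma> l (h * h') (g * g')"

lemma reduces_zero: "reduces \<gamma> l 0 0"
  using reduces.const[OF has_value_zero] by (simp add: laurent_const_zero)

lemma reduces_one: "reduces \<gamma> l 1 1"
  using reduces.const[OF has_value_one] by (simp add: laurent_const_one one_pCons)

lemma reduces_uminus: "reduces \<gamma> l h g \<Longrightarrow> reduces \<gamma> l (- h) (- g)"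
  using reduces.mult[OF reduces.const[OF has_value_uminus[OF has_value_one]], of \<gamma> l h g]
  by (simp add: laurent_const_uminus laurent_const_one)

text \<open>The substitution of \<^const>\<open>h_lift\<close> for the variable \<open>h\<close> of \<open>F[h]\<close>.\<close>

definition lift_poly :: "'a::field \<Rightarrow> int \<Rightarrow> 'a poly \<Rightarrow> 'a ratfun laurent" where
  "lift_poly \<gamma> l g = poly (map_poly (\<lambda>c. laurent_const (ratfun_const c)) g) (h_lift \<gamma> l)"

lemma lift_poly_pCons:
  "lift_poly \<gamma> l (pCons c g) = laurent_const (ratfun_const c) + h_lift \<gamma> l * lift_poly \<gamma> l g"
  by (cases "c = 0 \<and> g = 0")
    (auto simp: lift_poly_def map_poly_pCons ratfun_const_zero laurent_const_zero)

lemma lift_poly_zero: "lift_poly \<gamma> l 0 = 0"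
  by (simp add: lift_poly_def)

lemma lift_poly_const: "lift_poly \<gamma> l [:c:] = laurent_const (ratfun_const c)"
  by (simp add: lift_poly_pCons lift_poly_zero)

lemma lift_poly_one: "lift_poly \<gamma> l 1 = 1"
  by (simp add: one_pCons lift_poly_const ratfun_const_one laurent_const_one)

lemma lift_poly_add: "lift_poly \<gamma> l (g + g') = lift_poly \<gamma> l g + lift_poly \<gamma> l g'"
  by (induction g g' rule: poly_induct2)
    (simp_all add: lift_poly_zero lift_poly_pCons ratfun_const_add laurent_const_add algebra_simps)

lemma lift_poly_smult:
  "lift_poly \<gamma> l (Polynomial.smult c g) = laurent_const (ratfun_const c) * lift_poly \<gamma> l g"
  by (induction g)
    (simp_all add: lift_poly_zero lift_poly_pCons ratfun_const_mult laurent_const_mult algebra_simps)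

lemma lift_poly_mult: "lift_poly \<gamma> l (g * g') = lift_poly \<gamma> l g * lift_poly \<gamma> l g'"
proof (induction g)
  case (pCons c g)
  then show ?case
    by (simp add: lift_poly_add lift_poly_smult lift_poly_pCons ratfun_const_zero
        laurent_const_zero algebra_simps)
qed (simp add: lift_poly_zero)

text \<open>The parameters of the limit; their being nonzero makes \<open>- \<gamma> / l\<close> invertible.\<close>

locale limit_parameters =
  fixes \<gamma> :: "'a::field_char_0" and l :: int
  assumes gamma_nonzero: "\<gamma> \<noteq> 0" and l_nonzero: "l \<noteq> 0"
begin

lemma reduces_h_lift: "reduces \<gamma> l (h_lift \<gamma> l) [:0, 1:]"
  using reduces.mult[OF reduces.const[OF has_value_const[of "- \<gamma> / of_int l"]] reduces.K_quotient,
      of \<gamma> l]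
    gamma_nonzero l_nonzero
  by (simp add: h_lift_def)

lemma reduces_lift_poly: "reduces \<gamma> l (lift_poly \<gamma> l g) g"
proof (induction g)
  case (pCons c g)
  have "reduces \<gamma> l (laurent_const (ratfun_const c) + h_lift \<gamma> l * lift_poly \<gamma> l g) ([:c:] + [:0, 1:] * g)"
    by (intro reduces.add reduces.mult reduces_h_lift pCons reduces.const has_value_const)
  then show ?case by (simp add: lift_poly_pCons)
qed (simp add: lift_poly_zero reduces_zero)

lemma K_quotient_eq: "K_quotient = lift_poly \<gamma> l [:0, - of_int l / \<gamma>:]"
proof -
  have "ratfun_const (- of_int l / \<gamma>) * ratfun_const (- \<gamma> / of_int l) = 1"
    using gamma_nonzero l_nonzero by (simp add: ratfun_const_one flip: ratfun_const_mult)
  then have "laurent_const (ratfun_const (- of_int l / \<gamma>)) * laurent_const (ratfun_const (- \<gamma> / of_int l)) = 1"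
    by (metis laurent_const_mult laurent_const_one)
  then show ?thesis
    by (simp add: lift_poly_pCons lift_poly_zero h_lift_def ratfun_const_zero laurent_const_zero
        algebra_simps flip: mult.assoc)
qed

text \<open>Modulo \<open>q - 1\<close>, the \<open>R\<close>-form of the base consists of the polynomials in the lift of \<open>h\<close>.\<close>

lemma reduces_decompose:
  assumes "reduces \<gamma> l h g"
  shows "\<exists>h' g'. reduces \<gamma> l h' g' \<and> h = lift_poly \<gamma> l g + laurent_const (qvar - 1) * h'"
  using assms
proof induction
  case (const r c)
  have "has_value (r - ratfun_const c) 0"
    using has_value_diff[OF const has_value_const[of c]] by simp
  then obtain y d where y: "has_value y d" "r - ratfun_const c = (qvar - 1) * y"
    by (rule has_value_zeroE)
  then have "r = ratfun_const c + (qvar - 1) * y" by (simp add: algebra_simps)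
  then have "laurent_const r = lift_poly \<gamma> l [:c:] + laurent_const (qvar - 1) * laurent_const y"
    by (simp only: lift_poly_const laurent_const_add laurent_const_mult)
  then show ?case using reduces.const[OF y(1)] by blast
next
  case K
  then show ?case using Kpow_one_eq reduces.K_quotient by (auto simp: lift_poly_one)
next
  case K_inverse
  have "Kpow 1 * Kpow (- 1) = (1 :: 'a ratfun laurent)" using Kpow_add[of 1 "- 1"] by (simp add: Kpow_zero)
  then have "(1 + laurent_const (qvar - 1) * K_quotient) * Kpow (- 1) = (1 :: 'a ratfun laurent)"
    by (simp only: Kpow_one_eq)
  then have "Kpow (- 1) = 1 + laurent_const (qvar - 1) * (- (K_quotient * Kpow (- 1) :: 'a ratfun laurent))"
    by (simp add: algebra_simps eq_diff_eq)
  then show ?case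
    unfolding lift_poly_one
    using reduces_uminus[OF reduces.mult[OF reduces.K_quotient reduces.K_inverse]] by blast
next
  case K_quotient
  show ?case using K_quotient_eq reduces_zero by (metis add.right_neutral mult_zero_right)
next
  case (add h g h' g')
  then obtain a b a' b' where *: "reduces \<gamma> l a b" "h = lift_poly \<gamma> l g + laurent_const (qvar - 1) * a"
    "reduces \<gamma> l a' b'" "h' = lift_poly \<gamma> l g' + laurent_const (qvar - 1) * a'" by blast
  then have "h + h' = lift_poly \<gamma> l (g + g') + laurent_const (qvar - 1) * (a + a')"
    by (simp add: lift_poly_add algebra_simps)
  then show ?case using reduces.add[OF *(1,3)] by blast
next
  case (mult h g h' g')
  then obtain a b a' b' where *: "reduces \<gamma> l a b" "h = lift_poly \<gamma> l g + laurent_const (qvar - 1) * a"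
    "reduces \<gamma> l a' b'" "h' = lift_poly \<gamma> l g' + laurent_const (qvar - 1) * a'" by blast
  then have "h * h' = lift_poly \<gamma> l (g * g') + laurent_const (qvar - 1) * (a * h' + lift_poly \<gamma> l g * a')"
    by (simp add: lift_poly_mult algebra_simps)
  moreover have "reduces \<gamma> l (a * h' + lift_poly \<gamma> l g * a') (b * g' + g * b')"
    by (intro reduces.add reduces.mult * mult.hyps reduces_lift_poly)
  ultimately show ?case by blast
qed

text \<open>Evaluation at \<open>K = \<kappa>\<close> followed by \<open>q = 1\<close> factors through the reduction.  For varying \<open>\<kappa>\<close> this
  makes the reduction well defined, and for the given weight it identifies the limit weight.\<close>

lemma reduces_eval:
  assumes "reduces \<gamma> l h g" and "\<kappa> \<noteq> 0" and "has_value ((\<kappa> - 1) / (qvar - 1)) \<rho>"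
  shows "has_value (laurent_eval \<kappa> h) (poly g (- \<gamma> / of_int l * \<rho>))"
proof -
  have "\<kappa> = 1 + (qvar - 1) * ((\<kappa> - 1) / (qvar - 1))" by simp
  moreover have "has_value (1 + (qvar - 1) * ((\<kappa> - 1) / (qvar - 1))) (1 + (1 - 1) * \<rho>)"
    by (intro has_value_add has_value_mult has_value_diff has_value_one has_value_qvar assms)
  ultimately have kappa: "has_value \<kappa> 1" by simp
  from assms(1) show ?thesis
  proof induction
    case K_quotient
    then show ?case
      using assms gamma_nonzero l_nonzero by (simp add: laurent_eval_K_quotient)
  qed (use has_value_inverse[OF kappa] in \<open>simp_all add: laurent_eval_const laurent_eval_Kpow kappa
      laurent_eval_add laurent_eval_mult[OF assms(2)] has_value_add has_value_mult
      power_int_minus\<close>)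
qed

lemma reduces_unique:
  assumes "reduces \<gamma> l h g" "reduces \<gamma> l h g'"
  shows "g = g'"
proof -
  have "poly g x = poly g' x" for x
  proof -
    \<comment> \<open>evaluate at \<open>K = 1 + (q - 1) c\<close>\<close>
    define c where "c = - of_int l / \<gamma> * x"
    define \<kappa> where "\<kappa> = 1 + (qvar - 1) * ratfun_const c"
    have "has_value \<kappa> (1 + (1 - 1) * c)"
      unfolding \<kappa>_def
      by (intro has_value_add has_value_mult has_value_diff has_value_one has_value_qvar has_value_const)
    then have "\<kappa> \<noteq> 0" using has_value_nonzero by force
    moreover have "has_value ((\<kappa> - 1) / (qvar - 1)) c"
      using has_value_const[of c] by (simp add: \<kappa>_def)
    ultimately have "poly g (- \<gamma> / of_int l * c) = poly g' (- \<gamma> / of_int l * c)"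
      using reduces_eval assms has_value_unique by blast
    then show ?thesis using gamma_nonzero l_nonzero by (simp add: c_def)
  qed
  then show ?thesis using poly_eq_poly_eq_iff by blast
qed

lemma reduces_zero_right:
  assumes "reduces \<gamma> l h 0"
  obtains h' g' where "reduces \<gamma> l h' g'" "h = laurent_const (qvar - 1) * h'"
  using reduces_decompose[OF assms] by (auto simp: lift_poly_zero)

text \<open>The substitution \<open>K \<mapsto> q^-l K\<close> reduces to \<open>h \<mapsto> h + \<gamma>\<close>, because \<open>(q^-l - 1)/(q - 1)\<close> has value
  \<open>- l\<close> at \<open>q = 1\<close>.\<close>

lemma reduces_rescale:
  assumes "reduces \<gamma> l h g"
  shows "reduces \<gamma> l (laurent_rescale (qvar powi (- l)) h) (pcompose g [:\<gamma>, 1:])"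
proof -
  let ?c = "(qvar :: 'a ratfun) powi (- l)"
  have q0: "(qvar :: 'a ratfun) \<noteq> 0" using has_value_nonzero[OF has_value_qvar] by simp
  have c0: "?c \<noteq> 0" using q0 by simp
  have c1: "has_value ?c 1" by (rule has_value_power_int[OF has_value_qvar])
  from assms show ?thesis
  proof induction
    case (const r c)
    then show ?case by (simp add: laurent_rescale_const reduces.const)
  next
    case K
    then show ?case
      using reduces.mult[OF reduces.const[OF c1] reduces.K]
      by (simp add: laurent_rescale_Kpow pcompose_1 pCons_one)
  next
    case K_inverse
    have "has_value (inverse ?c) 1" using has_value_inverse[OF c1] by simp
    then show ?case
      using reduces.mult[OF reduces.const[OF \<open>has_value (inverse ?c) 1\<close>] reduces.K_inverse]
      by (simp add: laurent_rescale_Kpow power_int_minus pcompose_1 pCons_one)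
  next
    case K_quotient
    have "laurent_rescale ?c (Kpow 1 + - 1) = laurent_const ?c * Kpow 1 + - 1"
      using laurent_rescale_const[of ?c "- 1"]
      by (simp only: laurent_rescale_add laurent_rescale_Kpow laurent_const_uminus laurent_const_one
          power_int_1_right)
    then have "laurent_rescale ?c K_quotient
        = laurent_const (inverse (qvar - 1)) * (laurent_const ?c * Kpow 1 - 1)"
      by (simp add: K_quotient_def laurent_rescale_mult[OF c0] laurent_rescale_const)
    also have "\<dots> = laurent_const ?c * K_quotient + laurent_const ((?c - 1) / (qvar - 1))"
      by (simp add: K_quotient_def divide_inverse laurent_const_mult laurent_const_diff
          laurent_const_one algebra_simps)
    finally have "laurent_rescale ?c K_quotient
      = laurent_const ?c * K_quotient + laurent_const ((?c - 1) / (qvar - 1))" .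
    moreover have "reduces \<gamma> l (laurent_const ?c * K_quotient + laurent_const ((?c - 1) / (qvar - 1)))
       ([:1:] * [:0, - of_int l / \<gamma>:] + [:of_int (- l):])"
      by (intro reduces.add reduces.mult reduces.const reduces.K_quotient c1 has_value_q_number)
    ultimately show ?case using gamma_nonzero by (simp add: pcompose_pCons)
  next
    case (add h g h' g')
    then show ?case by (simp add: laurent_rescale_add pcompose_add reduces.add)
  next
    case (mult h g h' g')
    then show ?case by (simp add: laurent_rescale_mult[OF c0] pcompose_mult reduces.mult)
  qed
qed

lemma reduces_Kpow: "reduces \<gamma> l (Kpow n) 1"
proof -
  have pos: "reduces \<gamma> l (Kpow (int k)) 1" for k
  proof (induction k)
    case (Suc k)
    then show ?case using reduces.mult[OF reduces.K Suc] by (simp add: Kpow_add)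
  qed (simp add: Kpow_zero reduces_one)
  have neg: "reduces \<gamma> l (Kpow (- int k)) 1" for k
  proof (induction k)
    case (Suc k)
    have "- int (Suc k) = - 1 + - int k" by simp
    then show ?case using reduces.mult[OF reduces.K_inverse Suc] by (simp only: Kpow_add) simp
  qed (simp add: Kpow_zero reduces_one)
  show ?thesis using pos[of "nat n"] neg[of "nat (- n)"] by (cases "n \<ge> 0") simp_all
qed

lemma reduces_z_zero:
  "reduces \<gamma> l (z_zero (Wq_data \<gamma> s f l m n)) (z_zero (Wclassical_data \<gamma> s f))"
proof -
  have "reduces \<gamma> l (z_zero (Wq_data \<gamma> s f l m n)) ([:inverse s:] * [:1:] * 1 * f)"
    unfolding Wq_data_def tgwa_data.simps lift_poly_def[symmetric]
    by (intro reduces.mult reduces.const has_value_const has_value_power_int has_value_qvar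
        reduces_Kpow reduces_lift_poly)
  then show ?thesis by (simp add: Wclassical_data_def)
qed

lemma reduces_z_one:
  "reduces \<gamma> l (z_one (Wq_data \<gamma> s f l m n)) (z_one (Wclassical_data \<gamma> s f))"
  by (simp add: Wq_data_def Wclassical_data_def reduces.const has_value_const)

end

lemma tgwa_basis_Wq: "tgwa_basis (Wq_data \<gamma> s f l m n)"
proof
  have "(qvar :: 'a ratfun) powi (- l) \<noteq> 0" for l
    using has_value_nonzero[OF has_value_power_int[OF has_value_qvar]] by simp
  then show "endo (Wq_data \<gamma> s f l m n) (g * h) = endo (Wq_data \<gamma> s f l m n) g * endo (Wq_data \<gamma> s f l m n) h" for g h
    by (simp add: Wq_data_def laurent_rescale_mult)
  show "endo (Wq_data \<gamma> s f l m n) 1 = 1"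
    using laurent_rescale_const[of _ 1] by (simp add: Wq_data_def laurent_const_one)
qed (simp_all add: Wq_data_def laurent_rescale_add laurent_rescale_const laurent_const_add
    laurent_const_mult laurent_const_one)

lemma tgwa_basis_Wclassical: "tgwa_basis (Wclassical_data \<gamma> s f)"
  by standard (simp_all add: Wclassical_data_def pcompose_add pcompose_mult pcompose_1
      flip: one_pCons)


section \<open>The classical limit of the algebra\<close>

lemma (in tgwa_basis) pbw_monomial_scalar:
  "tgwa_eq A (pbw_monomial i j (scalar_map A c * h)) (free_scalar c * pbw_monomial i j h)"
proof -
  have "tgwa_eq A (pbw_monomial i j (scalar_map A c * h))
      (free_gen Down ^ i * (free_gen (Base (scalar_map A c)) * free_gen (Base h)) * free_gen Up ^ j)"
    unfolding pbw_monomial_def by (intro tgwa_eq_mult tgwa_eq_base_mult) simp_all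
  also have "tgwa_eq A \<dots> (free_gen Down ^ i * (free_scalar c * free_gen (Base h)) * free_gen Up ^ j)"
    by (intro tgwa_eq_mult tgwa_eq_base_scalar) simp_all
  also have "\<dots> = (free_gen Down ^ i * free_scalar c) * free_gen (Base h) * free_gen Up ^ j"
    by (simp add: mult.assoc)
  also have "\<dots> = free_scalar c * pbw_monomial i j h"
    by (simp add: pbw_monomial_def mult.assoc flip: free_scalar_commute[of c "free_gen Down ^ i"])
  finally show ?thesis .
qed

locale classical_limit = limit_parameters \<gamma> l for \<gamma> :: "'a::field_char_0" and l :: int +
  fixes s :: 'a and f :: "'a poly" and m n :: int
begin

abbreviation "Wq \<equiv> Wq_data \<gamma> s f l m n"
abbreviation "Wc \<equiv> Wclassical_data \<gamma> s f"

sublocale Q: tgwa_basis Wq by (rule tgwa_basis_Wq)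
sublocale C: tgwa_basis Wc by (rule tgwa_basis_Wclassical)

lemma scalar_map_Wq: "scalar_map Wq = laurent_const"
  by (simp add: Wq_data_def)

lemma scalar_map_Wc: "scalar_map Wc c = [:c:]"
  by (simp add: Wclassical_data_def)

lemma reduces_endo: "reduces \<gamma> l h g \<Longrightarrow> reduces \<gamma> l (endo Wq h) (endo Wc g)"
  by (simp add: Wq_data_def Wclassical_data_def reduces_rescale)

lemma reduces_endo_pow: "reduces \<gamma> l h g \<Longrightarrow> reduces \<gamma> l ((endo Wq ^^ i) h) ((endo Wc ^^ i) g)"
  by (induction i) (simp_all add: reduces_endo)

lemma reduces_lower_coeff: "reduces \<gamma> l (Q.lower_coeff i) (C.lower_coeff i)"
  by (induction i)
    (auto intro!: reduces.add reduces.mult reduces_endo_pow reduces_z_zero reduces_z_one reduces_zero)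

lemma reduces_raise_coeff: "reduces \<gamma> l (Q.raise_coeff i) (C.raise_coeff i)"
  by (induction i) (auto intro!: reduces.mult reduces_endo_pow reduces_z_one reduces_one)

text \<open>Reduction of families, coefficient by coefficient.\<close>

definition reduces_family ::
    "(nat \<Rightarrow> nat \<Rightarrow> 'a ratfun laurent) \<Rightarrow> (nat \<Rightarrow> nat \<Rightarrow> 'a poly) \<Rightarrow> bool" where
  "reduces_family p p' \<longleftrightarrow> (\<forall>i j. reduces \<gamma> l (p i j) (p' i j))"

text \<open>\<open>limit_rel x y\<close> says that \<open>x\<close> preserves the \<open>R\<close>-lattice in the regular representation and
  induces the action of \<open>y\<close> on its reduction modulo \<open>q - 1\<close>.  On classes, this is the graph of the
  surjection from the \<open>R\<close>-form onto the classical algebra.\<close>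

definition limit_rel ::
    "('a ratfun, 'a ratfun laurent tgwa_letter) free_alg \<Rightarrow> ('a, 'a poly tgwa_letter) free_alg \<Rightarrow> bool"
  where "limit_rel x y \<longleftrightarrow>
    (\<forall>p p'. reduces_family p p' \<longrightarrow> reduces_family (Q.free_act x p) (C.free_act y p'))"

lemma limit_rel_add: "limit_rel x y \<Longrightarrow> limit_rel x' y' \<Longrightarrow> limit_rel (x + x') (y + y')"
  unfolding limit_rel_def reduces_family_def
  by (simp add: Q.free_act_add_left C.free_act_add_left reduces.add)

lemma limit_rel_mult: "limit_rel x y \<Longrightarrow> limit_rel x' y' \<Longrightarrow> limit_rel (x * x') (y * y')"
  unfolding limit_rel_def by (simp add: Q.free_act_mult C.free_act_mult)

lemma limit_rel_scalar: "has_value r c \<Longrightarrow> limit_rel (free_scalar r) (free_scalar c)"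
  unfolding limit_rel_def reduces_family_def Q.free_act_scalar C.free_act_scalar Q.scale_def C.scale_def
    scalar_map_Wq scalar_map_Wc
  by (blast intro: reduces.mult reduces.const)

lemma limit_rel_one: "limit_rel 1 1"
  using limit_rel_scalar[OF has_value_one] by (simp add: free_scalar_one)

lemma limit_rel_zero: "limit_rel 0 0"
  using limit_rel_scalar[OF has_value_zero] by (simp add: free_scalar_zero)

lemma limit_rel_uminus: "limit_rel x y \<Longrightarrow> limit_rel (- x) (- y)"
  using limit_rel_mult[OF limit_rel_scalar[OF has_value_uminus[OF has_value_one]], of x y]
  by (simp add: free_scalar_uminus free_scalar_one)

lemma limit_rel_diff: "limit_rel x y \<Longrightarrow> limit_rel x' y' \<Longrightarrow> limit_rel (x - x') (y - y')"
  using limit_rel_add[of x y "- x'" "- y'"] limit_rel_uminus by fastforce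

lemma limit_rel_base: "reduces \<gamma> l h g \<Longrightarrow> limit_rel (free_gen (Base h)) (free_gen (Base g))"
  unfolding limit_rel_def reduces_family_def Q.free_act_gen C.free_act_gen
  by (simp add: reduces.mult reduces_endo_pow)

lemma limit_rel_down: "limit_rel (free_gen Down) (free_gen Down)"
  unfolding limit_rel_def reduces_family_def Q.free_act_gen C.free_act_gen
  by (simp add: reduces_zero split: nat.splits)

lemma limit_rel_up: "limit_rel (free_gen Up) (free_gen Up)"
proof -
  have "reduces \<gamma> l (Q.letter_act Up p i j) (C.letter_act Up p' i j)"
    if p: "\<And>i j. reduces \<gamma> l (p i j) (p' i j)" for p p' i j
  proof -
    have "reduces \<gamma> l (Q.lower_coeff (Suc i) * p (Suc i) j) (C.lower_coeff (Suc i) * p' (Suc i) j)"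
      by (intro reduces.mult reduces_lower_coeff p)
    moreover have "reduces \<gamma> l (case j of 0 \<Rightarrow> 0 | Suc k \<Rightarrow> Q.raise_coeff i * endo Wq (p i k))
        (case j of 0 \<Rightarrow> 0 | Suc k \<Rightarrow> C.raise_coeff i * endo Wc (p' i k))"
      by (cases j) (auto intro!: reduces.mult reduces_raise_coeff reduces_endo reduces_zero p)
    ultimately show ?thesis
      unfolding Q.letter_act.simps C.letter_act.simps by (rule reduces.add)
  qed
  then show ?thesis
    unfolding limit_rel_def reduces_family_def Q.free_act_gen C.free_act_gen by blast
qed

lemma limit_rel_power: "limit_rel x y \<Longrightarrow> limit_rel (x ^ k) (y ^ k)"
  by (induction k) (simp_all add: limit_rel_one limit_rel_mult)

lemma limit_rel_sum:
  "(\<And>k. k \<in> S \<Longrightarrow> limit_rel (x k) (y k)) \<Longrightarrow> limit_rel (sum x S) (sum y S)"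
  by (induction S rule: infinite_finite_induct) (auto simp: limit_rel_zero limit_rel_add)

lemma limit_rel_pbw_monomial:
  "reduces \<gamma> l h g \<Longrightarrow> limit_rel (Q.pbw_monomial i j h) (C.pbw_monomial i j g)"
  unfolding Q.pbw_monomial_def C.pbw_monomial_def
  by (intro limit_rel_mult limit_rel_power limit_rel_down limit_rel_up limit_rel_base)

lemma limit_rel_pbw_coeffs: "limit_rel x y \<Longrightarrow> reduces \<gamma> l (Q.pbw_coeffs x i j) (C.pbw_coeffs y i j)"
proof -
  assume "limit_rel x y"
  moreover have "reduces_family Q.vacuum C.vacuum"
    by (simp add: reduces_family_def Q.vacuum_def C.vacuum_def reduces_one reduces_zero)
  ultimately show ?thesis
    unfolding limit_rel_def reduces_family_def Q.pbw_coeffs_def C.pbw_coeffs_def by blast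
qed

text \<open>On classes the relation is a function: if \<open>x - x'\<close> vanishes, its coefficients reduce to those of
  \<open>y - y'\<close>, and zero reduces only to zero.\<close>

lemma limit_rel_functional:
  assumes "limit_rel x y" "limit_rel x' y'" "tgwa_eq Wq x x'"
  shows "tgwa_eq Wc y y'"
proof -
  have "Q.pbw_coeffs (x - x') = 0"
    using Q.free_act_ideal assms(3) by (simp add: tgwa_eq_def Q.pbw_coeffs_def)
  then have "reduces \<gamma> l 0 (C.pbw_coeffs (y - y') i j)" for i j
    using limit_rel_pbw_coeffs[OF limit_rel_diff[OF assms(1,2)], of i j] by simp
  then have "C.pbw_coeffs (y - y') = 0"
    using reduces_unique reduces_zero by (intro ext) (simp, blast)
  then show ?thesis using C.pbw_coeffs_eq_zero by (simp add: tgwa_eq_def)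
qed

lemma limit_rel_surjective: "\<exists>x. limit_rel x y"
proof (induction y rule: free_alg_induct)
  case (scalar c)
  then show ?case using limit_rel_scalar[OF has_value_const] by blast
next
  case (gen a)
  then show ?case
    by (cases a) (use limit_rel_base[OF reduces_lift_poly] limit_rel_down limit_rel_up in blast)+
next
  case (add x y)
  then show ?case using limit_rel_add by blast
next
  case (mult x y)
  then show ?case using limit_rel_mult by blast
qed

text \<open>If \<open>y\<close> vanishes, then all coefficients of \<open>x\<close> are divisible by \<open>q - 1\<close> within the \<open>R\<close>-form of
  the base.\<close>

lemma limit_rel_kernel:
  assumes "limit_rel x y" "y \<in> tgwa_ideal Wc"
  obtains x' y' where "limit_rel x' y'" "tgwa_eq Wq x (free_scalar (qvar - 1) * x')"
proof -
  have "C.pbw_coeffs y = 0" using C.free_act_ideal[OF assms(2)] by (simp add: C.pbw_coeffs_def)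
  then have "reduces \<gamma> l (Q.pbw_coeffs x i j) 0" for i j
    using limit_rel_pbw_coeffs[OF assms(1), of i j] by simp
  then have "\<exists>h' g'. reduces \<gamma> l h' g' \<and> Q.pbw_coeffs x i j = laurent_const (qvar - 1) * h'" for i j
    by (metis reduces_zero_right)
  then obtain h g where hg: "\<And>i j. reduces \<gamma> l (h i j) (g i j)"
      "\<And>i j. Q.pbw_coeffs x i j = laurent_const (qvar - 1) * h i j"
    by metis
  obtain S where S: "tgwa_eq Wq x (\<Sum>(i, j)\<in>S. Q.pbw_monomial i j (Q.pbw_coeffs x i j))"
    by (rule Q.pbw_coeffs_expansion)
  note S
  also have "tgwa_eq Wq (\<Sum>(i, j)\<in>S. Q.pbw_monomial i j (Q.pbw_coeffs x i j))
      (\<Sum>(i, j)\<in>S. free_scalar (qvar - 1) * Q.pbw_monomial i j (h i j))"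
    using Q.pbw_monomial_scalar[of _ _ "qvar - 1"]
    unfolding scalar_map_Wq by (intro tgwa_eq_sum) (auto simp only: hg(2) split_def)
  also have "\<dots> = free_scalar (qvar - 1) * (\<Sum>(i, j)\<in>S. Q.pbw_monomial i j (h i j))"
    by (simp add: sum_distrib_left split_def)
  finally have "tgwa_eq Wq x (free_scalar (qvar - 1) * (\<Sum>(i, j)\<in>S. Q.pbw_monomial i j (h i j)))" .
  moreover have "limit_rel (\<Sum>(i, j)\<in>S. Q.pbw_monomial i j (h i j)) (\<Sum>(i, j)\<in>S. C.pbw_monomial i j (g i j))"
    by (rule limit_rel_sum) (auto intro: limit_rel_pbw_monomial hg)
  ultimately show ?thesis using that by blast
qed


subsection \<open>The \<open>R\<close>-form\<close>

abbreviation "R_generators \<equiv> tgwa_scalar Wq ` regular_at_one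
  \<union> {tgwa_u Wq, tgwa_d Wq, tgwa_base Wq (Kpow 1), tgwa_base Wq (Kpow (- 1)), tgwa_base Wq K_quotient}"

lemma R_generators_subset: "R_generators \<subseteq> carrier (tgwa Wq)"
  by (auto simp: tgwa_scalar_def tgwa_u_def tgwa_d_def tgwa_base_def)

lemma R_form_carrier_def: "carrier (R_form Wq) = generate_ring (tgwa Wq) R_generators"
  by (simp add: R_form_def)

lemma R_form_simps [simp]:
  "mult (R_form Wq) = mult (tgwa Wq)" "add (R_form Wq) = add (tgwa Wq)"
  "one (R_form Wq) = one (tgwa Wq)" "zero (R_form Wq) = zero (tgwa Wq)"
  by (simp_all add: R_form_def)

lemma R_form_ring: "ring (R_form Wq)"
  unfolding R_form_def by (rule ring.generate_ring_is_ring[OF tgwa_ring R_generators_subset])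

lemma R_form_subset: "carrier (R_form Wq) \<subseteq> carrier (tgwa Wq)"
  unfolding R_form_carrier_def by (rule ring.generate_ring_incl[OF tgwa_ring R_generators_subset])

lemma R_form_base:
  assumes "reduces \<gamma> l h g"
  shows "tgwa_class Wq (free_gen (Base h)) \<in> carrier (R_form Wq)"
  using assms
proof induction
  case (const r c)
  have "tgwa_class Wq (free_gen (Base (laurent_const r))) = tgwa_scalar Wq r"
    using tgwa_eq_base_scalar[of Wq r] by (simp add: tgwa_scalar_def tgwa_class_eq_iff scalar_map_Wq)
  moreover have "tgwa_scalar Wq r \<in> R_generators"
    using const regular_at_one_iff by blast
  ultimately show ?case by (simp only: R_form_carrier_def generate_ring.incl)
next
  case (add h g h' g')
  have "tgwa_class Wq (free_gen (Base (h + h')))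
      = tgwa_class Wq (free_gen (Base h)) \<oplus>\<^bsub>tgwa Wq\<^esub> tgwa_class Wq (free_gen (Base h'))"
    unfolding tgwa_class_add tgwa_class_eq_iff by (rule tgwa_eq_base_add)
  then show ?case using add by (simp add: R_form_carrier_def generate_ring.eng_add)
next
  case (mult h g h' g')
  have "tgwa_class Wq (free_gen (Base (h * h')))
      = tgwa_class Wq (free_gen (Base h)) \<otimes>\<^bsub>tgwa Wq\<^esub> tgwa_class Wq (free_gen (Base h'))"
    unfolding tgwa_class_mult tgwa_class_eq_iff by (rule tgwa_eq_base_mult)
  then show ?case using mult by (simp add: R_form_carrier_def generate_ring.eng_mult)
qed (auto simp: R_form_carrier_def tgwa_base_def intro!: generate_ring.incl)

lemma R_form_class_mult:
  "tgwa_class Wq x \<in> carrier (R_form Wq) \<Longrightarrow> tgwa_class Wq y \<in> carrier (R_form Wq)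
    \<Longrightarrow> tgwa_class Wq (x * y) \<in> carrier (R_form Wq)"
  by (simp add: R_form_carrier_def generate_ring.eng_mult flip: tgwa_class_mult)

lemma R_form_class_add:
  "tgwa_class Wq x \<in> carrier (R_form Wq) \<Longrightarrow> tgwa_class Wq y \<in> carrier (R_form Wq)
    \<Longrightarrow> tgwa_class Wq (x + y) \<in> carrier (R_form Wq)"
  by (simp add: R_form_carrier_def generate_ring.eng_add flip: tgwa_class_add)

lemma R_form_class_one: "tgwa_class Wq 1 \<in> carrier (R_form Wq)"
  by (simp add: R_form_carrier_def generate_ring.one flip: tgwa_class_one)

lemma R_form_class_zero: "tgwa_class Wq 0 \<in> carrier (R_form Wq)"
  using ring.ring_simprules(2)[OF R_form_ring] by (simp add: tgwa_class_zero)

lemma R_form_class_power: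
  "tgwa_class Wq x \<in> carrier (R_form Wq) \<Longrightarrow> tgwa_class Wq (x ^ k) \<in> carrier (R_form Wq)"
  by (induction k) (simp_all add: R_form_class_one R_form_class_mult)

lemma R_form_class_sum:
  "(\<And>k. k \<in> S \<Longrightarrow> tgwa_class Wq (x k) \<in> carrier (R_form Wq))
    \<Longrightarrow> tgwa_class Wq (sum x S) \<in> carrier (R_form Wq)"
  by (induction S rule: infinite_finite_induct) (auto simp: R_form_class_zero R_form_class_add)

text \<open>The \<open>R\<close>-form, defined by generators, consists of the classes of all elements with a reduction;
  for the converse inclusion such an element is expanded in the basis.\<close>

lemma R_form_carrier: "carrier (R_form Wq) = tgwa_class Wq ` {x. \<exists>y. limit_rel x y}"
proof (intro equalityI subsetI)
  fix X assume "X \<in> carrier (R_form Wq)"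
  then have "X \<in> generate_ring (tgwa Wq) R_generators" by (simp add: R_form_carrier_def)
  then have "\<exists>x y. X = tgwa_class Wq x \<and> limit_rel x y"
  proof induction
    case one
    then show ?case using limit_rel_one by (auto simp: tgwa_class_one)
  next
    case (incl X)
    then show ?case
      using limit_rel_scalar limit_rel_up limit_rel_down limit_rel_base[OF reduces.K]
        limit_rel_base[OF reduces.K_inverse] limit_rel_base[OF reduces.K_quotient]
      by (auto simp: tgwa_scalar_def tgwa_u_def tgwa_d_def tgwa_base_def regular_at_one_iff) blast+
  next
    case (a_inv X)
    then show ?case using limit_rel_uminus by (auto simp: tgwa_class_uminus) blast
  next
    case (eng_add X Y)
    then show ?case using limit_rel_add by (auto simp: tgwa_class_add) blast
  next
    case (eng_mult X Y)
    then show ?case using limit_rel_mult by (auto simp: tgwa_class_mult) blast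
  qed
  then show "X \<in> tgwa_class Wq ` {x. \<exists>y. limit_rel x y}" by blast
next
  fix X assume "X \<in> tgwa_class Wq ` {x. \<exists>y. limit_rel x y}"
  then obtain x y where x: "X = tgwa_class Wq x" "limit_rel x y" by blast
  obtain S where "tgwa_eq Wq x (\<Sum>(i, j)\<in>S. Q.pbw_monomial i j (Q.pbw_coeffs x i j))"
    by (rule Q.pbw_coeffs_expansion)
  then have "X = tgwa_class Wq (\<Sum>(i, j)\<in>S. Q.pbw_monomial i j (Q.pbw_coeffs x i j))"
    by (simp add: x tgwa_class_eq_iff)
  moreover have "tgwa_class Wq (Q.pbw_monomial i j (Q.pbw_coeffs x i j)) \<in> carrier (R_form Wq)" for i j
    unfolding Q.pbw_monomial_def
    by (intro R_form_class_mult R_form_class_power R_form_base[OF limit_rel_pbw_coeffs[OF x(2)]])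
      (auto simp: R_form_carrier_def tgwa_u_def tgwa_d_def intro!: generate_ring.incl)
  ultimately show "X \<in> carrier (R_form Wq)" by (auto intro: R_form_class_sum)
qed

lemma limit_rel_R_form: "limit_rel x y \<Longrightarrow> tgwa_class Wq x \<in> carrier (R_form Wq)"
  unfolding R_form_carrier by blast

lemma R_form_elemE:
  assumes "X \<in> carrier (R_form Wq)"
  obtains x y where "X = tgwa_class Wq x" "limit_rel x y"
  using assms unfolding R_form_carrier by blast


subsection \<open>The isomorphism\<close>

text \<open>The surjection from the \<open>R\<close>-form onto the classical algebra.  The choice of \<open>y\<close> is immaterial by
  \<open>limit_rel_functional\<close>.\<close>

definition limit_map ::
    "('a ratfun, 'a ratfun laurent) tgwa_elem \<Rightarrow> ('a, 'a poly) tgwa_elem" where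
  "limit_map X = tgwa_class Wc (SOME y. \<exists>x. X = tgwa_class Wq x \<and> limit_rel x y)"

lemma limit_map_class:
  assumes "limit_rel x y"
  shows "limit_map (tgwa_class Wq x) = tgwa_class Wc y"
proof -
  let ?P = "\<lambda>y'. \<exists>x'. tgwa_class Wq x = tgwa_class Wq x' \<and> limit_rel x' y'"
  have "?P (SOME y'. ?P y')" by (rule someI) (use assms in blast)
  then obtain x' where x': "tgwa_class Wq x = tgwa_class Wq x'" "limit_rel x' (SOME y'. ?P y')"
    by blast
  then have "tgwa_eq Wc (SOME y'. ?P y') y"
    using limit_rel_functional[OF x'(2) assms] tgwa_class_eq_iff tgwa_eq_sym by blast
  then show ?thesis by (simp add: limit_map_def tgwa_class_eq_iff)
qed

lemma limit_map_hom: "ring_hom_ring (R_form Wq) (tgwa Wc) limit_map"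
proof (rule ring_hom_ringI[OF R_form_ring tgwa_ring])
  show "limit_map X \<in> carrier (tgwa Wc)" if "X \<in> carrier (R_form Wq)" for X
    by (simp add: limit_map_def)
  fix X Y assume "X \<in> carrier (R_form Wq)" "Y \<in> carrier (R_form Wq)"
  then obtain x y x' y' where "X = tgwa_class Wq x" "limit_rel x y" "Y = tgwa_class Wq x'" "limit_rel x' y'"
    by (metis R_form_elemE)
  then show "limit_map (X \<otimes>\<^bsub>R_form Wq\<^esub> Y) = limit_map X \<otimes>\<^bsub>tgwa Wc\<^esub> limit_map Y"
    and "limit_map (X \<oplus>\<^bsub>R_form Wq\<^esub> Y) = limit_map X \<oplus>\<^bsub>tgwa Wc\<^esub> limit_map Y"
    by (simp_all add: tgwa_class_mult tgwa_class_add limit_map_class limit_rel_mult limit_rel_add)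
qed (simp add: tgwa_class_one limit_map_class limit_rel_one)

lemma limit_map_surj: "limit_map ` carrier (R_form Wq) = carrier (tgwa Wc)"
proof (intro equalityI subsetI)
  fix Y assume "Y \<in> carrier (tgwa Wc)"
  then obtain y where y: "Y = tgwa_class Wc y" by (auto simp: tgwa_carrier)
  obtain x where "limit_rel x y" using limit_rel_surjective by blast
  then show "Y \<in> limit_map ` carrier (R_form Wq)"
    using limit_map_class limit_rel_R_form y by (metis imageI)
qed (auto simp: limit_map_def)

lemma has_value_qvar_minus_one: "has_value (qvar - 1) 0"
  using has_value_diff[OF has_value_qvar has_value_one] by simp

lemma limit_map_kernel: "a_kernel (R_form Wq) (tgwa Wc) limit_map = q_minus_one_ideal Wq"
proof (intro equalityI subsetI)
  fix X assume "X \<in> a_kernel (R_form Wq) (tgwa Wc) limit_map"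
  then have X: "X \<in> carrier (R_form Wq)" "limit_map X = \<zero>\<^bsub>tgwa Wc\<^esub>"
    by (auto simp: a_kernel_def kernel_def)
  obtain x y where x: "X = tgwa_class Wq x" "limit_rel x y" using X(1) by (rule R_form_elemE)
  then have "y \<in> tgwa_ideal Wc"
    using X(2) by (simp add: limit_map_class tgwa_class_zero tgwa_class_eq_iff tgwa_eq_zero_iff)
  then obtain x' y' where x': "limit_rel x' y'" "tgwa_eq Wq x (free_scalar (qvar - 1) * x')"
    using limit_rel_kernel x(2) by blast
  then have "X = tgwa_scalar Wq (qvar - 1) \<otimes>\<^bsub>tgwa Wq\<^esub> tgwa_class Wq x'"
    by (simp add: x tgwa_scalar_def tgwa_class_mult tgwa_class_eq_iff)
  then show "X \<in> q_minus_one_ideal Wq"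
    using limit_rel_R_form[OF x'(1)] unfolding q_minus_one_ideal_def by blast
next
  fix X assume "X \<in> q_minus_one_ideal Wq"
  then obtain Y where Y: "X = tgwa_scalar Wq (qvar - 1) \<otimes>\<^bsub>tgwa Wq\<^esub> Y" "Y \<in> carrier (R_form Wq)"
    unfolding q_minus_one_ideal_def by blast
  obtain x y where x: "Y = tgwa_class Wq x" "limit_rel x y" using Y(2) by (rule R_form_elemE)
  have X: "X = tgwa_class Wq (free_scalar (qvar - 1) * x)"
    by (simp add: Y x tgwa_scalar_def tgwa_class_mult)
  have "limit_rel (free_scalar (qvar - 1) * x) 0"
    using limit_rel_mult[OF limit_rel_scalar[OF has_value_qvar_minus_one] x(2)]
    by (simp add: free_scalar_zero)
  then show "X \<in> a_kernel (R_form Wq) (tgwa Wc) limit_map"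
    unfolding X a_kernel_def kernel_def
    using limit_map_class limit_rel_R_form by (simp add: tgwa_class_zero)
qed

text \<open>The isomorphism induced on the quotient by \<open>q - 1\<close>.\<close>

definition limit_iso ::
    "('a ratfun, 'a ratfun laurent) tgwa_elem set \<Rightarrow> ('a, 'a poly) tgwa_elem" where
  "limit_iso X = the_elem (limit_map ` X)"

lemma limit_iso_ring_iso: "limit_iso \<in> ring_iso (W_one Wq) (tgwa Wc)"
  using ring_hom_ring.FactRing_iso_set[OF limit_map_hom limit_map_surj]
  by (simp add: W_one_def limit_map_kernel limit_iso_def[abs_def])

lemma limit_iso_class:
  assumes "limit_rel x y"
  shows "limit_iso (W_one_class Wq (tgwa_class Wq x)) = tgwa_class Wc y"
  using ring_hom_ring.the_elem_simp[OF limit_map_hom limit_rel_R_form[OF assms]]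
  by (simp add: limit_iso_def W_one_class_def limit_map_kernel limit_map_class[OF assms])

lemma limit_iso_classical_limit_iso: "classical_limit_iso \<gamma> s f l m n limit_iso"
  unfolding classical_limit_iso_def Let_def tgwa_scalar_def tgwa_u_def tgwa_d_def tgwa_base_def
  by (intro conjI allI limit_iso_ring_iso limit_iso_class limit_rel_scalar has_value_const
      limit_rel_up limit_rel_down limit_rel_base reduces_h_lift)

lemma limit_iso_inverse:
  assumes "limit_rel x y"
  shows "inv_into (carrier (W_one Wq)) limit_iso (tgwa_class Wc y) = W_one_class Wq (tgwa_class Wq x)"
proof -
  have "inj_on limit_iso (carrier (W_one Wq))"
    using limit_iso_ring_iso by (simp add: ring_iso_def bij_betw_def)
  moreover have "W_one_class Wq (tgwa_class Wq x) \<in> carrier (W_one Wq)"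
    using limit_rel_R_form[OF assms]
    by (auto simp: W_one_def W_one_class_def FactRing_def A_RCOSETS_def')
  ultimately show ?thesis using inv_into_f_f limit_iso_class[OF assms] by metis
qed

end


section \<open>Left modules\<close>

lemma abelian_group_of_comm_group:
  assumes "comm_group G" and "carrier M = carrier G" "add M = mult G" "\<zero>\<^bsub>M\<^esub> = \<one>\<^bsub>G\<^esub>"
  shows "abelian_group M"
proof -
  interpret comm_group G by fact
  show ?thesis
    by (rule abelian_groupI) (auto simp: assms(2-) m_assoc intro: m_comm l_inv_ex)
qed

context left_module
begin

lemma smult_l_null: "x \<in> carrier M \<Longrightarrow> \<zero>\<^bsub>R\<^esub> \<odot>\<^bsub>M\<^esub> x = \<zero>\<^bsub>M\<^esub>"
  using smult_l_distr[of "\<zero>\<^bsub>R\<^esub>" "\<zero>\<^bsub>R\<^esub>" x] smult_closed[of "\<zero>\<^bsub>R\<^esub>" x]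
  by (metis M.add.r_cancel_one' R.add.r_one R.zero_closed)

lemma smult_r_null: "a \<in> carrier R \<Longrightarrow> a \<odot>\<^bsub>M\<^esub> \<zero>\<^bsub>M\<^esub> = \<zero>\<^bsub>M\<^esub>"
  using smult_r_distr[of a "\<zero>\<^bsub>M\<^esub>" "\<zero>\<^bsub>M\<^esub>"] smult_closed[of a "\<zero>\<^bsub>M\<^esub>"]
  by (metis M.add.r_cancel_one' M.add.r_one M.zero_closed)

lemma smult_l_minus:
  assumes "a \<in> carrier R" "x \<in> carrier M"
  shows "(\<ominus>\<^bsub>R\<^esub> a) \<odot>\<^bsub>M\<^esub> x = \<ominus>\<^bsub>M\<^esub> (a \<odot>\<^bsub>M\<^esub> x)"
proof -
  have "(\<ominus>\<^bsub>R\<^esub> a) \<odot>\<^bsub>M\<^esub> x \<oplus>\<^bsub>M\<^esub> a \<odot>\<^bsub>M\<^esub> x = \<zero>\<^bsub>M\<^esub>"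
    using assms smult_l_distr[of "\<ominus>\<^bsub>R\<^esub> a" a x] by (simp add: smult_l_null R.l_neg)
  then show ?thesis
    using assms by (intro M.minus_equality[symmetric]) (simp_all add: smult_closed)
qed

end

text \<open>A submodule, as a subset of the carrier; \<open>coset_eq_iff\<close> and the \<open>quot\<close> lemmas below describe the
  quotient by it.\<close>

locale left_submodule = left_module R M
  for R :: "('a, 'm) ring_scheme" (structure) and M :: "('a, 'b) module" (structure) +
  fixes N :: "'b set"
  assumes subgroup: "subgroup N (add_monoid M)"
    and smult_mem: "a \<in> carrier R \<Longrightarrow> x \<in> N \<Longrightarrow> a \<odot>\<^bsub>M\<^esub> x \<in> N"
begin

sublocale sub: abelian_subgroup N M
  by (rule abelian_subgroupI3[OF additive_subgroupI[OF subgroup] M.abelian_group_axioms])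

lemma mem_carrier: "x \<in> N \<Longrightarrow> x \<in> carrier M"
  using sub.a_subset by blast

lemma coset_eq_iff:
  assumes "x \<in> carrier M" "y \<in> carrier M"
  shows "N +>\<^bsub>M\<^esub> x = N +>\<^bsub>M\<^esub> y \<longleftrightarrow> x \<oplus>\<^bsub>M\<^esub> \<ominus>\<^bsub>M\<^esub> y \<in> N"
proof
  assume "N +>\<^bsub>M\<^esub> x = N +>\<^bsub>M\<^esub> y"
  then have "x \<in> N +>\<^bsub>M\<^esub> y" using sub.a_rcos_self[OF assms(1)] by simp
  then show "x \<oplus>\<^bsub>M\<^esub> \<ominus>\<^bsub>M\<^esub> y \<in> N" by (rule sub.a_rcos_module_imp[OF assms(2)])
next
  assume "x \<oplus>\<^bsub>M\<^esub> \<ominus>\<^bsub>M\<^esub> y \<in> N"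
  then have "x \<in> N +>\<^bsub>M\<^esub> y" by (rule sub.a_rcos_module_rev[OF assms(2,1)])
  then show "N +>\<^bsub>M\<^esub> x = N +>\<^bsub>M\<^esub> y"
    using M.a_repr_independence[OF _ assms(2) subgroup] by simp
qed

lemma quot_carrier: "carrier (quot_module M N) = {N +>\<^bsub>M\<^esub> x | x. x \<in> carrier M}"
  by (auto simp: quot_module_def A_RCOSETS_def')

lemma quot_zero: "\<zero>\<^bsub>quot_module M N\<^esub> = N +>\<^bsub>M\<^esub> \<zero>\<^bsub>M\<^esub>"
  using sub.a_subset by (simp add: quot_module_def)

lemma quot_add:
  "x \<in> carrier M \<Longrightarrow> y \<in> carrier M \<Longrightarrow>
    (N +>\<^bsub>M\<^esub> x) \<oplus>\<^bsub>quot_module M N\<^esub> (N +>\<^bsub>M\<^esub> y) = N +>\<^bsub>M\<^esub> (x \<oplus>\<^bsub>M\<^esub> y)"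
  by (simp add: quot_module_def sub.a_rcos_sum)

lemma quot_smult:
  assumes "a \<in> carrier R" "x \<in> carrier M"
  shows "a \<odot>\<^bsub>quot_module M N\<^esub> (N +>\<^bsub>M\<^esub> x) = N +>\<^bsub>M\<^esub> (a \<odot>\<^bsub>M\<^esub> x)"
proof -
  have *: "N +>\<^bsub>M\<^esub> (a \<odot>\<^bsub>M\<^esub> y) = N +>\<^bsub>M\<^esub> (a \<odot>\<^bsub>M\<^esub> x)" if y: "y \<in> N +>\<^bsub>M\<^esub> x" for y
  proof -
    obtain z where z: "z \<in> N" "y = z \<oplus>\<^bsub>M\<^esub> x" using y by (auto simp: a_r_coset_def')
    then have "a \<odot>\<^bsub>M\<^esub> y = a \<odot>\<^bsub>M\<^esub> z \<oplus>\<^bsub>M\<^esub> a \<odot>\<^bsub>M\<^esub> x"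
      using assms mem_carrier by (simp add: smult_r_distr)
    moreover have "N +>\<^bsub>M\<^esub> (a \<odot>\<^bsub>M\<^esub> z) = N"
      using smult_mem[OF assms(1) z(1)] by (rule sub.a_rcos_const)
    ultimately show ?thesis
      using M.a_coset_add_assoc[OF sub.a_subset, of "a \<odot>\<^bsub>M\<^esub> z" "a \<odot>\<^bsub>M\<^esub> x"] assms z mem_carrier
        smult_closed by simp
  qed
  have "(\<Union>y\<in>N +>\<^bsub>M\<^esub> x. N +>\<^bsub>M\<^esub> (a \<odot>\<^bsub>M\<^esub> y)) = N +>\<^bsub>M\<^esub> (a \<odot>\<^bsub>M\<^esub> x)"
    by (intro UN_constant_eq[OF sub.a_rcos_self[OF assms(2)]] ballI *)
  then show ?thesis by (simp only: quot_module_def module.simps)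
qed

lemma quot_left_module: "left_module R (quot_module M N)"
proof (intro left_module.intro left_module_axioms.intro R.ring_axioms)
  show "abelian_group (quot_module M N)"
    by (rule abelian_group_of_comm_group[OF sub.a_factorgroup_is_comm_group])
      (simp_all add: quot_module_def A_FactGroup_def FactGroup_def A_RCOSETS_def set_add_def)
next
  fix a X assume "a \<in> carrier R" "X \<in> carrier (quot_module M N)"
  then obtain x where "a \<in> carrier R" "x \<in> carrier M" "X = N +>\<^bsub>M\<^esub> x" by (auto simp: quot_carrier)
  then show "a \<odot>\<^bsub>quot_module M N\<^esub> X \<in> carrier (quot_module M N)"
    unfolding quot_carrier using quot_smult smult_closed by blast
next
  fix a b X assume ab: "a \<in> carrier R" "b \<in> carrier R" and "X \<in> carrier (quot_module M N)"
  then obtain x where "x \<in> carrier M" "X = N +>\<^bsub>M\<^esub> x" by (auto simp: quot_carrier)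
  then show "(a \<oplus>\<^bsub>R\<^esub> b) \<odot>\<^bsub>quot_module M N\<^esub> X
      = a \<odot>\<^bsub>quot_module M N\<^esub> X \<oplus>\<^bsub>quot_module M N\<^esub> b \<odot>\<^bsub>quot_module M N\<^esub> X"
    and "(a \<otimes>\<^bsub>R\<^esub> b) \<odot>\<^bsub>quot_module M N\<^esub> X = a \<odot>\<^bsub>quot_module M N\<^esub> (b \<odot>\<^bsub>quot_module M N\<^esub> X)"
    using ab by (simp_all add: quot_smult quot_add smult_closed smult_l_distr smult_assoc)
next
  fix a X Y assume a: "a \<in> carrier R" and "X \<in> carrier (quot_module M N)" "Y \<in> carrier (quot_module M N)"
  then obtain x y where "x \<in> carrier M" "X = N +>\<^bsub>M\<^esub> x" "y \<in> carrier M" "Y = N +>\<^bsub>M\<^esub> y"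
    by (auto simp: quot_carrier)
  then show "a \<odot>\<^bsub>quot_module M N\<^esub> (X \<oplus>\<^bsub>quot_module M N\<^esub> Y)
      = a \<odot>\<^bsub>quot_module M N\<^esub> X \<oplus>\<^bsub>quot_module M N\<^esub> a \<odot>\<^bsub>quot_module M N\<^esub> Y"
    using a by (simp add: quot_smult quot_add smult_closed smult_r_distr)
next
  fix X assume "X \<in> carrier (quot_module M N)"
  then obtain x where "x \<in> carrier M" "X = N +>\<^bsub>M\<^esub> x" by (auto simp: quot_carrier)
  then show "\<one>\<^bsub>R\<^esub> \<odot>\<^bsub>quot_module M N\<^esub> X = X" by (simp add: quot_smult smult_one)
qed

end

lemma (in left_module) restrict_left_module:
  assumes "subring K R" and "subgroup L (add_monoid M)"
    and "\<And>a x. a \<in> K \<Longrightarrow> x \<in> L \<Longrightarrow> a \<odot>\<^bsub>M\<^esub> x \<in> L"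
  shows "left_module (R\<lparr>carrier := K\<rparr>) (submodule_on M L)"
proof (intro left_module.intro left_module_axioms.intro)
  show "ring (R\<lparr>carrier := K\<rparr>)" using R.subring_is_ring[OF assms(1)] .
  interpret L: additive_subgroup L M using assms(2) by (rule additive_subgroupI)
  have "\<ominus>\<^bsub>M\<^esub> x \<oplus>\<^bsub>M\<^esub> x = \<zero>\<^bsub>M\<^esub>" if "x \<in> L" for x
    using that L.a_Hcarr by (simp add: M.l_neg)
  then show "abelian_group (submodule_on M L)"
    by (intro abelian_groupI)
      (use L.a_Hcarr L.a_inv_closed in \<open>auto simp: submodule_on_def M.a_ac\<close>)
  have K: "K \<subseteq> carrier R" using assms(1) subringE(1) by blast
  have L: "L \<subseteq> carrier M" using subgroup.subset[OF assms(2)] by simp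
  show "a \<odot>\<^bsub>submodule_on M L\<^esub> x \<in> carrier (submodule_on M L)"
    if "a \<in> carrier (R\<lparr>carrier := K\<rparr>)" "x \<in> carrier (submodule_on M L)" for a x
    using that assms(3) by (simp add: submodule_on_def)
  show "(a \<oplus>\<^bsub>R\<lparr>carrier := K\<rparr>\<^esub> b) \<odot>\<^bsub>submodule_on M L\<^esub> x
      = a \<odot>\<^bsub>submodule_on M L\<^esub> x \<oplus>\<^bsub>submodule_on M L\<^esub> b \<odot>\<^bsub>submodule_on M L\<^esub> x"
    and "(a \<otimes>\<^bsub>R\<lparr>carrier := K\<rparr>\<^esub> b) \<odot>\<^bsub>submodule_on M L\<^esub> x
      = a \<odot>\<^bsub>submodule_on M L\<^esub> (b \<odot>\<^bsub>submodule_on M L\<^esub> x)"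
    if "a \<in> carrier (R\<lparr>carrier := K\<rparr>)" "b \<in> carrier (R\<lparr>carrier := K\<rparr>)" "x \<in> carrier (submodule_on M L)" for a b x
    using that K L smult_l_distr[of a b x] smult_assoc[of a b x] by (auto simp: submodule_on_def)
  show "a \<odot>\<^bsub>submodule_on M L\<^esub> (x \<oplus>\<^bsub>submodule_on M L\<^esub> y)
      = a \<odot>\<^bsub>submodule_on M L\<^esub> x \<oplus>\<^bsub>submodule_on M L\<^esub> a \<odot>\<^bsub>submodule_on M L\<^esub> y"
    if "a \<in> carrier (R\<lparr>carrier := K\<rparr>)" "x \<in> carrier (submodule_on M L)" "y \<in> carrier (submodule_on M L)" for a x y
    using that K L smult_r_distr[of a x y] by (auto simp: submodule_on_def)
  show "\<one>\<^bsub>R\<lparr>carrier := K\<rparr>\<^esub> \<odot>\<^bsub>submodule_on M L\<^esub> x = x" if "x \<in> carrier (submodule_on M L)" for x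
    using that L smult_one[of x] by (auto simp: submodule_on_def)
qed

lemma pullback_left_module:
  assumes "left_module R M" and "ring S" and "\<psi> \<in> Ring.ring_hom S R"
  shows "left_module S (pullback_module \<psi> M)"
proof -
  interpret left_module R M by fact
  show ?thesis
  proof (intro left_module.intro left_module_axioms.intro assms(2))
    show "abelian_group (pullback_module \<psi> M)"
      by (rule abelian_group_of_comm_group[OF M.a_comm_group]) (simp_all add: pullback_module_def)
  qed (use ring_hom_closed[OF assms(3)] in \<open>simp_all add: pullback_module_def ring_hom_add[OF assms(3)]
      ring_hom_mult[OF assms(3)] ring_hom_one[OF assms(3)] smult_closed smult_l_distr smult_r_distr
      smult_assoc smult_one\<close>)
qed

lemma descend_smult:
  fixes R (structure)
  assumes "left_module R M" and "ideal I R" and "\<And>a x. a \<in> I \<Longrightarrow> x \<in> carrier M \<Longrightarrow> a \<odot>\<^bsub>M\<^esub> x = \<zero>\<^bsub>M\<^esub>"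
    and "a \<in> carrier R" "x \<in> carrier M"
  shows "(I +>\<^bsub>R\<^esub> a) \<odot>\<^bsub>descend_module M\<^esub> x = a \<odot>\<^bsub>M\<^esub> x"
proof -
  interpret left_module R M by fact
  interpret I: ideal I R by fact
  have *: "b \<odot>\<^bsub>M\<^esub> x = a \<odot>\<^bsub>M\<^esub> x" if b: "b \<in> I +>\<^bsub>R\<^esub> a" for b
  proof -
    obtain z where z: "z \<in> I" "b = z \<oplus>\<^bsub>R\<^esub> a" using b by (auto simp: a_r_coset_def')
    then show ?thesis
      using assms I.Icarr by (simp add: smult_l_distr smult_closed)
  qed
  have "(\<Union>b\<in>I +>\<^bsub>R\<^esub> a. b \<odot>\<^bsub>M\<^esub> x) = a \<odot>\<^bsub>M\<^esub> x"
    by (intro UN_constant_eq[OF I.a_rcos_self[OF assms(4)]] ballI *)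
  then show ?thesis by (simp only: descend_module_def module.simps)
qed

lemma descend_left_module:
  fixes R (structure)
  assumes "left_module R M" and "ideal I R" and "\<And>a x. a \<in> I \<Longrightarrow> x \<in> carrier M \<Longrightarrow> a \<odot>\<^bsub>M\<^esub> x = \<zero>\<^bsub>M\<^esub>"
  shows "left_module (R Quot I) (descend_module M)"
proof -
  interpret left_module R M by fact
  interpret I: ideal I R by fact
  note smult = descend_smult[OF assms]
  have [simp]: "carrier (descend_module M) = carrier M" "add (descend_module M) = add M"
    by (simp_all add: descend_module_def)
  have hom: "(+>\<^bsub>R\<^esub>) I \<in> Ring.ring_hom R (R Quot I)" by (rule I.rcos_ring_hom)
  have cosets: "\<exists>a\<in>carrier R. X = I +>\<^bsub>R\<^esub> a" if "X \<in> carrier (R Quot I)" for X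
    using that by (auto simp: FactRing_def A_RCOSETS_def')
  show ?thesis
  proof (intro left_module.intro left_module_axioms.intro I.quotient_is_ring)
    show "abelian_group (descend_module M)"
      by (rule abelian_group_of_comm_group[OF M.a_comm_group]) (simp_all add: descend_module_def)
  next
    fix X x assume "X \<in> carrier (R Quot I)" "x \<in> carrier (descend_module M)"
    then show "X \<odot>\<^bsub>descend_module M\<^esub> x \<in> carrier (descend_module M)"
      using cosets smult smult_closed by fastforce
  next
    fix X Y x assume *: "X \<in> carrier (R Quot I)" "Y \<in> carrier (R Quot I)" "x \<in> carrier (descend_module M)"
    obtain a b where ab: "a \<in> carrier R" "X = I +>\<^bsub>R\<^esub> a" "b \<in> carrier R" "Y = I +>\<^bsub>R\<^esub> b"
      using cosets * by blast
    have "X \<oplus>\<^bsub>R Quot I\<^esub> Y = I +>\<^bsub>R\<^esub> (a \<oplus> b)" "X \<otimes>\<^bsub>R Quot I\<^esub> Y = I +>\<^bsub>R\<^esub> (a \<otimes> b)"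
      using ab ring_hom_add[OF hom] ring_hom_mult[OF hom] by simp_all
    then show "(X \<oplus>\<^bsub>R Quot I\<^esub> Y) \<odot>\<^bsub>descend_module M\<^esub> x
        = X \<odot>\<^bsub>descend_module M\<^esub> x \<oplus>\<^bsub>descend_module M\<^esub> Y \<odot>\<^bsub>descend_module M\<^esub> x"
      "(X \<otimes>\<^bsub>R Quot I\<^esub> Y) \<odot>\<^bsub>descend_module M\<^esub> x = X \<odot>\<^bsub>descend_module M\<^esub> (Y \<odot>\<^bsub>descend_module M\<^esub> x)"
      using ab * by (simp_all add: smult smult_l_distr smult_assoc smult_closed)
  next
    fix X x y assume *: "X \<in> carrier (R Quot I)" "x \<in> carrier (descend_module M)" "y \<in> carrier (descend_module M)"
    obtain a where "a \<in> carrier R" "X = I +>\<^bsub>R\<^esub> a" using cosets * by blast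
    then show "X \<odot>\<^bsub>descend_module M\<^esub> (x \<oplus>\<^bsub>descend_module M\<^esub> y)
        = X \<odot>\<^bsub>descend_module M\<^esub> x \<oplus>\<^bsub>descend_module M\<^esub> X \<odot>\<^bsub>descend_module M\<^esub> y"
      using * by (simp add: smult smult_r_distr)
  next
    fix x assume "x \<in> carrier (descend_module M)"
    then show "\<one>\<^bsub>R Quot I\<^esub> \<odot>\<^bsub>descend_module M\<^esub> x = x"
      using smult[of "\<one>" x] ring_hom_one[OF hom] by (simp add: smult_one)
  qed
qed

lemma regular_left_module:
  assumes "ring R"
  shows "left_module R (regular_module R)"
proof -
  interpret ring R by fact
  have "abelian_group (regular_module R)"
    by (rule abelian_group_of_comm_group[OF a_comm_group]) (simp_all add: regular_module_def)
  then show ?thesis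
    by (intro left_module.intro left_module_axioms.intro assms)
      (simp_all add: regular_module_def l_distr r_distr m_assoc)
qed

lemma left_multiples_submodule:
  fixes R (structure)
  assumes "ring R" and "S \<subseteq> carrier R"
  shows "subgroup (left_multiples R S) (add_monoid R)"
    and "a \<in> carrier R \<Longrightarrow> x \<in> left_multiples R S \<Longrightarrow> a \<otimes> x \<in> left_multiples R S"
    and "S \<subseteq> left_multiples R S"
proof -
  interpret ring R by fact
  let ?G = "{r \<otimes> s | r s. r \<in> carrier R \<and> s \<in> S}"
  have G: "?G \<subseteq> carrier R" using assms(2) by auto
  show sub: "subgroup (left_multiples R S) (add_monoid R)"
    unfolding left_multiples_def by (rule group.generate_is_subgroup[OF a_group]) (simp add: G)
  show "a \<otimes> x \<in> left_multiples R S" if a: "a \<in> carrier R" and "x \<in> left_multiples R S"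
    using that(2) unfolding left_multiples_def
  proof (induction rule: generate.induct)
    case one
    show ?case using a generate.one[of "add_monoid R" ?G] by simp
  next
    case (incl h)
    then obtain r s where "h = r \<otimes> s" "r \<in> carrier R" "s \<in> S" by blast
    then have "a \<otimes> h = (a \<otimes> r) \<otimes> s" "a \<otimes> r \<in> carrier R" using a assms(2) by (auto simp: m_assoc)
    then show ?case using \<open>s \<in> S\<close> by (intro generate.incl) blast
  next
    case (inv h)
    then obtain r s where *: "h = r \<otimes> s" "r \<in> carrier R" "s \<in> S" by blast
    then have "a \<otimes> (\<ominus> h) = (\<ominus> (a \<otimes> r)) \<otimes> s" "\<ominus> (a \<otimes> r) \<in> carrier R"
      using a assms(2) by (auto simp: m_assoc r_minus l_minus)
    then show ?case using * unfolding a_inv_def by (intro generate.incl) blast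
  next
    case (eng h1 h2)
    have "h1 \<in> carrier R" "h2 \<in> carrier R"
      using eng group.generate_in_carrier[OF a_group, of ?G] G by auto
    then show ?case using eng a generate.eng[OF eng.IH] by (simp add: r_distr)
  qed
  show "S \<subseteq> left_multiples R S"
  proof
    fix x assume x: "x \<in> S"
    then have "x = \<one> \<otimes> x" using assms(2) by auto
    then show "x \<in> left_multiples R S"
      unfolding left_multiples_def using x by (intro generate.incl) blast
  qed
qed

lemma left_multiples_minimal:
  fixes R (structure)
  assumes "ring R" and "S \<subseteq> J" and "subgroup J (add_monoid R)"
    and "\<And>a x. a \<in> carrier R \<Longrightarrow> x \<in> J \<Longrightarrow> a \<otimes> x \<in> J"
  shows "left_multiples R S \<subseteq> J"
proof -
  interpret ring R by fact
  show ?thesis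
    unfolding left_multiples_def
    by (rule group.generate_subgroup_incl[OF a_group _ assms(3)]) (use assms in auto)
qed


section \<open>Highest weight vectors\<close>

lemma tgwa_scalar_hom: "tgwa_scalar A \<in> Ring.ring_hom class_ring (tgwa A)"
  by (rule ring_hom_memI)
    (simp_all add: tgwa_scalar_def tgwa_class_add tgwa_class_mult tgwa_class_one free_scalar_add
      free_scalar_mult free_scalar_one)

text \<open>Modules over a triangular generalized Weyl algebra, acted on by elements of the free algebra.\<close>

locale tgwa_module = tgwa_basis A + V: left_module "tgwa A" V
  for A :: "('k::field, 'h::comm_ring_1) tgwa_data" and V :: "(('k, 'h) tgwa_elem, 'v) module"
begin

definition act :: "('k, 'h tgwa_letter) free_alg \<Rightarrow> 'v \<Rightarrow> 'v" where
  "act x m = tgwa_class A x \<odot>\<^bsub>V\<^esub> m"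

lemma act_closed [simp]: "m \<in> carrier V \<Longrightarrow> act x m \<in> carrier V"
  by (simp add: act_def V.smult_closed)

lemma act_add: "m \<in> carrier V \<Longrightarrow> act (x + y) m = act x m \<oplus>\<^bsub>V\<^esub> act y m"
  by (simp add: act_def V.smult_l_distr flip: tgwa_class_add)

lemma act_add_right:
  "m \<in> carrier V \<Longrightarrow> m' \<in> carrier V \<Longrightarrow> act x (m \<oplus>\<^bsub>V\<^esub> m') = act x m \<oplus>\<^bsub>V\<^esub> act x m'"
  by (simp add: act_def V.smult_r_distr)

lemma act_mult: "m \<in> carrier V \<Longrightarrow> act (x * y) m = act x (act y m)"
  by (simp add: act_def V.smult_assoc flip: tgwa_class_mult)

lemma act_one: "m \<in> carrier V \<Longrightarrow> act 1 m = m"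
  by (simp add: act_def V.smult_one flip: tgwa_class_one)

lemma act_zero: "m \<in> carrier V \<Longrightarrow> act 0 m = \<zero>\<^bsub>V\<^esub>"
  by (simp add: act_def V.smult_l_null flip: tgwa_class_zero)

lemma act_zero_right: "act x \<zero>\<^bsub>V\<^esub> = \<zero>\<^bsub>V\<^esub>"
  by (simp add: act_def V.smult_r_null)

lemma act_uminus: "m \<in> carrier V \<Longrightarrow> act (- x) m = \<ominus>\<^bsub>V\<^esub> act x m"
  by (simp add: act_def V.smult_l_minus flip: tgwa_class_uminus)

lemma act_diff: "m \<in> carrier V \<Longrightarrow> act (x - y) m = act x m \<oplus>\<^bsub>V\<^esub> \<ominus>\<^bsub>V\<^esub> act y m"
  using act_add[of m x "- y"] by (simp add: act_uminus)

lemma act_cong: "tgwa_eq A x y \<Longrightarrow> act x m = act y m"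
  by (simp add: act_def flip: tgwa_class_eq_iff)

lemma act_sum_cong:
  assumes "m \<in> carrier V" "\<And>k. k \<in> S \<Longrightarrow> act (f k) m = act (g k) m"
  shows "act (sum f S) m = act (sum g S) m"
  using assms(2)
  by (induction S rule: infinite_finite_induct) (simp_all add: act_add assms(1))

lemma weight_space_iff:
  "m \<in> weight_space A V \<nu> \<longleftrightarrow>
    m \<in> carrier V \<and> (\<forall>h. act (free_gen (Base h)) m = act (free_scalar (\<nu> h)) m)"
  by (simp add: weight_space_def act_def tgwa_base_def tgwa_scalar_def)

lemma act_scalar_commute:
  "m \<in> carrier V \<Longrightarrow> act x (act (free_scalar c) m) = act (free_scalar c) (act x m)"
  by (metis act_mult free_scalar_commute)

lemma weight_space_scalar:
  assumes "m \<in> weight_space A V \<nu>"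
  shows "act (free_scalar c) m \<in> weight_space A V \<nu>"
proof -
  have m: "m \<in> carrier V" "\<And>h. act (free_gen (Base h)) m = act (free_scalar (\<nu> h)) m"
    using assms by (auto simp: weight_space_iff)
  have "act (free_gen (Base h)) (act (free_scalar c) m) = act (free_scalar (\<nu> h)) (act (free_scalar c) m)" for h
    unfolding act_scalar_commute[OF m(1), of "free_gen (Base h)"] m(2)
    by (rule act_scalar_commute[OF m(1), symmetric])
  then show ?thesis using m(1) by (simp add: weight_space_iff)
qed

lemma weight_vectorspace_vectorspace:
  "vectorspace class_ring (weight_vectorspace A V \<nu>)"
proof -
  let ?P = "pullback_module (tgwa_scalar A) V"
  interpret P: left_module class_ring ?P
    by (rule pullback_left_module[OF V.left_module_axioms class_ring.ring_axioms tgwa_scalar_hom])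
  have P: "carrier ?P = carrier V" "add ?P = add V" "zero ?P = zero V"
    by (simp_all add: pullback_module_def)
  have smult: "c \<odot>\<^bsub>?P\<^esub> m = act (free_scalar c) m" for c m
    by (simp add: pullback_module_def act_def tgwa_scalar_def)
  have "subgroup (weight_space A V \<nu>) (add_monoid ?P)"
  proof (rule P.M.add.subgroupI)
    show "weight_space A V \<nu> \<noteq> {}"
      using V.M.zero_closed act_zero_right weight_space_iff by (metis emptyE)
    fix m assume m: "m \<in> weight_space A V \<nu>"
    have "\<ominus>\<^bsub>?P\<^esub> m = \<ominus>\<^bsub>V\<^esub> m" by (simp add: P a_inv_def m_inv_def)
    also have "\<dots> = act (- 1) m"
      using m by (simp add: weight_space_iff act_uminus act_one)
    finally have *: "\<ominus>\<^bsub>?P\<^esub> m = act (free_scalar (- 1)) m"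
      by (simp add: free_scalar_uminus free_scalar_one)
    show "\<ominus>\<^bsub>?P\<^esub> m \<in> weight_space A V \<nu>"
      using weight_space_scalar[OF m] by (simp add: *)
  qed (auto simp: P weight_space_iff act_add_right)
  moreover have "c \<odot>\<^bsub>?P\<^esub> m \<in> weight_space A V \<nu>" if "m \<in> weight_space A V \<nu>" for c m
    using weight_space_scalar[OF that] by (simp add: smult)
  moreover have "subring (carrier (class_ring :: 'k ring)) class_ring"
    by (rule ring.carrier_is_subring[OF class_ring.ring_axioms])
  ultimately have "left_module class_ring (weight_vectorspace A V \<nu>)"
    using P.restrict_left_module[of UNIV "weight_space A V \<nu>"]
    by (simp add: weight_vectorspace_def)
  then interpret W: left_module class_ring "weight_vectorspace A V \<nu>" .
  show ?thesis
    by (intro vectorspace.intro moduleI class_field.field_axioms class_cring.cring_axioms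
        W.M.abelian_group_axioms W.smult_closed W.smult_l_distr W.smult_r_distr W.smult_assoc
        W.smult_one)
qed

end

lemma (in vectorspace) cyclic_dim:
  assumes "v \<in> carrier V" "carrier V = {c \<odot>\<^bsub>V\<^esub> v | c. c \<in> carrier K}"
  shows "fin_dim" and "dim = (if v = \<zero>\<^bsub>V\<^esub> then 0 else 1)"
proof -
  have "carrier V \<subseteq> span {v}"
  proof
    fix w assume "w \<in> carrier V"
    then obtain c where c: "c \<in> carrier K" "w = c \<odot>\<^bsub>V\<^esub> v" using assms(2) by blast
    then have "w = lincomb (\<lambda>_. c) {v}" unfolding lincomb_def using assms(1) by simp
    then show "w \<in> span {v}" using c unfolding span_def by blast
  qed
  then have gen: "gen_set {v}" using span_closed assms(1) by blast
  then show "fin_dim" unfolding fin_dim_def using assms(1) by blast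
  show "dim = (if v = \<zero>\<^bsub>V\<^esub> then 0 else 1)"
    using gen dim0I dim1I assms(1) by auto
qed

text \<open>A generator \<open>v\<close> of \<open>V\<close> that is killed by \<open>u\<close> and on which the base acts through \<open>\<mu>\<close>.  Up to
  \<open>v\<close> being nonzero, the existence of such a vector characterises highest weight modules.\<close>

locale highest_weight_vector = tgwa_module A V
  for A :: "('k::field, 'h::comm_ring_1) tgwa_data" and V :: "(('k, 'h) tgwa_elem, 'v) module" +
  fixes \<mu> :: "'h \<Rightarrow> 'k" and v :: 'v
  assumes is_weight: "weight A \<mu>"
    and vector: "v \<in> carrier V"
    and up_vector: "act (free_gen Up) v = \<zero>\<^bsub>V\<^esub>"
    and base_vector: "act (free_gen (Base h)) v = act (free_scalar (\<mu> h)) v"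
    and cyclic: "m \<in> carrier V \<Longrightarrow> \<exists>x. m = act x v"
begin

lemma weight_add: "\<mu> (g + h) = \<mu> g + \<mu> h"
  and weight_mult: "\<mu> (g * h) = \<mu> g * \<mu> h"
  and weight_scalar: "\<mu> (scalar_map A c) = c"
  using is_weight by (simp_all add: weight_def)

lemma weight_zero: "\<mu> 0 = 0"
  using weight_scalar[of 0] by (simp add: scalar_map_zero)

lemma weight_one: "\<mu> 1 = 1"
  using weight_scalar[of 1] by (simp add: scalar_map_one)

lemma down_closed [simp]: "act (free_gen Down ^ i) v \<in> carrier V"
  by (simp add: vector)

lemma act_pbw_monomial_vector:
  "act (pbw_monomial i j h) v = act (if j = 0 then free_scalar (\<mu> h) * free_gen Down ^ i else 0) v"
proof (cases j)
  case 0
  have "act (pbw_monomial i j h) v = act (free_gen Down ^ i) (act (free_scalar (\<mu> h)) v)"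
    by (simp add: 0 pbw_monomial_def act_mult vector base_vector)
  then show ?thesis by (simp add: 0 act_mult vector act_scalar_commute)
next
  case (Suc k)
  have "pbw_monomial i j h = (free_gen Down ^ i * free_gen (Base h) * free_gen Up ^ k) * free_gen Up"
    by (simp add: pbw_monomial_def Suc mult.assoc power_commutes)
  then show ?thesis by (simp only: act_mult vector up_vector act_zero_right) (simp add: Suc act_zero vector)
qed

lemma base_down_vector:
  "act (free_gen (Base h)) (act (free_gen Down ^ i) v)
    = act (free_scalar (\<mu> ((endo A ^^ i) h))) (act (free_gen Down ^ i) v)"
proof -
  have "act (free_gen (Base h)) (act (free_gen Down ^ i) v)
      = act (free_gen Down ^ i * free_gen (Base ((endo A ^^ i) h))) v"
    using act_cong[OF base_down_power] by (simp add: vector flip: act_mult)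
  also have "\<dots> = act (free_scalar (\<mu> ((endo A ^^ i) h))) (act (free_gen Down ^ i) v)"
    by (simp add: act_mult vector base_vector act_scalar_commute)
  finally show ?thesis .
qed

lemma down_weight_space: "act (free_gen Down ^ i) v \<in> weight_space A V (\<mu> \<circ> (endo A ^^ i))"
  by (simp add: weight_space_iff base_down_vector)

end

text \<open>If the weights of the vectors \<open>d^i v\<close> are pairwise distinct, then Lagrange interpolation in
  the base algebra separates these vectors, so that the weight space of each of these weights
  is spanned by one of them.\<close>

locale separated_highest_weight_vector = highest_weight_vector A V \<mu> v
  for A :: "('k::field, 'h::comm_ring_1) tgwa_data" and V :: "(('k, 'h) tgwa_elem, 'v) module"
    and \<mu> v +
  assumes separated: "\<exists>h. inj (\<lambda>i. \<mu> ((endo A ^^ i) h))"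
begin

lemma interpolation:
  assumes "finite I" "k \<notin> I"
  shows "\<exists>g. \<mu> ((endo A ^^ k) g) = 1 \<and> (\<forall>i\<in>I. \<mu> ((endo A ^^ i) g) = 0)"
  using assms
proof (induction I)
  case empty
  have "(endo A ^^ k) 1 = 1" using endo_pow_scalar[of k 1] by (simp add: scalar_map_one)
  then show ?case using weight_one by (intro exI[of _ 1]) simp
next
  case (insert i I)
  then obtain g where g: "\<mu> ((endo A ^^ k) g) = 1" "\<And>i. i \<in> I \<Longrightarrow> \<mu> ((endo A ^^ i) g) = 0"
    by auto
  obtain h where "inj (\<lambda>i. \<mu> ((endo A ^^ i) h))" using separated by blast
  define a where "a j = \<mu> ((endo A ^^ j) h)" for j
  have "a k \<noteq> a i"
    using insert.prems \<open>inj _\<close> unfolding a_def by (auto dest: injD)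
  define g' where "g' = g * (h + scalar_map A (- a i)) * scalar_map A (inverse (a k - a i))"
  have "\<mu> ((endo A ^^ j) g') = \<mu> ((endo A ^^ j) g) * (a j - a i) * inverse (a k - a i)" for j
    by (simp add: g'_def endo_pow_mult endo_pow_add endo_pow_scalar weight_mult weight_add
        weight_scalar a_def)
  then have "\<mu> ((endo A ^^ k) g') = 1 \<and> (\<forall>j\<in>insert i I. \<mu> ((endo A ^^ j) g') = 0)"
    using g \<open>a k \<noteq> a i\<close> by auto
  then show ?case by blast
qed

text \<open>Applying a base element that is \<open>1\<close> at the \<open>k\<close>-th weight and \<open>0\<close> at the other weights involved
  isolates the component of \<open>d^k v\<close>.\<close>

lemma weight_component:
  assumes "act x v \<in> weight_space A V (\<mu> \<circ> (endo A ^^ k))"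
  shows "act x v = act (free_scalar (\<mu> (pbw_coeffs x k 0))) (act (free_gen Down ^ k) v)"
proof -
  let ?d = "free_gen Down :: ('k, 'h tgwa_letter) free_alg"
  obtain S where S: "finite S" "\<And>i j. (i, j) \<notin> S \<Longrightarrow> pbw_coeffs x i j = 0"
    "tgwa_eq A x (\<Sum>(i, j)\<in>S. pbw_monomial i j (pbw_coeffs x i j))"
    by (rule pbw_coeffs_expansion[of x]) blast
  obtain g where g: "\<mu> ((endo A ^^ k) g) = 1" "\<And>i. i \<in> fst ` S - {k} \<Longrightarrow> \<mu> ((endo A ^^ i) g) = 0"
    using interpolation[of "fst ` S - {k}" k] S(1) by auto
  let ?y = "\<lambda>(i, j). if (i, j) = (k, 0 :: nat) then free_scalar (\<mu> (pbw_coeffs x k 0)) * ?d ^ k else 0"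
  have "act x v = act (free_scalar (\<mu> ((endo A ^^ k) g))) (act x v)"
    using g vector by (simp add: free_scalar_one act_one)
  also have "\<dots> = act (free_gen (Base g)) (act x v)"
    using assms by (simp add: weight_space_iff)
  also have "\<dots> = act (free_gen (Base g)) (act (\<Sum>(i, j)\<in>S. pbw_monomial i j (pbw_coeffs x i j)) v)"
    by (simp add: act_cong[OF S(3)])
  also have "\<dots> = act (\<Sum>(i, j)\<in>S. free_gen (Base g) * pbw_monomial i j (pbw_coeffs x i j)) v"
    using vector by (simp add: sum_distrib_left split_def flip: act_mult)
  also have "\<dots> = act (sum ?y S) v"
  proof (rule act_sum_cong[OF vector])
    fix t assume "t \<in> S"
    then obtain i j where t: "t = (i, j)" and ij: "(i, j) \<in> S" by (cases t) auto
    have "act (free_gen (Base g) * pbw_monomial i j (pbw_coeffs x i j)) v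
        = act (if j = 0 then free_scalar (\<mu> ((endo A ^^ i) g * pbw_coeffs x i j)) * ?d ^ i else 0) v"
      by (simp add: act_cong[OF base_pbw_monomial] act_pbw_monomial_vector)
    also have "\<dots> = act (?y (i, j)) v"
    proof (cases "i = k")
      case False
      then have "\<mu> ((endo A ^^ i) g) = 0" using g(2)[of i] ij by force
      then show ?thesis using False by (simp add: weight_mult free_scalar_zero)
    qed (simp add: weight_mult g)
    finally show "act (case t of (i, j) \<Rightarrow> free_gen (Base g) * pbw_monomial i j (pbw_coeffs x i j)) v
        = act (?y t) v"
      by (simp add: t)
  qed
  also have "sum ?y S = free_scalar (\<mu> (pbw_coeffs x k 0)) * ?d ^ k"
  proof (cases "(k, 0) \<in> S")
    case True
    have "sum ?y S = sum ?y {(k, 0)}"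
      by (rule sum.mono_neutral_right) (use True S(1) in \<open>auto split: if_splits\<close>)
    then show ?thesis by simp
  next
    case False
    then have "sum ?y S = 0" by (intro sum.neutral) auto
    then show ?thesis using S(2)[OF False] by (simp add: weight_zero free_scalar_zero)
  qed
  finally show ?thesis using vector by (simp add: act_mult)
qed

lemma weight_space_eq:
  "weight_space A V (\<mu> \<circ> (endo A ^^ k))
    = {act (free_scalar c) (act (free_gen Down ^ k) v) | c. True}" (is "?L = ?R")
proof (intro equalityI subsetI)
  fix m assume m: "m \<in> ?L"
  then obtain x where "m = act x v" using cyclic weight_space_iff by blast
  then show "m \<in> ?R" using weight_component m by blast
next
  fix m assume "m \<in> ?R"
  then obtain c where "m = act (free_scalar c) (act (free_gen Down ^ k) v)" by blast
  then show "m \<in> ?L"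
    using weight_space_scalar[OF down_weight_space[of k]] by simp
qed

lemma weight_space_dim:
  fixes k
  defines "W \<equiv> weight_vectorspace A V (\<mu> \<circ> (endo A ^^ k))"
  shows "vectorspace.fin_dim class_ring W"
    and "vectorspace.dim class_ring W = (if act (free_gen Down ^ k) v = \<zero>\<^bsub>V\<^esub> then 0 else 1)"
proof -
  interpret W: vectorspace class_ring W
    unfolding W_def by (rule weight_vectorspace_vectorspace)
  let ?w = "act (free_gen Down ^ k) v"
  have w: "?w \<in> carrier W" "carrier W = {c \<odot>\<^bsub>W\<^esub> ?w | c. c \<in> carrier class_ring}" "\<zero>\<^bsub>W\<^esub> = \<zero>\<^bsub>V\<^esub>"
    using down_weight_space[of k] weight_space_eq[of k]
    by (simp_all add: W_def weight_vectorspace_def submodule_on_def pullback_module_def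
        act_def tgwa_scalar_def)
  show "W.fin_dim" by (rule W.cyclic_dim[OF w(1,2)])
  show "W.dim = (if ?w = \<zero>\<^bsub>V\<^esub> then 0 else 1)" using W.cyclic_dim(2)[OF w(1,2)] w(3) by simp
qed

text \<open>A vector of the highest weight is a multiple of the given one, so \<open>u\<close> kills it as well.\<close>

lemma other_highest_weight_vector:
  assumes "w \<in> weight_space A V \<mu>" and "\<And>m. m \<in> carrier V \<Longrightarrow> \<exists>x. m = act x w"
  shows "separated_highest_weight_vector A V \<mu> w"
proof -
  have w: "w \<in> carrier V" using assms(1) by (simp add: weight_space_iff)
  have "\<mu> \<circ> (endo A ^^ 0) = \<mu>" by auto
  then obtain c where "w = act (free_scalar c) v"
    using assms(1) weight_space_eq[of 0] act_one[OF vector] by auto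
  then have "act (free_gen Up) w = \<zero>\<^bsub>V\<^esub>"
    by (simp add: act_scalar_commute vector up_vector act_zero_right)
  then show ?thesis
    using assms w separated is_weight by unfold_locales (auto simp: weight_space_iff)
qed

end


section \<open>Highest weight modules\<close>

text \<open>The left ideal defining a Verma module is a submodule of the regular module, so that Verma
  modules are quotients to which the lemmas on submodules apply.\<close>

lemma verma_left_submodule:
  assumes "weight A \<mu>"
  shows "left_submodule (tgwa A) (regular_module (tgwa A)) (verma_ideal A \<mu>)"
proof -
  interpret R: ring "tgwa A" by (rule tgwa_ring)
  let ?I = "left_multiples (tgwa A) {tgwa_u A}"
  let ?J = "left_multiples (tgwa A) (tgwa_base A ` {h. \<mu> h = 0})"
  have gens: "{tgwa_u A} \<subseteq> carrier (tgwa A)" "tgwa_base A ` {h. \<mu> h = 0} \<subseteq> carrier (tgwa A)"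
    by (auto simp: tgwa_u_def tgwa_base_def)
  note I = left_multiples_submodule[OF tgwa_ring gens(1)]
  note J = left_multiples_submodule[OF tgwa_ring gens(2)]
  have "subgroup (verma_ideal A \<mu>) (add_monoid (tgwa A))"
    unfolding verma_ideal_def set_add_def
    by (rule comm_group.mult_subgroups[OF R.a_comm_group I(1) J(1)])
  then have "subgroup (verma_ideal A \<mu>) (add_monoid (regular_module (tgwa A)))"
    by (simp add: subgroup_def m_inv_def regular_module_def)
  moreover have "a \<otimes>\<^bsub>tgwa A\<^esub> x \<in> verma_ideal A \<mu>" if a: "a \<in> carrier (tgwa A)" and "x \<in> verma_ideal A \<mu>" for a x
  proof -
    obtain y z where yz: "y \<in> ?I" "z \<in> ?J" "x = y \<oplus>\<^bsub>tgwa A\<^esub> z"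
      using \<open>x \<in> verma_ideal A \<mu>\<close> by (auto simp: verma_ideal_def set_add_def')
    then have "y \<in> carrier (tgwa A)" "z \<in> carrier (tgwa A)"
      using subgroup.subset[OF I(1)] subgroup.subset[OF J(1)] by auto
    then have "a \<otimes>\<^bsub>tgwa A\<^esub> x = (a \<otimes>\<^bsub>tgwa A\<^esub> y) \<oplus>\<^bsub>tgwa A\<^esub> (a \<otimes>\<^bsub>tgwa A\<^esub> z)"
      using a by (simp add: yz R.r_distr)
    moreover have "a \<otimes>\<^bsub>tgwa A\<^esub> y \<in> ?I" "a \<otimes>\<^bsub>tgwa A\<^esub> z \<in> ?J"
      using I(2) J(2) a yz by auto
    ultimately show ?thesis unfolding verma_ideal_def set_add_def' by blast
  qed
  ultimately show ?thesis
    by (intro left_submodule.intro left_submodule_axioms.intro regular_left_module tgwa_ring)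
      (simp_all add: regular_module_def)
qed

lemma verma_ideal_generators:
  assumes "weight A \<mu>"
  shows "tgwa_u A \<in> verma_ideal A \<mu>" and "\<mu> h = 0 \<Longrightarrow> tgwa_base A h \<in> verma_ideal A \<mu>"
proof -
  interpret R: ring "tgwa A" by (rule tgwa_ring)
  have gens: "{tgwa_u A} \<subseteq> carrier (tgwa A)" "tgwa_base A ` {h. \<mu> h = 0} \<subseteq> carrier (tgwa A)"
    by (auto simp: tgwa_u_def tgwa_base_def)
  note I = left_multiples_submodule[OF tgwa_ring gens(1)]
  note J = left_multiples_submodule[OF tgwa_ring gens(2)]
  have zeros: "\<zero>\<^bsub>tgwa A\<^esub> \<in> left_multiples (tgwa A) {tgwa_u A}"
    "\<zero>\<^bsub>tgwa A\<^esub> \<in> left_multiples (tgwa A) (tgwa_base A ` {h. \<mu> h = 0})"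
    using subgroup.one_closed[OF I(1)] subgroup.one_closed[OF J(1)] by simp_all
  moreover have "tgwa_u A \<in> left_multiples (tgwa A) {tgwa_u A}" using I(3) by simp
  ultimately have "tgwa_u A \<oplus>\<^bsub>tgwa A\<^esub> \<zero>\<^bsub>tgwa A\<^esub> \<in> verma_ideal A \<mu>"
    unfolding verma_ideal_def set_add_def' by blast
  then show "tgwa_u A \<in> verma_ideal A \<mu>" using gens by simp
  assume "\<mu> h = 0"
  then have "tgwa_base A h \<in> left_multiples (tgwa A) (tgwa_base A ` {h. \<mu> h = 0})" using J(3) by blast
  then have "\<zero>\<^bsub>tgwa A\<^esub> \<oplus>\<^bsub>tgwa A\<^esub> tgwa_base A h \<in> verma_ideal A \<mu>"
    unfolding verma_ideal_def set_add_def' using zeros by blast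
  then show "tgwa_base A h \<in> verma_ideal A \<mu>" by (simp add: tgwa_base_def)
qed

context tgwa_module
begin

lemma highest_weight_vector_exists:
  assumes "highest_weight_module A \<mu> V"
  obtains w where "highest_weight_vector A V \<mu> w"
proof -
  have weight: "weight A \<mu>" using assms by (simp add: highest_weight_module_def)
  obtain \<pi> where \<pi>: "\<pi> \<in> left_module_hom (tgwa A) (verma A \<mu>) V" "\<pi> ` carrier (verma A \<mu>) = carrier V"
    using assms by (auto simp: highest_weight_module_def)
  interpret N: left_submodule "tgwa A" "regular_module (tgwa A)" "verma_ideal A \<mu>"
    by (rule verma_left_submodule[OF weight])
  let ?c = "\<lambda>x. verma_ideal A \<mu> +>\<^bsub>regular_module (tgwa A)\<^esub> tgwa_class A x"
  have reg: "carrier (regular_module (tgwa A)) = carrier (tgwa A)"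
      "smult (regular_module (tgwa A)) = mult (tgwa A)" "add (regular_module (tgwa A)) = add (tgwa A)"
      "zero (regular_module (tgwa A)) = zero (tgwa A)"
    by (simp_all add: regular_module_def)
  have reg_inv: "\<ominus>\<^bsub>regular_module (tgwa A)\<^esub> x = \<ominus>\<^bsub>tgwa A\<^esub> x" for x
    by (simp add: a_inv_def m_inv_def reg)
  define w where "w = \<pi> (?c 1)"
  have closed: "?c x \<in> carrier (verma A \<mu>)" for x
    unfolding verma_def N.quot_carrier reg by auto
  have act: "act x w = \<pi> (?c x)" for x
  proof -
    have "act x w = \<pi> (tgwa_class A x \<odot>\<^bsub>verma A \<mu>\<^esub> ?c 1)"
      using \<pi>(1) closed by (simp add: act_def w_def left_module_hom_def)
    also have "tgwa_class A x \<odot>\<^bsub>verma A \<mu>\<^esub> ?c 1 = ?c x"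
      unfolding verma_def by (subst N.quot_smult) (simp_all add: reg tgwa_class_mult)
    finally show ?thesis .
  qed
  have eq: "act x w = act y w" if "tgwa_class A (x - y) \<in> verma_ideal A \<mu>" for x y
  proof -
    have "?c x = ?c y"
      using that N.coset_eq_iff[of "tgwa_class A x" "tgwa_class A y"]
      by (simp add: reg reg_inv tgwa_class_uminus tgwa_class_add)
    then show ?thesis by (simp add: act)
  qed
  have w: "w \<in> carrier V" using \<pi>(2) closed unfolding w_def by blast
  have "highest_weight_vector A V \<mu> w"
  proof
    show "act (free_gen Up) w = \<zero>\<^bsub>V\<^esub>"
      using eq[of "free_gen Up" 0] verma_ideal_generators(1)[OF weight] act_zero[OF w]
      by (simp add: tgwa_u_def)
    show "act (free_gen (Base h)) w = act (free_scalar (\<mu> h)) w" for h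
    proof (rule eq)
      let ?c = "\<mu> h"
      have "tgwa_eq A (free_gen (Base (h + scalar_map A (- ?c)))) (free_gen (Base h) + free_scalar (- ?c))"
        by (rule tgwa_eq_trans[OF tgwa_eq_base_add tgwa_eq_add[OF tgwa_eq_refl tgwa_eq_base_scalar]])
      then have "tgwa_class A (free_gen (Base h) - free_scalar ?c) = tgwa_base A (h + scalar_map A (- ?c))"
        by (simp add: tgwa_base_def tgwa_class_eq_iff free_scalar_uminus tgwa_eq_sym)
      moreover have "\<mu> (h + scalar_map A (- ?c)) = 0"
        using weight by (simp add: weight_def)
      ultimately show "tgwa_class A (free_gen (Base h) - free_scalar ?c) \<in> verma_ideal A \<mu>"
        using verma_ideal_generators(2)[OF weight] by simp
    qed
    show "\<exists>x. m = act x w" if m: "m \<in> carrier V" for m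
    proof -
      obtain X where X: "X \<in> carrier (verma A \<mu>)" "m = \<pi> X" using m \<pi>(2) by blast
      then obtain x where "X = ?c x"
        unfolding verma_def N.quot_carrier reg tgwa_carrier by auto
      then show ?thesis using X act by metis
    qed
  qed (use weight w in auto)
  then show ?thesis using that by blast
qed

end

lemma (in highest_weight_vector) highest_weight_module:
  assumes "v \<noteq> \<zero>\<^bsub>V\<^esub>"
  shows "highest_weight_module A \<mu> V"
proof -
  interpret N: left_submodule "tgwa A" "regular_module (tgwa A)" "verma_ideal A \<mu>"
    by (rule verma_left_submodule[OF is_weight])
  interpret R: ring "tgwa A" by (rule tgwa_ring)
  have reg: "carrier (regular_module (tgwa A)) = carrier (tgwa A)"
      "smult (regular_module (tgwa A)) = mult (tgwa A)" "add (regular_module (tgwa A)) = add (tgwa A)"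
    by (simp_all add: regular_module_def)
  let ?K = "{X \<in> carrier (tgwa A). X \<odot>\<^bsub>V\<^esub> v = \<zero>\<^bsub>V\<^esub>}"
  have K: "subgroup ?K (add_monoid (tgwa A))"
    by (rule V.R.add.subgroupI)
      (use vector in \<open>auto simp: V.smult_l_null V.smult_l_minus V.smult_l_distr\<close>)
  have K': "a \<otimes>\<^bsub>tgwa A\<^esub> X \<in> ?K" if "a \<in> carrier (tgwa A)" "X \<in> ?K" for a X
    using that vector by (simp add: V.smult_assoc V.smult_r_null)
  have IK: "left_multiples (tgwa A) {tgwa_u A} \<subseteq> ?K"
    by (rule left_multiples_minimal[OF tgwa_ring _ K K'])
      (use up_vector in \<open>auto simp: tgwa_u_def act_def\<close>)
  have JK: "left_multiples (tgwa A) (tgwa_base A ` {h. \<mu> h = 0}) \<subseteq> ?K"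
  proof (rule left_multiples_minimal[OF tgwa_ring _ K K'])
    have "tgwa_base A h \<in> ?K" if "\<mu> h = 0" for h
      using base_vector[of h] act_zero[OF vector] that by (simp add: tgwa_base_def act_def free_scalar_zero)
    then show "tgwa_base A ` {h. \<mu> h = 0} \<subseteq> ?K" by blast
  qed
  have kills: "X \<odot>\<^bsub>V\<^esub> v = \<zero>\<^bsub>V\<^esub>" if X: "X \<in> verma_ideal A \<mu>" for X
  proof -
    obtain Y Z where "X = Y \<oplus>\<^bsub>tgwa A\<^esub> Z" "Y \<in> left_multiples (tgwa A) {tgwa_u A}"
        "Z \<in> left_multiples (tgwa A) (tgwa_base A ` {h. \<mu> h = 0})"
      using X unfolding verma_ideal_def set_add_def' by blast
    then have "X = Y \<oplus>\<^bsub>tgwa A\<^esub> Z" "Y \<in> ?K" "Z \<in> ?K"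
      using IK JK by blast+
    then show ?thesis by (simp add: V.smult_l_distr vector)
  qed
  define \<pi> where "\<pi> X = the_elem ((\<lambda>x. x \<odot>\<^bsub>V\<^esub> v) ` X)" for X
  have \<pi>: "\<pi> (verma_ideal A \<mu> +>\<^bsub>regular_module (tgwa A)\<^esub> X) = X \<odot>\<^bsub>V\<^esub> v"
    if X: "X \<in> carrier (tgwa A)" for X
  proof -
    have "Y \<odot>\<^bsub>V\<^esub> v = X \<odot>\<^bsub>V\<^esub> v" if "Y \<in> verma_ideal A \<mu> +>\<^bsub>regular_module (tgwa A)\<^esub> X" for Y
    proof -
      obtain Z where Z: "Z \<in> verma_ideal A \<mu>" "Y = Z \<oplus>\<^bsub>tgwa A\<^esub> X"
        using \<open>Y \<in> _\<close> by (auto simp: a_r_coset_def' reg)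
      then have "Z \<in> carrier (tgwa A)" using N.mem_carrier reg by simp
      then show ?thesis using Z X vector by (simp add: V.smult_l_distr kills V.smult_closed)
    qed
    moreover have "X \<in> verma_ideal A \<mu> +>\<^bsub>regular_module (tgwa A)\<^esub> X"
      using X by (intro N.sub.a_rcos_self) (simp add: reg)
    ultimately have "(\<lambda>x. x \<odot>\<^bsub>V\<^esub> v) ` (verma_ideal A \<mu> +>\<^bsub>regular_module (tgwa A)\<^esub> X) = {X \<odot>\<^bsub>V\<^esub> v}"
      by blast
    then show ?thesis by (simp add: \<pi>_def)
  qed
  have "\<pi> \<in> left_module_hom (tgwa A) (verma A \<mu>) V"
    unfolding left_module_hom_def verma_def N.quot_carrier reg
    using vector
    by (auto simp: \<pi> N.quot_add N.quot_smult reg V.smult_closed V.smult_l_distr V.smult_assoc)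
  moreover have "\<pi> ` carrier (verma A \<mu>) = carrier V"
  proof (intro equalityI subsetI)
    fix m assume "m \<in> carrier V"
    then obtain x where "m = act x v" using cyclic by blast
    then have "m = \<pi> (verma_ideal A \<mu> +>\<^bsub>regular_module (tgwa A)\<^esub> tgwa_class A x)"
      by (simp add: \<pi> act_def)
    moreover have "verma_ideal A \<mu> +>\<^bsub>regular_module (tgwa A)\<^esub> tgwa_class A x \<in> carrier (verma A \<mu>)"
      unfolding verma_def N.quot_carrier reg using tgwa_class_closed by blast
    ultimately show "m \<in> \<pi> ` carrier (verma A \<mu>)" by blast
  qed (use \<open>\<pi> \<in> left_module_hom _ _ _\<close> in \<open>auto simp: left_module_hom_def\<close>)
  ultimately show ?thesis
    using assms vector is_weight V.left_module_axioms unfolding highest_weight_module_def by blast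
qed


section \<open>The classical limit of a highest weight module\<close>

context classical_limit
begin

text \<open>The weights \<open>K \<mapsto> q^(- l i) \<kappa>\<close> are pairwise distinct.\<close>

lemma separated_Wq:
  assumes "\<kappa> \<noteq> 0"
  shows "\<exists>h. inj (\<lambda>i. laurent_eval \<kappa> ((endo Wq ^^ i) h))"
proof (intro exI injI)
  let ?c = "(qvar :: 'a ratfun) powi (- l)"
  have q0: "(qvar :: 'a ratfun) \<noteq> 0" using has_value_nonzero[OF has_value_qvar] by simp
  have pow: "(endo Wq ^^ i) (Kpow 1) = laurent_const (?c ^ i) * Kpow 1" for i
  proof (induction i)
    case (Suc i)
    have "?c \<noteq> 0" using q0 by simp
    then show ?case
      using Suc by (simp add: Wq_data_def laurent_rescale_mult laurent_rescale_const
          laurent_rescale_Kpow laurent_const_mult mult_ac)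
  qed (simp add: laurent_const_one)
  have eval: "laurent_eval \<kappa> ((endo Wq ^^ i) (Kpow 1)) = ?c ^ i * \<kappa>" for i
    by (simp add: pow laurent_eval_mult[OF assms] laurent_eval_const laurent_eval_Kpow)
  fix i j assume "laurent_eval \<kappa> ((endo Wq ^^ i) (Kpow 1)) = laurent_eval \<kappa> ((endo Wq ^^ j) (Kpow 1))"
  then have "?c ^ i = ?c ^ j" using assms by (simp only: eval mult_cancel_right) simp
  then have "qvar powi (- l * int i) = (qvar :: 'a ratfun) powi (- l * int j)"
    by (simp only: power_int_power')
  moreover have "(qvar :: 'a ratfun) powi (- l * int i - - l * int j)
      = qvar powi (- l * int i) / qvar powi (- l * int j)"
    using q0 by (intro power_int_diff) simp
  ultimately have "qvar powi (- l * int i - - l * int j) = (1 :: 'a ratfun)"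
    using q0 by (simp only: divide_self_if power_int_eq_0_iff) simp
  then have "- l * int i - - l * int j = 0" by (simp only: qvar_power_int_eq_one_iff)
  then show "i = j" using l_nonzero by (simp add: algebra_simps)
qed

text \<open>The weights \<open>h \<mapsto> a + i \<gamma>\<close> are pairwise distinct.\<close>

lemma separated_Wc: "\<exists>g. inj (\<lambda>i. poly ((endo Wc ^^ i) g) a)"
proof (intro exI injI)
  have pow: "(endo Wc ^^ i) [:0, 1:] = [:of_nat i * \<gamma>, 1:]" for i
    by (induction i) (simp_all add: Wclassical_data_def pcompose_pCons algebra_simps)
  fix i j assume "poly ((endo Wc ^^ i) [:0, 1:]) a = poly ((endo Wc ^^ j) [:0, 1:]) a"
  then show "i = j" using gamma_nonzero by (simp add: pow)
qed

end

text \<open>A nonzero module over the algebra over \<open>F(q)\<close> with highest weight vector \<open>v\<close>, whose highest weight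
  \<open>K \<mapsto> \<kappa>\<close> specialises at \<open>q = 1\<close>.  Below, \<open>L\<close> is the lattice generated by \<open>v\<close>, and \<open>N = (q - 1) L\<close>.\<close>

locale limit_module = classical_limit \<gamma> l s f m n
    + VQ: separated_highest_weight_vector "Wq_data \<gamma> s f l m n" V "laurent_eval \<kappa>" v
  for \<gamma> :: "'a::field_char_0" and l s f m n
    and V :: "(('a ratfun, 'a ratfun laurent) tgwa_elem, 'v) module" and \<kappa> v +
  assumes kappa_nonzero: "\<kappa> \<noteq> 0" and kappa_regular: "(\<kappa> - 1) / (qvar - 1) \<in> regular_at_one"
    and v_nonzero: "v \<noteq> \<zero>\<^bsub>V\<^esub>"
begin

abbreviation "L \<equiv> R_lattice Wq V v"

abbreviation "N \<equiv> {tgwa_scalar Wq (qvar - 1) \<odot>\<^bsub>V\<^esub> x | x. x \<in> L}"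

text \<open>The highest weight of the limit.\<close>

definition limit_weight :: "'a poly \<Rightarrow> 'a" where
  "limit_weight p = poly p (- \<gamma> / of_int l * value_at_one ((\<kappa> - 1) / (qvar - 1)))"

text \<open>The reduction \<open>L / (q - 1) L\<close>, as a module over the classical algebra through the isomorphism
  \<^const>\<open>limit_iso\<close>.\<close>

definition V1 :: "(('a, 'a poly) tgwa_elem, 'v set) module" where
  "V1 = pullback_module (inv_into (carrier (W_one Wq)) limit_iso) (V_one Wq V v)"

lemma reduces_weight: "reduces \<gamma> l h g \<Longrightarrow> has_value (laurent_eval \<kappa> h) (limit_weight g)"
  unfolding limit_weight_def
  using reduces_eval kappa_nonzero has_value_value_at_one[OF kappa_regular] by blast

lemma L_eq: "L = {VQ.act x v | x. \<exists>y. limit_rel x y}"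
  unfolding R_lattice_def R_form_carrier VQ.act_def by blast

lemma N_eq: "N = {VQ.act (free_scalar (qvar - 1)) (VQ.act x v) | x. \<exists>y. limit_rel x y}"
  unfolding L_eq VQ.act_def tgwa_scalar_def by blast

lemma L_subset: "L \<subseteq> carrier V"
  unfolding L_eq using VQ.vector by auto

lemma N_subset: "N \<subseteq> L"
proof
  fix z assume "z \<in> N"
  then obtain x y where x: "z = VQ.act (free_scalar (qvar - 1)) (VQ.act x v)" "limit_rel x y"
    unfolding N_eq by blast
  then have "z = VQ.act (free_scalar (qvar - 1) * x) v" by (simp add: VQ.act_mult VQ.vector)
  moreover have "limit_rel (free_scalar (qvar - 1) * x) (free_scalar 0 * y)"
    by (rule limit_rel_mult[OF limit_rel_scalar[OF has_value_qvar_minus_one] x(2)])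
  ultimately show "z \<in> L" unfolding L_eq by blast
qed

lemma lattice_subgroup: "subgroup L (add_monoid V)"
proof (rule VQ.V.M.add.subgroupI)
  show "L \<noteq> {}" using limit_rel_one unfolding L_eq by blast
  show "\<ominus>\<^bsub>V\<^esub> x \<in> L" if "x \<in> L" for x
    using that limit_rel_uminus VQ.act_uminus[OF VQ.vector] unfolding L_eq by (smt (verit) mem_Collect_eq)
  show "x \<oplus>\<^bsub>V\<^esub> y \<in> L" if "x \<in> L" "y \<in> L" for x y
    using that limit_rel_add VQ.act_add[OF VQ.vector] unfolding L_eq by (smt (verit) mem_Collect_eq)
qed (rule L_subset)

lemma lattice_smult:
  assumes "X \<in> carrier (R_form Wq)" "z \<in> L"
  shows "X \<odot>\<^bsub>V\<^esub> z \<in> L"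
proof -
  obtain x y where x: "X = tgwa_class Wq x" "limit_rel x y" using assms(1) by (rule R_form_elemE)
  obtain x' y' where x': "z = VQ.act x' v" "limit_rel x' y'" using assms(2) unfolding L_eq by blast
  have "X \<odot>\<^bsub>V\<^esub> z = VQ.act x z" by (simp add: x VQ.act_def)
  then have "X \<odot>\<^bsub>V\<^esub> z = VQ.act (x * x') v" by (simp add: x' VQ.act_mult VQ.vector)
  then show ?thesis using limit_rel_mult[OF x(2) x'(2)] unfolding L_eq by blast
qed

sublocale LL: left_module "R_form Wq" "submodule_on V L"
  unfolding R_form_def
  by (rule VQ.V.restrict_left_module[OF _ lattice_subgroup])
    (use lattice_smult ring.generate_ring_is_subring[OF tgwa_ring R_generators_subset] in
      \<open>simp_all add: R_form_carrier_def\<close>)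

lemma LL_simps: "carrier (submodule_on V L) = L" "add (submodule_on V L) = add V"
  "zero (submodule_on V L) = zero V" "smult (submodule_on V L) = smult V"
  by (simp_all add: submodule_on_def)

lemma LL_uminus:
  assumes "x \<in> L"
  shows "\<ominus>\<^bsub>submodule_on V L\<^esub> x = \<ominus>\<^bsub>V\<^esub> x"
proof (rule LL.M.minus_equality)
  show "\<ominus>\<^bsub>V\<^esub> x \<in> carrier (submodule_on V L)"
    using subgroup.m_inv_closed[OF lattice_subgroup assms] by (simp add: LL_simps a_inv_def)
  show "\<ominus>\<^bsub>V\<^esub> x \<oplus>\<^bsub>submodule_on V L\<^esub> x = \<zero>\<^bsub>submodule_on V L\<^esub>"
    using assms L_subset by (auto simp: LL_simps VQ.V.M.l_neg)
qed (simp add: LL_simps assms)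

sublocale LN: left_submodule "R_form Wq" "submodule_on V L" N
proof (intro left_submodule.intro left_submodule_axioms.intro LL.left_module_axioms)
  show "subgroup N (add_monoid (submodule_on V L))"
  proof (rule LL.M.add.subgroupI)
    show "N \<subseteq> carrier (submodule_on V L)" using N_subset by (simp add: LL_simps)
    show "N \<noteq> {}" using limit_rel_one unfolding N_eq by blast
    fix z assume z: "z \<in> N"
    then obtain x y where x: "z = VQ.act (free_scalar (qvar - 1)) (VQ.act x v)" "limit_rel x y"
      unfolding N_eq by blast
    have "\<ominus>\<^bsub>submodule_on V L\<^esub> z = \<ominus>\<^bsub>V\<^esub> z" using z N_subset LL_uminus by blast
    also have "\<dots> = VQ.act (free_scalar (qvar - 1)) (VQ.act (- x) v)"
      by (simp add: x VQ.vector flip: VQ.act_mult VQ.act_uminus)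
    finally show "\<ominus>\<^bsub>submodule_on V L\<^esub> z \<in> N"
      unfolding N_eq using limit_rel_uminus[OF x(2)] by blast
    fix z' assume "z' \<in> N"
    then obtain x' y' where x': "z' = VQ.act (free_scalar (qvar - 1)) (VQ.act x' v)" "limit_rel x' y'"
      unfolding N_eq by blast
    have "z \<oplus>\<^bsub>submodule_on V L\<^esub> z' = VQ.act (free_scalar (qvar - 1)) (VQ.act (x + x') v)"
      by (simp add: LL_simps x x' VQ.vector VQ.act_add VQ.act_add_right)
    then show "z \<oplus>\<^bsub>submodule_on V L\<^esub> z' \<in> N"
      unfolding N_eq using limit_rel_add[OF x(2) x'(2)] by blast
  qed
  fix X z assume X: "X \<in> carrier (R_form Wq)" and "z \<in> N"
  then obtain x y where x: "z = VQ.act (free_scalar (qvar - 1)) (VQ.act x v)" "limit_rel x y"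
    unfolding N_eq by blast
  obtain x' y' where x': "X = tgwa_class Wq x'" "limit_rel x' y'" using X by (rule R_form_elemE)
  have "X \<odot>\<^bsub>V\<^esub> z = VQ.act x' z" by (simp add: x' VQ.act_def)
  also have "\<dots> = VQ.act (free_scalar (qvar - 1)) (VQ.act (x' * x) v)"
    by (simp add: x VQ.vector VQ.act_mult VQ.act_scalar_commute)
  finally show "X \<odot>\<^bsub>submodule_on V L\<^esub> z \<in> N"
    unfolding N_eq LL_simps using limit_rel_mult[OF x'(2) x(2)] by blast
qed

text \<open>The class in \<open>L / (q - 1) L\<close> of the vector \<open>x v\<close>, for \<open>x\<close> with a reduction.\<close>

abbreviation coset where "coset x \<equiv> N +>\<^bsub>submodule_on V L\<^esub> VQ.act x v"

lemma limit_rel_lattice: "limit_rel x y \<Longrightarrow> VQ.act x v \<in> L"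
  unfolding L_eq by blast

lemma coset_eq_iff:
  assumes "limit_rel x y" "limit_rel x' y'"
  shows "coset x = coset x' \<longleftrightarrow> VQ.act (x - x') v \<in> N"
  using LN.coset_eq_iff[of "VQ.act x v" "VQ.act x' v"] limit_rel_lattice[OF assms(1)]
    limit_rel_lattice[OF assms(2)]
  by (simp add: LL_simps LL_uminus VQ.act_diff VQ.vector)

lemma q_minus_one_kills:
  assumes "X \<in> q_minus_one_ideal Wq" "Z \<in> carrier (quot_module (submodule_on V L) N)"
  shows "X \<odot>\<^bsub>quot_module (submodule_on V L) N\<^esub> Z = \<zero>\<^bsub>quot_module (submodule_on V L) N\<^esub>"
proof -
  obtain Y where Y: "X = tgwa_scalar Wq (qvar - 1) \<otimes>\<^bsub>tgwa Wq\<^esub> Y" "Y \<in> carrier (R_form Wq)"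
    using assms(1) unfolding q_minus_one_ideal_def by blast
  have "tgwa_scalar Wq (qvar - 1) \<in> carrier (R_form Wq)"
    unfolding tgwa_scalar_def by (rule limit_rel_R_form[OF limit_rel_scalar[OF has_value_qvar_minus_one]])
  then have X: "X \<in> carrier (R_form Wq)"
    using Y LL.R.m_closed[of "tgwa_scalar Wq (qvar - 1)" Y] by simp
  obtain z where z: "z \<in> L" "Z = N +>\<^bsub>submodule_on V L\<^esub> z"
    using assms(2) unfolding LN.quot_carrier LL_simps by blast
  have "X \<odot>\<^bsub>V\<^esub> z = tgwa_scalar Wq (qvar - 1) \<odot>\<^bsub>V\<^esub> (Y \<odot>\<^bsub>V\<^esub> z)"
    using Y R_form_subset z L_subset
    by (auto simp: tgwa_scalar_def intro!: VQ.V.smult_assoc)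
  then have "X \<odot>\<^bsub>V\<^esub> z \<in> N" using lattice_smult[OF Y(2) z(1)] by blast
  then have "N +>\<^bsub>submodule_on V L\<^esub> (X \<odot>\<^bsub>V\<^esub> z) = N" by (rule LN.sub.a_rcos_const)
  then show ?thesis
    using LN.quot_smult[OF X, of z] z by (simp add: LL_simps quot_module_def)
qed

lemma q_minus_one_ideal_ideal: "ideal (q_minus_one_ideal Wq) (R_form Wq)"
  using ring_hom_ring.kernel_is_ideal[OF limit_map_hom] by (simp add: limit_map_kernel)

lemma V_one_left_module: "left_module (W_one Wq) (V_one Wq V v)"
  unfolding W_one_def V_one_def
  by (rule descend_left_module[OF LN.quot_left_module q_minus_one_ideal_ideal q_minus_one_kills])

sublocale V1: tgwa_module Wc V1
proof -
  have "inv_into (carrier (W_one Wq)) limit_iso \<in> Ring.ring_hom (tgwa Wc) (W_one Wq)"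
    using ring_iso_set_sym[OF left_module.axioms(1)[OF V_one_left_module] limit_iso_ring_iso]
    by (simp add: ring_iso_def)
  then show "tgwa_module Wc V1"
    unfolding V1_def
    by (intro tgwa_module.intro tgwa_basis_Wclassical pullback_left_module[OF V_one_left_module tgwa_ring])
qed

lemma V1_carrier: "carrier V1 = {coset x | x. \<exists>y. limit_rel x y}"
proof -
  have "carrier V1 = carrier (quot_module (submodule_on V L) N)"
    by (simp add: V1_def V_one_def pullback_module_def descend_module_def)
  then show ?thesis unfolding LN.quot_carrier LL_simps unfolding L_eq by blast
qed

lemma V1_zero: "\<zero>\<^bsub>V1\<^esub> = coset 0"
proof -
  have "\<zero>\<^bsub>V1\<^esub> = \<zero>\<^bsub>quot_module (submodule_on V L) N\<^esub>"
    by (simp add: V1_def V_one_def pullback_module_def descend_module_def)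
  then show ?thesis by (simp add: LN.quot_zero LL_simps VQ.act_zero VQ.vector)
qed

text \<open>The action on the limit module is computed by any \<open>x\<close> that reduces to \<open>y\<close>.\<close>

lemma V1_act:
  assumes "limit_rel x y" "limit_rel x' y'"
  shows "V1.act y (coset x') = coset (x * x')"
proof -
  let ?M = "quot_module (submodule_on V L) N"
  have mem: "coset x' \<in> carrier ?M"
    unfolding LN.quot_carrier LL_simps using limit_rel_lattice[OF assms(2)] by blast
  have "V1.act y (coset x') = W_one_class Wq (tgwa_class Wq x) \<odot>\<^bsub>V_one Wq V v\<^esub> coset x'"
    unfolding V1.act_def by (simp add: V1_def pullback_module_def limit_iso_inverse[OF assms(1)])
  also have "\<dots> = tgwa_class Wq x \<odot>\<^bsub>?M\<^esub> coset x'"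
    unfolding W_one_class_def V_one_def
    by (rule descend_smult[OF LN.quot_left_module q_minus_one_ideal_ideal q_minus_one_kills])
      (use mem limit_rel_R_form[OF assms(1)] in auto)
  also have "\<dots> = N +>\<^bsub>submodule_on V L\<^esub> (tgwa_class Wq x \<odot>\<^bsub>V\<^esub> VQ.act x' v)"
    using LN.quot_smult[OF limit_rel_R_form[OF assms(1)]] limit_rel_lattice[OF assms(2)]
    by (simp add: LL_simps)
  also have "tgwa_class Wq x \<odot>\<^bsub>V\<^esub> VQ.act x' v = VQ.act (x * x') v"
    by (simp only: VQ.act_mult[OF VQ.vector]) (simp only: VQ.act_def)
  finally show ?thesis .
qed

lemma V1_act_one: "limit_rel x y \<Longrightarrow> V1.act y (coset 1) = coset x"
  using V1_act[OF _ limit_rel_one, of x y] by simp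

lemma V1_highest_weight_vector: "separated_highest_weight_vector Wc V1 limit_weight (coset 1)"
proof
  show "weight Wc limit_weight"
    by (simp add: weight_def limit_weight_def Wclassical_data_def)
  show "coset 1 \<in> carrier V1" unfolding V1_carrier using limit_rel_one by blast
  have "VQ.act (free_gen Up - 0) v \<in> N"
    using VQ.up_vector LN.sub.zero_closed by (simp add: LL_simps)
  then show "V1.act (free_gen Up) (coset 1) = \<zero>\<^bsub>V1\<^esub>"
    using coset_eq_iff[OF limit_rel_up limit_rel_zero] by (simp add: V1_act_one[OF limit_rel_up] V1_zero)
  show "V1.act (free_gen (Base g)) (coset 1) = V1.act (free_scalar (limit_weight g)) (coset 1)" for g
  proof -
    let ?h = "lift_poly \<gamma> l g" and ?r = "ratfun_const (limit_weight g)"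
    have b: "limit_rel (free_gen (Base ?h)) (free_gen (Base g))"
      by (rule limit_rel_base[OF reduces_lift_poly])
    have c: "limit_rel (free_scalar ?r) (free_scalar (limit_weight g))"
      by (rule limit_rel_scalar[OF has_value_const])
    have "has_value (laurent_eval \<kappa> ?h - ?r) 0"
      using has_value_diff[OF reduces_weight[OF reduces_lift_poly[of g]] has_value_const[of "limit_weight g"]]
      by simp
    then obtain y d where y: "has_value y d" "laurent_eval \<kappa> ?h - ?r = (qvar - 1) * y"
      by (rule has_value_zeroE)
    have "VQ.act (free_gen (Base ?h) - free_scalar ?r) v = VQ.act (free_scalar (laurent_eval \<kappa> ?h - ?r)) v"
      by (simp add: VQ.act_diff VQ.vector VQ.base_vector free_scalar_diff)
    also have "\<dots> = VQ.act (free_scalar (qvar - 1)) (VQ.act (free_scalar y) v)"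
      by (simp add: y(2) free_scalar_mult VQ.act_mult VQ.vector)
    also have "\<dots> \<in> N" unfolding N_eq using limit_rel_scalar[OF y(1)] by blast
    finally show ?thesis
      using coset_eq_iff[OF b c] by (simp add: V1_act_one[OF b] V1_act_one[OF c])
  qed
  show "\<exists>y. m = V1.act y (coset 1)" if "m \<in> carrier V1" for m
    using that V1_act_one unfolding V1_carrier by blast
  show "\<exists>g. inj (\<lambda>i. limit_weight ((endo Wc ^^ i) g))"
    unfolding limit_weight_def by (rule separated_Wc)
qed

sublocale VC: separated_highest_weight_vector Wc V1 limit_weight "coset 1"
  by (rule V1_highest_weight_vector)

text \<open>A vector \<open>D^k v\<close> in \<open>(q - 1) L\<close> equals \<open>(q - 1) r D^k v\<close> with \<open>r\<close> regular at \<open>1\<close>, by comparing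
  components of equal weight.  As \<open>1 - (q - 1) r\<close> is invertible, the vector vanishes.\<close>

lemma down_zero_iff:
  "V1.act (free_gen Down ^ k) (coset 1) = \<zero>\<^bsub>V1\<^esub> \<longleftrightarrow> VQ.act (free_gen Down ^ k) v = \<zero>\<^bsub>V\<^esub>"
proof -
  let ?w = "VQ.act (free_gen Down ^ k) v"
  have "V1.act (free_gen Down ^ k) (coset 1) = \<zero>\<^bsub>V1\<^esub> \<longleftrightarrow> ?w \<in> N"
    using coset_eq_iff[OF limit_rel_power[OF limit_rel_down] limit_rel_zero]
    by (simp add: V1_act_one[OF limit_rel_power[OF limit_rel_down]] V1_zero)
  also have "\<dots> \<longleftrightarrow> ?w = \<zero>\<^bsub>V\<^esub>"
  proof
    assume "?w = \<zero>\<^bsub>V\<^esub>"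
    then show "?w \<in> N" using LN.sub.zero_closed by (simp add: LL_simps)
  next
    assume "?w \<in> N"
    then obtain x y where x: "?w = VQ.act (free_scalar (qvar - 1)) (VQ.act x v)" "limit_rel x y"
      unfolding N_eq by blast
    let ?x = "free_scalar (qvar - 1) * x"
    have w: "?w = VQ.act ?x v" by (simp add: x(1) VQ.act_mult VQ.vector)
    have "VQ.act ?x v \<in> weight_space Wq V (laurent_eval \<kappa> \<circ> (endo Wq ^^ k))"
      using VQ.down_weight_space[of k] by (simp add: w)
    then have "?w = VQ.act (free_scalar (laurent_eval \<kappa> (Q.pbw_coeffs ?x k 0))) ?w"
      using VQ.weight_component[of ?x k] by (simp only: w)
    moreover define r where "r = laurent_eval \<kappa> (Q.pbw_coeffs ?x k 0)"
    moreover have "has_value r 0"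
    proof -
      have "reduces \<gamma> l (Q.pbw_coeffs ?x k 0) (C.pbw_coeffs (free_scalar 0 * y) k 0)"
        by (rule limit_rel_pbw_coeffs[OF limit_rel_mult[OF
              limit_rel_scalar[OF has_value_qvar_minus_one] x(2)]])
      moreover have "C.pbw_coeffs (free_scalar 0 * y) k 0 = 0"
        by (simp add: free_scalar_zero C.pbw_coeffs_def C.free_act_zero)
      ultimately show ?thesis using reduces_weight[of _ 0] by (simp add: r_def limit_weight_def)
    qed
    ultimately have r: "?w = VQ.act (free_scalar r) ?w" "has_value r 0" by auto
    have "1 - r \<noteq> 0"
      using has_value_nonzero[OF has_value_diff[OF has_value_one r(2)]] by simp
    have "VQ.act (free_scalar (1 - r)) ?w = ?w \<oplus>\<^bsub>V\<^esub> \<ominus>\<^bsub>V\<^esub> VQ.act (free_scalar r) ?w"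
      by (simp add: free_scalar_diff free_scalar_one VQ.act_diff VQ.act_one)
    also have "\<dots> = \<zero>\<^bsub>V\<^esub>" using VQ.down_closed[of k] by (simp add: VQ.V.M.r_neg flip: r(1))
    finally have zero: "VQ.act (free_scalar (1 - r)) ?w = \<zero>\<^bsub>V\<^esub>" .
    have "?w = VQ.act (free_scalar (inverse (1 - r) * (1 - r))) ?w"
      using \<open>1 - r \<noteq> 0\<close> by (simp add: free_scalar_one VQ.act_one)
    also have "\<dots> = VQ.act (free_scalar (inverse (1 - r))) (VQ.act (free_scalar (1 - r)) ?w)"
      by (simp add: free_scalar_mult VQ.act_mult)
    finally show "?w = \<zero>\<^bsub>V\<^esub>" by (simp add: zero VQ.act_zero_right)
  qed
  finally show ?thesis .
qed

lemma V1_highest_weight_module: "highest_weight_module Wc limit_weight V1"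
proof (rule VC.highest_weight_module)
  have "V1.act (free_gen Down ^ 0) (coset 1) = coset 1"
    using V1_act_one[OF limit_rel_one] by simp
  moreover have "VQ.act (free_gen Down ^ 0) v = v" by (simp add: VQ.act_one VQ.vector)
  ultimately show "coset 1 \<noteq> \<zero>\<^bsub>V1\<^esub>" using down_zero_iff[of 0] v_nonzero by simp
qed

lemma V1_same_graded_character: "same_graded_character Wq (laurent_eval \<kappa>) V Wc limit_weight V1"
  unfolding same_graded_character_def Let_def
  using VQ.weight_space_dim VC.weight_space_dim down_zero_iff by simp

end

theorem theorem8p19:
  fixes \<gamma> s :: "'a::field_char_0" and f :: "'a poly" and l m n :: int
  assumes "\<gamma> \<noteq> 0" and "s \<noteq> 0" and "\<forall>k::nat. 0 < k \<longrightarrow> s ^ k \<noteq> 1" and "l \<noteq> 0"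
  shows "\<exists>\<phi>. classical_limit_iso \<gamma> s f l m n \<phi>
    \<and> (\<forall>(\<kappa> :: 'a ratfun) (V :: (('a ratfun, 'a ratfun laurent) tgwa_elem, 'v) module) v.
          \<kappa> \<noteq> 0
        \<and> (\<kappa> - 1) / (qvar - 1) \<in> regular_at_one
        \<and> highest_weight_module (Wq_data \<gamma> s f l m n) (laurent_eval \<kappa>) V
        \<and> v \<in> weight_space (Wq_data \<gamma> s f l m n) V (laurent_eval \<kappa>)
        \<and> {x \<odot>\<^bsub>V\<^esub> v | x. x \<in> carrier (tgwa (Wq_data \<gamma> s f l m n))} = carrier V
        \<longrightarrow>
          (let V\<^sub>1 = pullback_module (inv_into (carrier (W_one (Wq_data \<gamma> s f l m n))) \<phi>)
                      (V_one (Wq_data \<gamma> s f l m n) V v);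
               \<mu>\<^sub>1 = (\<lambda>p. poly p (- \<gamma> / of_int l * value_at_one ((\<kappa> - 1) / (qvar - 1))))
           in highest_weight_module (Wclassical_data \<gamma> s f) \<mu>\<^sub>1 V\<^sub>1
            \<and> same_graded_character (Wq_data \<gamma> s f l m n) (laurent_eval \<kappa>) V
                (Wclassical_data \<gamma> s f) \<mu>\<^sub>1 V\<^sub>1))"
proof -
  interpret classical_limit \<gamma> l s f m n
    using assms by (intro classical_limit.intro limit_parameters.intro)
  show ?thesis
  proof (intro exI[of _ limit_iso] conjI allI impI)
    show "classical_limit_iso \<gamma> s f l m n limit_iso" by (rule limit_iso_classical_limit_iso)
    fix \<kappa> :: "'a ratfun" and V :: "(('a ratfun, 'a ratfun laurent) tgwa_elem, 'v) module" and v
    assume *: "\<kappa> \<noteq> 0 \<and> (\<kappa> - 1) / (qvar - 1) \<in> regular_at_one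
      \<and> highest_weight_module Wq (laurent_eval \<kappa>) V \<and> v \<in> weight_space Wq V (laurent_eval \<kappa>)
      \<and> {x \<odot>\<^bsub>V\<^esub> v | x. x \<in> carrier (tgwa Wq)} = carrier V"
    then have hw: "highest_weight_module Wq (laurent_eval \<kappa>) V"
      and v: "v \<in> weight_space Wq V (laurent_eval \<kappa>)"
      and gen: "{x \<odot>\<^bsub>V\<^esub> v | x. x \<in> carrier (tgwa Wq)} = carrier V" by auto
    interpret VM: tgwa_module Wq V
      using hw by (intro tgwa_module.intro tgwa_basis_Wq) (simp add: highest_weight_module_def)
    obtain w where "highest_weight_vector Wq V (laurent_eval \<kappa>) w"
      using VM.highest_weight_vector_exists[OF hw] by blast
    then have w: "separated_highest_weight_vector Wq V (laurent_eval \<kappa>) w"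
      using separated_Wq * by (intro separated_highest_weight_vector.intro
          separated_highest_weight_vector_axioms.intro) auto
    have cyclic: "\<exists>x. z = VM.act x v" if "z \<in> carrier V" for z
      using that unfolding gen[symmetric] tgwa_carrier VM.act_def by blast
    have "separated_highest_weight_vector Wq V (laurent_eval \<kappa>) v"
      by (rule separated_highest_weight_vector.other_highest_weight_vector[OF w v cyclic])
    moreover have "v \<noteq> \<zero>\<^bsub>V\<^esub>"
    proof
      assume "v = \<zero>\<^bsub>V\<^esub>"
      then have "carrier V \<subseteq> {\<zero>\<^bsub>V\<^esub>}" using cyclic VM.act_zero_right by auto
      then show False using hw VM.V.M.zero_closed by (auto simp: highest_weight_module_def)
    qed
    ultimately interpret limit_module \<gamma> l s f m n V \<kappa> v
      using * classical_limit_axioms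
      by (intro limit_module.intro limit_module_axioms.intro) auto
    show "let V\<^sub>1 = pullback_module (inv_into (carrier (W_one Wq)) limit_iso) (V_one Wq V v);
        \<mu>\<^sub>1 = (\<lambda>p. poly p (- \<gamma> / of_int l * value_at_one ((\<kappa> - 1) / (qvar - 1))))
      in highest_weight_module Wc \<mu>\<^sub>1 V\<^sub>1 \<and> same_graded_character Wq (laurent_eval \<kappa>) V Wc \<mu>\<^sub>1 V\<^sub>1"
      using V1_highest_weight_module V1_same_graded_character
      unfolding Let_def V1_def limit_weight_def[abs_def] by (rule conjI)
  qed
qed

end
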